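(* Let $\Bbbk$ be an infinite field, $\mathcal{P}=\Bbbk[x_1,\dots,x_n]$, and let $\mathcal{I}=\langle f_1,\dots,f_k\rangle\subset\mathcal{P}$ be a proper ideal generated by nonzero homogeneous polynomials $f_i$ of degrees $d_i=\deg(f_i)$ with $d_1\ge d_2\ge\cdots\ge d_k$. If $\mathcal{I}$ has dimension $D=\dim(\mathcal{P}/\mathcal{I})$, then $$\deg(\mathcal{I})\le d_1\cdots d_{n-D}.$$
   Context: $D=\dim(\mathcal{I})$ is the Krull dimension of $\mathcal{P}/\mathcal{I}$ (so $k\ge n-D$). The degree $\deg(\mathcal{I})$ is $(D-1)!$ times the leading coefficient of the Hilbert polynomial of $\mathcal{P}/\mathcal{I}$ if $D>0$, and $\dim_{\Bbbk}(\mathcal{P}/\mathcal{I})$ (the sum of the coefficients of the Hilbert series of $\mathcal{P}/\mathcal{I}$) if $D=0$. *)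

theory Defs
  imports
    "HOL-Library.Poly_Mapping"
    "HOL-Library.Extended_Nat"
    "HOL-Algebra.QuotRing"
    "HOL-Algebra.Embedded_Algebras"
    "HOL-Computational_Algebra.Polynomial"
begin

text \<open>
  A monomial is a finitely supported exponent vector and a polynomial a finitely supported
  function from monomials to coefficients.  The type admits infinitely many variables, so the
  number of variables is fixed by the carrier of the ring.
\<close>

type_synonym 'k mpoly = "(nat \<Rightarrow>\<^sub>0 nat) \<Rightarrow>\<^sub>0 'k"

definition mpoly_ring :: "nat \<Rightarrow> ('k::field) mpoly ring"
  where "mpoly_ring n =
    \<lparr>carrier = {p. \<forall>m \<in> Poly_Mapping.keys p. Poly_Mapping.keys m \<subseteq> {1..n}},
     monoid.mult = (*), one = 1, zero = 0, add = (+)\<rparr>"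

lemma mpoly_ring_cring: "cring (mpoly_ring n :: ('k::field) mpoly ring)"
proof (rule cringI)
  let ?R = "mpoly_ring n :: 'k mpoly ring"
  have carrier: "p \<in> carrier ?R \<longleftrightarrow>
      (\<forall>m \<in> Poly_Mapping.keys p. Poly_Mapping.keys m \<subseteq> {1..n})" for p
    by (simp add: mpoly_ring_def)
  have ops: "p \<oplus>\<^bsub>?R\<^esub> q = p + q" "p \<otimes>\<^bsub>?R\<^esub> q = p * q" "\<zero>\<^bsub>?R\<^esub> = 0" "\<one>\<^bsub>?R\<^esub> = 1" for p q
    by (simp_all add: mpoly_ring_def)
  have add: "p + q \<in> carrier ?R" if "p \<in> carrier ?R" "q \<in> carrier ?R" for p q
    using that Poly_Mapping.keys_add[of p q] unfolding carrier by blast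
  have neg: "- p \<in> carrier ?R" if "p \<in> carrier ?R" for p
    using that unfolding carrier by simp
  have mult: "p * q \<in> carrier ?R" if p: "p \<in> carrier ?R" and q: "q \<in> carrier ?R" for p q
    unfolding carrier
  proof
    fix m assume "m \<in> Poly_Mapping.keys (p * q)"
    then obtain a b where "m = a + b" "a \<in> Poly_Mapping.keys p" "b \<in> Poly_Mapping.keys q"
      using Poly_Mapping.keys_mult[of p q] by blast
    then show "Poly_Mapping.keys m \<subseteq> {1..n}"
      using p q Poly_Mapping.keys_add[of a b] unfolding carrier by blast
  qed
  have zero: "0 \<in> carrier ?R" and one: "1 \<in> carrier ?R"
    unfolding carrier by simp_all
  show "abelian_group ?R"
  proof (rule abelian_groupI)
    show "\<exists>q \<in> carrier ?R. q \<oplus>\<^bsub>?R\<^esub> p = \<zero>\<^bsub>?R\<^esub>" if "p \<in> carrier ?R" for p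
      using neg[OF that] unfolding ops by (intro bexI[of _ "- p"]) simp_all
  qed (simp_all add: ops add zero ac_simps)
  show "comm_monoid ?R"
    by (rule comm_monoidI) (simp_all add: ops mult one ac_simps)
  show "(x \<oplus>\<^bsub>?R\<^esub> y) \<otimes>\<^bsub>?R\<^esub> z = x \<otimes>\<^bsub>?R\<^esub> z \<oplus>\<^bsub>?R\<^esub> y \<otimes>\<^bsub>?R\<^esub> z" for x y z
    unfolding ops by (rule distrib_right)
qed

definition monom_degree :: "(nat \<Rightarrow>\<^sub>0 nat) \<Rightarrow> nat"
  where "monom_degree m = (\<Sum>i \<in> Poly_Mapping.keys m. Poly_Mapping.lookup m i)"

text \<open>The zero polynomial gets total degree 0.\<close>

definition total_degree :: "('k::zero) mpoly \<Rightarrow> nat"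
  where "total_degree p = Max (insert 0 (monom_degree ` Poly_Mapping.keys p))"

definition homogeneous :: "('k::zero) mpoly \<Rightarrow> bool"
  where "homogeneous p \<longleftrightarrow> (\<exists>d. \<forall>m \<in> Poly_Mapping.keys p. monom_degree m = d)"

definition homogeneous_component :: "nat \<Rightarrow> nat \<Rightarrow> ('k::field) mpoly set"
  where "homogeneous_component n d =
    {p \<in> carrier (mpoly_ring n). \<forall>m \<in> Poly_Mapping.keys p. monom_degree m = d}"

text \<open>
  A chain with \<open>l\<close> strict inclusions (\<open>l + 1\<close> primes) has length \<open>l\<close>.  The zero ring, which has no
  prime ideals, gets dimension 0 here; it arises only as the quotient by the whole ring.
\<close>

definition krull_dim :: "('a, 'b) ring_scheme \<Rightarrow> enat"
  where "krull_dim R = Sup {enat l | l. \<exists>p :: nat \<Rightarrow> 'a set.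
    (\<forall>i \<le> l. primeideal (p i) R) \<and> (\<forall>i < l. p i \<subset> p (Suc i))}"

text \<open>
  The ground field embedded in the quotient by \<open>I\<close>, i.e. the set of cosets of the constants.
  Dimensions over it are taken with \<^const>\<open>ring.dim\<close>.
\<close>

definition quot_consts :: "nat \<Rightarrow> ('k::field) mpoly set \<Rightarrow> 'k mpoly set set"
  where "quot_consts n I =
    {I +>\<^bsub>mpoly_ring n\<^esub> Poly_Mapping.single 0 c | c. True}"

text \<open>
  For a homogeneous ideal \<open>I\<close> the degree \<open>d\<close> part of the quotient is the image of the forms of
  degree \<open>d\<close>.
\<close>

definition hilbert_function :: "nat \<Rightarrow> ('k::field) mpoly set \<Rightarrow> nat \<Rightarrow> nat"
  where "hilbert_function n I d =
    ring.dim (mpoly_ring n Quot I) (quot_consts n I)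
      ((\<lambda>p. I +>\<^bsub>mpoly_ring n\<^esub> p) ` homogeneous_component n d)"

definition hilbert_polynomial :: "nat \<Rightarrow> ('k::field) mpoly set \<Rightarrow> rat poly"
  where "hilbert_polynomial n I = (THE h.
    \<forall>\<^sub>F d in sequentially. of_nat (hilbert_function n I d) = poly h (of_nat d))"

definition ideal_degree :: "nat \<Rightarrow> ('k::field) mpoly set \<Rightarrow> rat"
  where "ideal_degree n I =
    (let D = the_enat (krull_dim (mpoly_ring n Quot I)) in
      if D > 0 then fact (D - 1) * lead_coeff (hilbert_polynomial n I)
      else of_nat (ring.dim (mpoly_ring n Quot I) (quot_consts n I)
        (carrier (mpoly_ring n Quot I))))"

end

theory Submission
  imports Defs
begin

text \<open>
  A graded prime of maximal growth above a homogeneous ideal gives chains of primes whose length is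
  one more than the degree of the Hilbert polynomial, and comparing the growth of the filtered
  quotients along any chain of primes shows that no longer chain exists; so the Krull dimension is
  read off the Hilbert polynomial.  Prime avoidance over the infinite field yields \<open>g\<^sub>1, \<dots>, g\<^sub>c\<close> in
  the ideal, \<open>c = n - D\<close>, with \<open>g\<^sub>j\<close> of degree \<open>d\<^sub>j\<close>, each lowering the dimension by one.  Such a
  system of parameters is a regular sequence, so the degree of the ideal it generates is exactly
  \<open>d\<^sub>1 \<cdots> d\<^sub>c\<close>, and the degree can only drop when passing to a larger ideal of the same dimension.
\<close>

section \<open>Linear algebra\<close>

text \<open>The obstacle is that a system of parameters has to be a regular sequence. This is
  transported from the variables, for which it is visible on monomials: in a full system of
  \<open>n\<close> parameters one member can be exchanged at a time, because in dimension one the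
  presence of some regular form of positive degree forces every parameter to be regular by a
  dimension count. Exchange needs full systems, so the \<open>c\<close> chosen forms are first
  completed by generic linear forms. The descending order of the degrees enters in the avoidance
  step: the \<open>j\<close>-th parameter is the \<open>j\<close>-th generator plus a form of the
  same degree in the ideal of the later generators, and a generator has multiples in that degree
  only if its own degree is not larger. Krull dimension quantifies over all primes, also
  inhomogeneous ones, so its upper bound is counted in the filtration \<open>P_le\<close>; the rest
  of the argument lives on graded pieces. Homogeneous ideals are families of finite-dimensional
  subspaces of polynomials, and quotients enter as differences of dimensions, to be translated into
  actual quotient rings only at the end.\<close>

locale coeff_space = vector_space
begin

text \<open>\<open>dim\<close> is 0 on an infinite-dimensional set, and the polynomial type has
  infinitely many variables, so every comparison of dimensions needs this side condition.\<close>

definition fin_dim :: "'b set \<Rightarrow> bool"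
  where "fin_dim S \<longleftrightarrow> (\<exists>B. finite B \<and> S \<subseteq> span B)"

lemma fin_dim_subset: "S \<subseteq> T \<Longrightarrow> fin_dim T \<Longrightarrow> fin_dim S"
  unfolding fin_dim_def by blast

lemma fin_dim_span: "finite B \<Longrightarrow> fin_dim (span B)"
  unfolding fin_dim_def by blast

lemma fin_dim_basis:
  assumes "subspace S" "fin_dim S"
  obtains B where "finite B" "B \<subseteq> S" "independent B" "span B = S" "card B = dim S"
proof -
  obtain B where B: "B \<subseteq> S" "independent B" "S \<subseteq> span B" "card B = dim S"
    using basis_exists by blast
  obtain C where C: "finite C" "S \<subseteq> span C"
    using assms(2) unfolding fin_dim_def by blast
  have "finite B"
    using independent_span_bound[OF C(1) B(2)] B(1) C(2) by blast
  moreover have "span B = S"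
    using span_subspace[OF B(1) B(3) assms(1)] .
  ultimately show thesis
    using that B by blast
qed

lemma dim_mono_fin_dim:
  assumes "S \<subseteq> T" "fin_dim T"
  shows "dim S \<le> dim T"
proof -
  obtain C where C: "finite C" "span T \<subseteq> span C"
    using assms(2) unfolding fin_dim_def by (metis span_minimal subspace_span)
  then have "fin_dim (span T)"
    unfolding fin_dim_def by blast
  then obtain B where B: "finite B" "span B = span T" "card B = dim (span T)"
    using fin_dim_basis[OF subspace_span] by metis
  have "S \<subseteq> span B"
    using B(2) assms(1) span_superset by blast
  then have "dim S \<le> card B"
    using dim_le_card B(1) by blast
  then show ?thesis
    using B(3) by simp
qed

lemma span_insert_span: "span (insert v (span B)) = span (insert v B)"
  by (subst (1 2) insert_is_Un) (simp only: span_Un span_span)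

lemma dim_insert_fin_dim:
  assumes "subspace S" "fin_dim S" "v \<notin> S"
  shows "dim (span (insert v S)) = Suc (dim S)"
proof -
  obtain B where B: "finite B" "B \<subseteq> S" "independent B" "span B = S" "card B = dim S"
    using fin_dim_basis[OF assms(1,2)] by metis
  have "independent (insert v B)"
    using B(3,4) assms(3) by (simp add: independent_insertI)
  moreover have "span (insert v B) = span (insert v S)"
    using B(4) span_insert_span by metis
  moreover have "v \<notin> B"
    using B(2) assms(3) by blast
  ultimately show ?thesis
    using dim_eq_card[of "insert v B" "span (insert v S)"] B(1,5) by (simp add: span_span)
qed

lemma subspace_eq_if_dim_ge:
  assumes "subspace S" "subspace T" "S \<subseteq> T" "fin_dim T" "dim T \<le> dim S"
  shows "S = T"
proof (rule ccontr)
  assume "S \<noteq> T"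
  then obtain v where v: "v \<in> T" "v \<notin> S"
    using assms(3) by blast
  have "span (insert v S) \<subseteq> T"
    using v assms(2,3) by (simp add: span_minimal)
  then have "dim (span (insert v S)) \<le> dim T"
    using dim_mono_fin_dim assms(4) by blast
  then show False
    using dim_insert_fin_dim[OF assms(1) fin_dim_subset[OF assms(3,4)] v(2)] assms(5) by simp
qed

lemma dim_zero: "dim {0} = 0"
  using dim_eq_card[of "{}" "{0}"] independent_empty by simp

lemma fin_dim_sum_image:
  assumes f: "Vector_Spaces.linear scale scale f" and "subspace A" "fin_dim A" "subspace U" "fin_dim U"
  shows "subspace {a + f u |a u. a \<in> A \<and> u \<in> U}" "fin_dim {a + f u |a u. a \<in> A \<and> u \<in> U}"
proof -
  interpret f: Vector_Spaces.linear scale scale f by (rule f)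
  have eq: "{a + f u |a u. a \<in> A \<and> u \<in> U} = {x + y |x y. x \<in> A \<and> y \<in> f ` U}"
    by blast
  have s: "subspace (f ` U)"
    by (rule f.subspace_image[OF assms(4)])
  show "subspace {a + f u |a u. a \<in> A \<and> u \<in> U}"
    unfolding eq by (rule subspace_sums[OF assms(2) s])
  obtain B where B: "finite B" "span B = A"
    using fin_dim_basis[OF assms(2,3)] by metis
  obtain C where C: "finite C" "span C = U"
    using fin_dim_basis[OF assms(4,5)] by metis
  have "{x + y |x y. x \<in> A \<and> y \<in> f ` U} = span (B \<union> f ` C)"
    unfolding span_Un B(2) f.span_image C(2) by blast
  then show "fin_dim {a + f u |a u. a \<in> A \<and> u \<in> U}"
    unfolding eq using B(1) C(1) by (simp add: fin_dim_span)
qed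

text \<open>Rank-nullity for the map \<open>U \<rightarrow> V / A\<close> induced by \<open>f\<close>.\<close>

lemma dim_sum_image:
  assumes f: "Vector_Spaces.linear scale scale f" and A: "subspace A" "fin_dim A" and U: "subspace U" "fin_dim U"
  shows "dim {a + f u |a u. a \<in> A \<and> u \<in> U} + dim {u \<in> U. f u \<in> A} = dim A + dim U"
proof -
  interpret f: Vector_Spaces.linear scale scale f by (rule f)
  define S where "S U = {a + f u |a u. a \<in> A \<and> u \<in> U}" for U
  define K where "K U = {u \<in> U. f u \<in> A}" for U
  obtain B where B: "finite B" "span B = U"
    using fin_dim_basis[OF U] by metis
  \<comment> \<open>Induction over a spanning set: a new vector outside the span so far enlarges
    exactly one of the sum \<open>S\<close> and the kernel \<open>K\<close>, by one
    dimension.\<close>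
  have "dim (S (span B)) + dim (K (span B)) = dim A + dim (span B)"
    using B(1)
  proof (induction B)
    case empty
    have "S {0} = A" unfolding S_def by (auto simp: f.zero)
    moreover have "K {0} = {0}" unfolding K_def using subspace_0[OF A(1)] by (auto simp: f.zero)
    ultimately show ?case by simp
  next
    case (insert b B)
    let ?U = "span B" and ?U' = "span (insert b B)"
    have ss: "subspace (S V)" "fin_dim (S V)" "subspace (K V)" "fin_dim (K V)"
      if "subspace V" "fin_dim V" for V
    proof -
      show "subspace (S V)" "fin_dim (S V)"
        unfolding S_def using fin_dim_sum_image[OF f A that] by auto
      have "K V = V \<inter> {u. f u \<in> A}" unfolding K_def by blast
      then show "subspace (K V)"
        using subspace_inter[OF that(1) f.subspace_linear_preimage[OF A(1)]] by simp
      show "fin_dim (K V)"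
        by (rule fin_dim_subset[OF _ that(2)]) (auto simp: K_def)
    qed
    have su: "subspace ?U" "fin_dim ?U" "subspace ?U'" "fin_dim ?U'"
      using insert(1) by (auto intro!: fin_dim_span)
    note s = ss[OF su(1,2)] and s' = ss[OF su(3,4)]
    show ?case
    proof (cases "b \<in> ?U")
      case True
      then show ?thesis using insert.IH by (simp add: span_redundant)
    next
      case False
      have U': "?U' = span (insert b ?U)"
        by (simp add: span_insert_span)
      have dU: "dim ?U' = Suc (dim ?U)"
        unfolding U' by (rule dim_insert_fin_dim[OF su(1,2) False])
      have SU: "S ?U \<subseteq> S ?U'" "K ?U \<subseteq> K ?U'"
        using span_mono[of B "insert b B"] unfolding S_def K_def by blast+
      show ?thesis
      proof (cases "f b \<in> S ?U")
        case True
        then obtain a u where au: "a \<in> A" "u \<in> ?U" "f b = a + f u"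
          unfolding S_def by blast
        have "S ?U' \<subseteq> S ?U"
        proof
          fix x assume "x \<in> S ?U'"
          then obtain a' w where w: "a' \<in> A" "w \<in> ?U'" "x = a' + f w" unfolding S_def by blast
          then obtain k where k: "w - k *s b \<in> ?U" using span_breakdown_eq by blast
          have "x = (a' + k *s a) + f ((w - k *s b) + k *s u)"
            using w(3) au(3) by (simp add: f.add f.diff f.scale scale_right_distrib)
          moreover have "a' + k *s a \<in> A" using A(1) au(1) w(1) by (simp add: subspace_add subspace_scale)
          moreover have "(w - k *s b) + k *s u \<in> ?U" using k au(2) by (simp add: span_add span_scale)
          ultimately show "x \<in> S ?U" unfolding S_def by blast
        qed
        then have dS: "S ?U' = S ?U" using SU by blast
        \<comment> \<open>Because \<open>f b = a + f u\<close>, the vector \<open>b - u\<close> is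
          the one new kernel element.\<close>
        have bu: "b - u \<notin> K ?U"
        proof
          assume "b - u \<in> K ?U"
          then have "b - u \<in> ?U" unfolding K_def by blast
          then have "(b - u) + u \<in> ?U" using au(2) span_add by blast
          then show False using False by simp
        qed
        have "K ?U' = span (insert (b - u) (K ?U))"
        proof
          show "span (insert (b - u) (K ?U)) \<subseteq> K ?U'"
          proof (rule span_minimal[OF _ s'(3)])
            have "b - u \<in> ?U'"
              using au(2) span_mono[of B "insert b B"] by (blast intro: span_base span_diff)
            moreover have "f (b - u) \<in> A" using au by (simp add: f.diff)
            ultimately show "insert (b - u) (K ?U) \<subseteq> K ?U'"
              using SU unfolding K_def by blast
          qed
          show "K ?U' \<subseteq> span (insert (b - u) (K ?U))"
          proof
            fix w assume w: "w \<in> K ?U'"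
            then obtain k where k: "w - k *s b \<in> ?U" using span_breakdown_eq unfolding K_def by blast
            have "w - k *s (b - u) = (w - k *s b) + k *s u" by (simp add: scale_right_diff_distrib)
            then have 1: "w - k *s (b - u) \<in> ?U"
              using span_add[OF k span_scale[OF au(2)]] by (simp only:)
            have "f w \<in> A" using w unfolding K_def by blast
            moreover have "f (b - u) \<in> A" using au by (simp add: f.diff)
            ultimately have "f w - k *s f (b - u) \<in> A"
              using A(1) by (intro subspace_diff subspace_scale)
            moreover have "f (w - k *s c) = f w - k *s f c" for c
              by (simp add: f.diff f.scale)
            ultimately have "f (w - k *s (b - u)) \<in> A" by (simp only:)
            then have "w - k *s (b - u) \<in> K ?U" using 1 unfolding K_def by blast
            then show "w \<in> span (insert (b - u) (K ?U))"
              unfolding span_breakdown_eq using span_base by blast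
          qed
        qed
        then have "dim (K ?U') = Suc (dim (K ?U))"
          using dim_insert_fin_dim[OF s(3,4) bu] by simp
        then show ?thesis using insert.IH dS dU by simp
      next
        case nS: False
        have "S ?U' = span (insert (f b) (S ?U))"
        proof
          have "f b = 0 + f b" by simp
          moreover have "b \<in> ?U'" by (simp add: span_base)
          ultimately have "f b \<in> S ?U'"
            unfolding S_def using subspace_0[OF A(1)] by blast
          then show "span (insert (f b) (S ?U)) \<subseteq> S ?U'"
            using SU by (intro span_minimal[OF _ s'(1)]) blast
          show "S ?U' \<subseteq> span (insert (f b) (S ?U))"
          proof
            fix x assume "x \<in> S ?U'"
            then obtain a' w where w: "a' \<in> A" "w \<in> ?U'" "x = a' + f w" unfolding S_def by blast
            then obtain k where k: "w - k *s b \<in> ?U" using span_breakdown_eq by blast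
            have "x - k *s f b = a' + f (w - k *s b)" using w by (simp add: f.diff f.scale)
            then have "x - k *s f b \<in> S ?U" unfolding S_def using k w(1) by blast
            then show "x \<in> span (insert (f b) (S ?U))"
              unfolding span_breakdown_eq using span_base by blast
          qed
        qed
        then have dS: "dim (S ?U') = Suc (dim (S ?U))"
          using dim_insert_fin_dim[OF s(1,2) nS] by simp
        have "K ?U' \<subseteq> K ?U"
        proof
          fix w assume w: "w \<in> K ?U'"
          then obtain k where k: "w - k *s b \<in> ?U" using span_breakdown_eq unfolding K_def by blast
          \<comment> \<open>A nonzero coefficient of \<open>b\<close> would put \<open>f b\<close>
            into the old sum.\<close>
          have "k = 0"
          proof (rule ccontr)
            assume k0: "k \<noteq> 0"
            have "k *s f b = f w + f (- (w - k *s b))" by (simp add: f.diff f.scale f.neg)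
            moreover have "f w \<in> A" using w unfolding K_def by blast
            moreover have "- (w - k *s b) \<in> ?U" using k span_neg by blast
            ultimately have "k *s f b \<in> S ?U" unfolding S_def by blast
            then have "inverse k *s (k *s f b) \<in> S ?U" using s(1) subspace_scale by blast
            then show False using nS k0 by simp
          qed
          then show "w \<in> K ?U" using w k unfolding K_def by simp
        qed
        then have "K ?U' = K ?U" using SU by blast
        then show ?thesis using insert.IH dS dU by simp
      qed
    qed
  qed
  then show ?thesis unfolding S_def K_def B(2) .
qed

text \<open>On a line through two points, each subspace not containing the line has at most one point, so
  infinitely many scalars are enough to avoid finitely many subspaces.\<close>

lemma avoid_subspaces:
  assumes "infinite (UNIV :: 'a set)" "finite \<Q>" "\<And>Q. Q \<in> \<Q> \<Longrightarrow> subspace Q" "subspace W"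
    "\<And>Q. Q \<in> \<Q> \<Longrightarrow> \<exists>w\<in>W. f + w \<notin> Q"
  shows "\<exists>w\<in>W. \<forall>Q\<in>\<Q>. f + w \<notin> Q"
  using assms(2,3,5)
proof (induction \<Q>)
  case empty
  then show ?case using subspace_0[OF assms(4)] by blast
next
  case (insert Q \<Q>)
  have "\<exists>w\<in>W. \<forall>Q\<in>\<Q>. f + w \<notin> Q"
    by (rule insert.IH) (use insert.prems in auto)
  then obtain w0 where w0: "w0 \<in> W" "\<And>R. R \<in> \<Q> \<Longrightarrow> f + w0 \<notin> R" by blast
  obtain w1 where w1: "w1 \<in> W" "f + w1 \<notin> Q" using insert.prems(2) by blast
  show ?case
  proof (cases "f + w0 \<in> Q")
    case False
    then show ?thesis using w0 by blast
  next
    case True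
    \<comment> \<open>The bad scalars on the line from \<open>f + w0\<close> (scalar 0) to
      \<open>f + w1\<close> (scalar 1). \<open>w1\<close> avoids \<open>Q\<close> and
      \<open>w0\<close> avoids all the others, so no subspace contains both points.\<close>
    define B where "B R = {c. f + w0 + c *s (w1 - w0) \<in> R}" for R
    have sub: "subspace R" if "R \<in> insert Q \<Q>" for R using insert.prems(1) that by blast
    have one: "c = c'"
      if R: "R \<in> insert Q \<Q>" and c: "c \<in> B R" "c' \<in> B R" and nR: "\<not> (f + w0 \<in> R \<and> f + w1 \<in> R)" for R c c'
    proof (rule ccontr)
      assume ne: "c \<noteq> c'"
      have "(f + w0 + c *s (w1 - w0)) - (f + w0 + c' *s (w1 - w0)) \<in> R"
        using c subspace_diff[OF sub[OF R]] unfolding B_def by blast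
      then have "(c - c') *s (w1 - w0) \<in> R" by (simp add: scale_left_diff_distrib)
      then have "inverse (c - c') *s ((c - c') *s (w1 - w0)) \<in> R"
        by (rule subspace_scale[OF sub[OF R]])
      then have d: "w1 - w0 \<in> R" using ne by (simp only: scale_scale) simp
      have "(f + w0 + c *s (w1 - w0)) - c *s (w1 - w0) \<in> R"
        using c(1) d subspace_diff[OF sub[OF R]] subspace_scale[OF sub[OF R]] unfolding B_def by blast
      then have 0: "f + w0 \<in> R" by simp
      have "(f + w0) + (w1 - w0) \<in> R" using subspace_add[OF sub[OF R] 0 d] .
      then have "f + w1 \<in> R" by simp
      then show False using 0 nR by blast
    qed
    have "finite (B R)" if R: "R \<in> insert Q \<Q>" for R
    proof -
      have nR: "\<not> (f + w0 \<in> R \<and> f + w1 \<in> R)" using R w0(2) w1(2) by blast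
      show ?thesis
      proof (cases "B R = {}")
        case False
        then obtain c where c: "c \<in> B R" by blast
        have "B R \<subseteq> {c}" using one[OF R _ c nR] by blast
        then show ?thesis using finite_subset by blast
      qed simp
    qed
    then have "finite (\<Union>R\<in>insert Q \<Q>. B R)" using insert.hyps(1) by blast
    then obtain c where c: "c \<notin> (\<Union>R\<in>insert Q \<Q>. B R)"
      using assms(1) by (metis finite_subset subset_UNIV UNIV_eq_I)
    have "w0 + c *s (w1 - w0) \<in> W"
      using w0(1) w1(1) assms(4) by (simp add: subspace_add subspace_diff subspace_scale)
    moreover have "f + (w0 + c *s (w1 - w0)) \<notin> R" if "R \<in> insert Q \<Q>" for R
      using c that unfolding B_def by (auto simp: add.assoc)
    ultimately show ?thesis by blast
  qed
qed

end

section \<open>Graded ideals\<close>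

abbreviation "keys \<equiv> Poly_Mapping.keys"
abbreviation "lookup \<equiv> Poly_Mapping.lookup"
abbreviation "single \<equiv> Poly_Mapping.single"

definition scl :: "'k::field \<Rightarrow> 'k mpoly \<Rightarrow> 'k mpoly"
  where "scl c p = single 0 c * p"

interpretation sp: coeff_space "scl :: 'k::field \<Rightarrow> 'k mpoly \<Rightarrow> 'k mpoly"
  by unfold_locales
    (simp_all add: scl_def distrib_left distrib_right single_add mult_single flip: mult.assoc)

lemma scl_mult_right: "p * scl c q = scl c (p * q)"
  by (simp add: scl_def ac_simps)

lemma linear_mult: "Vector_Spaces.linear scl scl (\<lambda>z. x * z)"
  by unfold_locales (simp_all add: distrib_left scl_mult_right)

lemma lookup_scl: "lookup (scl c p) m = c * lookup p m"
proof -
  have "scl c p = Poly_Mapping.map ((*) c) p"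
    unfolding scl_def by (rule mult_map_scale_conv_mult[symmetric])
  then show ?thesis by (simp add: Poly_Mapping.map.rep_eq when_def)
qed

lemma mpoly_eq_sum_monomials:
  "p = (\<Sum>m\<in>keys p. single m (lookup p m))"
  by (rule poly_mapping_eqI)
    (auto simp: lookup_sum lookup_single when_def in_keys_iff)

lemma monom_degree_superset:
  assumes "finite A" "keys m \<subseteq> A"
  shows "monom_degree m = (\<Sum>i\<in>A. lookup m i)"
  unfolding monom_degree_def using assms
  by (intro sum.mono_neutral_left) (auto simp: in_keys_iff)

lemma monom_degree_add: "monom_degree (a + b) = monom_degree a + monom_degree b"
proof -
  let ?A = "keys a \<union> keys b"
  have "keys (a + b) \<subseteq> ?A" by (rule keys_add)
  then show ?thesis
    by (simp add: monom_degree_superset[of ?A] lookup_add sum.distrib)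
qed

lemma monom_degree_0 [simp]: "monom_degree 0 = 0"
  by (simp add: monom_degree_def)

lemma monom_degree_single [simp]: "monom_degree (single i k) = k"
  by (simp add: monom_degree_def)

lemma monom_degree_eq_0_iff: "monom_degree m = 0 \<longleftrightarrow> m = 0"
  by (auto simp: monom_degree_def in_keys_iff intro!: poly_mapping_eqI)

lemma finite_monomials: "finite {m. keys m \<subseteq> {1..n} \<and> monom_degree m \<le> d}"
proof (rule finite_subset)
  let ?F = "{1..n} \<rightarrow>\<^sub>E {..d}"
  show "{m. keys m \<subseteq> {1..n} \<and> monom_degree m \<le> d}
    \<subseteq> (\<lambda>g. Poly_Mapping.Abs_poly_mapping (\<lambda>i. if i \<in> {1..n} then g i else 0)) ` ?F"
  proof
    fix m assume m: "m \<in> {m. keys m \<subseteq> {1..n} \<and> monom_degree m \<le> d}"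
    have "lookup m i \<le> d" if "i \<in> {1..n}" for i
    proof -
      have "lookup m i \<le> (\<Sum>i\<in>{1..n}. lookup m i)"
        using that by (intro member_le_sum) auto
      also have "\<dots> = monom_degree m" using m by (intro monom_degree_superset[symmetric]) auto
      finally show ?thesis using m by simp
    qed
    then have "restrict (lookup m) {1..n} \<in> ?F" by auto
    moreover have "(\<lambda>i. if i \<in> {1..n} then restrict (lookup m) {1..n} i else 0)
        = lookup m"
      using m by (auto simp: fun_eq_iff in_keys_iff)
    then have "m = Poly_Mapping.Abs_poly_mapping
        (\<lambda>i. if i \<in> {1..n} then restrict (lookup m) {1..n} i else 0)"
      by (simp add: Poly_Mapping.lookup_inverse)
    ultimately show "m \<in> (\<lambda>g. Poly_Mapping.Abs_poly_mapping
        (\<lambda>i. if i \<in> {1..n} then g i else 0)) ` ?F" by blast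
  qed
  show "finite ((\<lambda>g. Poly_Mapping.Abs_poly_mapping (\<lambda>i. if i \<in> {1..n} then g i else 0)) ` ?F)"
    by (intro finite_imageI finite_PiE) auto
qed

lemma mpoly_ring_ring: "ring (mpoly_ring n :: ('k::field) mpoly ring)"
  by (rule cring.axioms(1)[OF mpoly_ring_cring])

lemma mpoly_ring_simps:
  "x \<oplus>\<^bsub>mpoly_ring n\<^esub> y = x + y" "x \<otimes>\<^bsub>mpoly_ring n\<^esub> y = x * y"
  "\<zero>\<^bsub>mpoly_ring n\<^esub> = 0" "\<one>\<^bsub>mpoly_ring n\<^esub> = 1"
  by (simp_all add: mpoly_ring_def)

type_synonym 'k family = "nat \<Rightarrow> 'k mpoly set"

locale poly_vars =
  fixes n :: nat
begin

abbreviation P :: "'k::field family"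
  where "P \<equiv> homogeneous_component n"

text \<open>The filtration by total degree serves for ideals that are not homogeneous, whose graded
  pieces say nothing about their size.\<close>

definition P_le :: "'k::field family"
  where "P_le d = {p. \<forall>m\<in>keys p. keys m \<subseteq> {1..n} \<and> monom_degree m \<le> d}"

lemma P_iff: "p \<in> P d \<longleftrightarrow>
    (\<forall>m\<in>keys p. keys m \<subseteq> {1..n} \<and> monom_degree m = d)"
  by (auto simp: homogeneous_component_def mpoly_ring_def)

lemma subspace_keys: "sp.subspace {p. \<forall>m\<in>keys p. Q m}"
proof -
  have "keys (scl c p) \<subseteq> keys p" for c and p :: "'a mpoly"
    by (auto simp: in_keys_iff lookup_scl)
  moreover have "keys (p + q) \<subseteq> keys p \<union> keys q" for p q :: "'a mpoly"
    by (rule keys_add)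
  ultimately show ?thesis
    by (intro sp.subspaceI) (simp, blast+)
qed

lemma fin_dim_keys:
  assumes "finite {m. Q m}"
  shows "sp.fin_dim {p. \<forall>m\<in>keys p. Q m}"
proof -
  let ?B = "(\<lambda>m. single m 1) ` {m. Q m}"
  have "p \<in> sp.span ?B" if p: "\<forall>m\<in>keys p. Q m" for p :: "'a mpoly"
  proof -
    have "single m c = scl c (single m 1)" for m and c :: 'a
      by (simp add: scl_def mult_single)
    moreover have "scl (lookup p m) (single m 1) \<in> sp.span ?B"
      if "m \<in> keys p" for m
      using that p by (intro sp.span_scale sp.span_base) blast
    ultimately have "(\<Sum>m\<in>keys p. single m (lookup p m))
        \<in> sp.span ?B"
      by (intro sp.span_sum) metis
    then show ?thesis using mpoly_eq_sum_monomials[of p] by simp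
  qed
  then show ?thesis
    unfolding sp.fin_dim_def using assms by (intro exI[of _ ?B]) auto
qed

lemma subspace_memI:
  assumes "sp.subspace S"
    and "\<And>m c. m \<in> keys p \<Longrightarrow> single m c \<in> S"
  shows "p \<in> S"
  by (subst mpoly_eq_sum_monomials) (intro sp.subspace_sum[OF assms(1)] assms(2))

lemma subspace_P: "sp.subspace (P d)"
proof -
  have eq: "P d = {p. \<forall>m\<in>keys p. keys m \<subseteq> {1..n} \<and> monom_degree m = d}"
    using P_iff by blast
  show ?thesis unfolding eq by (rule subspace_keys)
qed

lemma fin_dim_P: "sp.fin_dim (P d)"
proof -
  have eq: "P d = {p. \<forall>m\<in>keys p. keys m \<subseteq> {1..n} \<and> monom_degree m = d}"
    using P_iff by blast
  have "finite {m. keys m \<subseteq> {1..n} \<and> monom_degree m = d}"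
    by (rule finite_subset[OF _ finite_monomials[of n d]]) auto
  then show ?thesis unfolding eq by (rule fin_dim_keys)
qed

lemma subspace_P_le: "sp.subspace (P_le d)"
  unfolding P_le_def by (rule subspace_keys)

lemma fin_dim_P_le: "sp.fin_dim (P_le d)"
  unfolding P_le_def by (rule fin_dim_keys[OF finite_monomials])

lemma keys_mult_cases:
  assumes "m \<in> keys (p * q)"
  obtains a b where "a \<in> keys p" "b \<in> keys q" "m = a + b"
    "monom_degree m = monom_degree a + monom_degree b"
    "keys m \<subseteq> keys a \<union> keys b"
proof -
  obtain a b where ab: "a \<in> keys p" "b \<in> keys q" "m = a + b"
    using assms keys_mult[of p q] by blast
  show thesis
    by (rule that[OF ab]) (simp_all add: ab(3) monom_degree_add keys_add)
qed

lemma P_mult: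
  assumes "p \<in> P a" "q \<in> P b"
  shows "p * q \<in> P (a + b)"
  unfolding P_iff
proof
  fix m assume "m \<in> keys (p * q)"
  then show "keys m \<subseteq> {1..n} \<and> monom_degree m = a + b"
    using assms unfolding P_iff by (elim keys_mult_cases) fastforce
qed

lemma P_le_mult:
  assumes "p \<in> P_le a" "q \<in> P_le b"
  shows "p * q \<in> P_le (a + b)"
  unfolding P_le_def
proof (intro CollectI ballI)
  fix m assume "m \<in> keys (p * q)"
  then show "keys m \<subseteq> {1..n} \<and> monom_degree m \<le> a + b"
  proof (rule keys_mult_cases)
    fix a' b' assume "a' \<in> keys p" "b' \<in> keys q"
      and m: "monom_degree m = monom_degree a' + monom_degree b'"
        "keys m \<subseteq> keys a' \<union> keys b'"
    then have "keys a' \<subseteq> {1..n} \<and> monom_degree a' \<le> a"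
      "keys b' \<subseteq> {1..n} \<and> monom_degree b' \<le> b"
      using assms unfolding P_le_def by blast+
    then show ?thesis using m by (metis Un_least add_mono order_trans)
  qed
qed

lemma P_le_mono: "a \<le> b \<Longrightarrow> P_le a \<subseteq> P_le b"
  unfolding P_le_def by fastforce

lemma P_subset_P_le: "d \<le> e \<Longrightarrow> P d \<subseteq> P_le e"
  unfolding P_le_def by (intro subsetI CollectI ballI) (metis P_iff)

lemma single_in_P: "keys m \<subseteq> {1..n} \<Longrightarrow> single m c \<in> P (monom_degree m)"
  unfolding P_iff by simp

lemma const_in_P: "single 0 c \<in> P 0"
  using single_in_P[of 0 c] by simp

lemma one_in_P: "1 \<in> P 0"
  using const_in_P[of 1] by simp

lemma P_power: "x \<in> P a \<Longrightarrow> x ^ k \<in> P (k * a)"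
  by (induction k) (auto simp: one_in_P intro: P_mult)

lemma P_0_const:
  assumes "p \<in> P 0"
  obtains c where "p = single 0 c"
proof
  show "p = single 0 (lookup p 0)"
    using assms unfolding P_iff monom_degree_eq_0_iff
    by (intro poly_mapping_eqI) (auto simp: lookup_single when_def in_keys_iff)
qed

lemma P_add: "p \<in> P d \<Longrightarrow> q \<in> P d \<Longrightarrow> p + q \<in> P d"
  using subspace_P sp.subspace_add by blast

lemma P_diff: "p \<in> P d \<Longrightarrow> q \<in> P d \<Longrightarrow> p - q \<in> P d"
  using subspace_P sp.subspace_diff by blast

lemma P_zero: "0 \<in> P d"
  using subspace_P sp.subspace_0 by blast

text \<open>A homogeneous ideal is represented by the family of its homogeneous parts.\<close>

definition gideal :: "('k::field family) \<Rightarrow> bool"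
  where "gideal J \<longleftrightarrow> (\<forall>d. J d \<subseteq> P d \<and> sp.subspace (J d)) \<and>
    (\<forall>d e. \<forall>p\<in>P e. \<forall>q\<in>J d. p * q \<in> J (e + d))"

text \<open>For a form \<open>x\<close> of degree \<open>a\<close>, these are the ideals \<open>J + (x)\<close> and \<open>J : x\<close>.\<close>

definition adj :: "('k::field family) \<Rightarrow> nat \<Rightarrow> 'k mpoly \<Rightarrow> 'k family"
  where "adj J a x d = (if a \<le> d then {u + x * v |u v. u \<in> J d \<and> v \<in> P (d - a)} else J d)"

definition colon :: "('k::field family) \<Rightarrow> nat \<Rightarrow> 'k mpoly \<Rightarrow> 'k family"
  where "colon J a x d = {z \<in> P d. x * z \<in> J (a + d)}"

text \<open>The Hilbert function of the quotient by \<open>J\<close>, counted without forming the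
  quotient. The truncated subtraction is a true one for a homogeneous ideal, since
  \<open>J d\<close> lies in the finite-dimensional \<open>P d\<close>.\<close>

definition HF :: "('k::field family) \<Rightarrow> nat \<Rightarrow> nat"
  where "HF J d = sp.dim (P d :: 'k mpoly set) - sp.dim (J d)"

lemma adjI: "a \<le> d \<Longrightarrow> u \<in> J d \<Longrightarrow> v \<in> P (d - a) \<Longrightarrow> u + x * v \<in> adj J a x d"
  unfolding adj_def by auto

lemma adj_superset: "p \<in> J d \<Longrightarrow> p \<in> adj J a x d"
  using adjI[of a d p J 0 x] P_zero by (cases "a \<le> d") (auto simp: adj_def)

lemma gidealI:
  assumes "\<And>d. J d \<subseteq> P d" "\<And>d. sp.subspace (J d)"
    "\<And>d e p q. p \<in> P e \<Longrightarrow> q \<in> J d \<Longrightarrow> p * q \<in> J (e + d)"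
  shows "gideal J"
  using assms unfolding gideal_def by blast

context
  fixes J :: "'k::field family"
  assumes J: "gideal J"
begin

lemma gideal_subset: "J d \<subseteq> P d"
  using J unfolding gideal_def by blast

lemma gideal_in_P: "p \<in> J d \<Longrightarrow> p \<in> P d"
  using gideal_subset by blast

lemma gideal_subspace: "sp.subspace (J d)"
  using J unfolding gideal_def by blast

lemma gideal_fin_dim: "sp.fin_dim (J d)"
  using gideal_subset fin_dim_P sp.fin_dim_subset by blast

lemma gideal_mult: "p \<in> P e \<Longrightarrow> q \<in> J d \<Longrightarrow> p * q \<in> J (e + d)"
  using J unfolding gideal_def by blast

lemma gideal_mult_right: "p \<in> P e \<Longrightarrow> q \<in> J d \<Longrightarrow> q * p \<in> J (d + e)"
  using gideal_mult[of p e q d] by (simp add: ac_simps)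

lemma gideal_zero: "0 \<in> J d"
  using gideal_subspace sp.subspace_0 by blast

lemma gideal_add: "p \<in> J d \<Longrightarrow> q \<in> J d \<Longrightarrow> p + q \<in> J d"
  using gideal_subspace sp.subspace_add by blast

lemma gideal_diff: "p \<in> J d \<Longrightarrow> q \<in> J d \<Longrightarrow> p - q \<in> J d"
  using gideal_subspace sp.subspace_diff by blast

lemma gideal_add_left: "p \<in> J d \<Longrightarrow> p + q \<in> J d \<Longrightarrow> q \<in> J d"
  using gideal_diff[of "p + q" d p] by simp

lemma gideal_adj:
  assumes x: "x \<in> P a"
  shows "gideal (adj J a x)"
proof (rule gidealI)
  show "adj J a x d \<subseteq> P d" for d
  proof (cases "a \<le> d")
    case True
    have "u + x * v \<in> P d" if "u \<in> J d" "v \<in> P (d - a)" for u v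
      using P_mult[OF x that(2)] True gideal_in_P[OF that(1)] P_add by simp
    then show ?thesis using True unfolding adj_def by auto
  qed (use gideal_subset in \<open>auto simp: adj_def\<close>)
  show "sp.subspace (adj J a x d)" for d
    unfolding adj_def
    using sp.fin_dim_sum_image(1)[OF linear_mult gideal_subspace gideal_fin_dim subspace_P fin_dim_P]
      gideal_subspace by simp
  show "p * q \<in> adj J a x (e + d)" if p: "p \<in> P e" and q: "q \<in> adj J a x d" for p q d e
  proof (cases "a \<le> d")
    case True
    then obtain u v where uv: "u \<in> J d" "v \<in> P (d - a)" "q = u + x * v"
      using q unfolding adj_def by auto
    have "p * q = p * u + x * (p * v)" using uv by (simp add: algebra_simps)
    moreover have "p * v \<in> P (e + d - a)" using P_mult[OF p uv(2)] True by simp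
    ultimately show ?thesis
      using gideal_mult[OF p uv(1)] True unfolding adj_def by auto
  next
    case False
    then have "p * q \<in> J (e + d)" using q gideal_mult[OF p] unfolding adj_def by simp
    then show ?thesis by (rule adj_superset)
  qed
qed

lemma gideal_colon:
  assumes x: "x \<in> P a"
  shows "gideal (colon J a x)"
proof (rule gidealI)
  show "colon J a x d \<subseteq> P d" for d unfolding colon_def by blast
  show "sp.subspace (colon J a x d)" for d
  proof -
    interpret f: Vector_Spaces.linear scl scl "\<lambda>z. x * z" by (rule linear_mult)
    have "colon J a x d = P d \<inter> {z. x * z \<in> J (a + d)}" unfolding colon_def by blast
    then show ?thesis
      using sp.subspace_inter[OF subspace_P f.subspace_linear_preimage[OF gideal_subspace]] by simp
  qed
  show "p * q \<in> colon J a x (e + d)" if p: "p \<in> P e" and q: "q \<in> colon J a x d" for p q d e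
    using gideal_mult[OF p, of "x * q" "a + d"] P_mult[OF p, of q d] q
    unfolding colon_def by (simp add: ac_simps)
qed

lemma adj_subset: "J \<le> adj J a x"
  by (intro le_funI subsetI adj_superset)

lemma mem_adj: "x \<in> adj J a x a"
  using adjI[of a a 0 J 1 x] gideal_zero one_in_P by simp

lemma subset_colon: "x \<in> P a \<Longrightarrow> J \<le> colon J a x"
  unfolding le_fun_def colon_def using gideal_mult gideal_subset by blast

lemma adj_eq_self: "x \<in> J a \<Longrightarrow> adj J a x = J"
proof (rule ext)
  fix d assume x: "x \<in> J a"
  have "u + x * v \<in> J d" if "a \<le> d" "u \<in> J d" "v \<in> P (d - a)" for u v
    using gideal_add[OF that(2)] gideal_mult_right[OF that(3) x] that(1) by simp
  then show "adj J a x d = J d"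
    using adj_subset[of a x] unfolding adj_def le_fun_def by (auto 0 3)
qed

text \<open>Additivity along \<open>0 \<rightarrow> (R / (J : x))(-a) \<rightarrow> R / J \<rightarrow> R / (J + (x)) \<rightarrow> 0\<close>.\<close>

lemma HF_adj_colon:
  assumes "x \<in> P a" "a \<le> d"
  shows "HF (adj J a x) d + HF (colon J a x) (d - a) = HF J d"
proof -
  have "sp.dim {u + x * v |u v. u \<in> J d \<and> v \<in> P (d - a)} + sp.dim {v \<in> P (d - a). x * v \<in> J d}
      = sp.dim (J d) + sp.dim (P (d - a) :: 'k mpoly set)"
    by (rule sp.dim_sum_image[OF linear_mult gideal_subspace gideal_fin_dim subspace_P fin_dim_P])
  moreover have "sp.dim (adj J a x d) \<le> sp.dim (P d :: 'k mpoly set)"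
    using gideal_adj[OF assms(1)] sp.dim_mono_fin_dim[OF _ fin_dim_P] unfolding gideal_def by blast
  moreover have "sp.dim (colon J a x (d - a)) \<le> sp.dim (P (d - a) :: 'k mpoly set)"
    using gideal_colon[OF assms(1)] sp.dim_mono_fin_dim[OF _ fin_dim_P] unfolding gideal_def by blast
  moreover have "sp.dim (J d) \<le> sp.dim (P d :: 'k mpoly set)"
    by (rule sp.dim_mono_fin_dim[OF gideal_subset fin_dim_P])
  ultimately show ?thesis
    using assms(2) unfolding HF_def adj_def colon_def by simp
qed

lemma HF_antimono:
  assumes "gideal K" "J \<le> K"
  shows "HF K d \<le> HF J d"
proof -
  have "sp.dim (J d) \<le> sp.dim (K d)"
    using sp.dim_mono_fin_dim[of "J d" "K d"] assms fin_dim_P sp.fin_dim_subset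
    unfolding gideal_def le_fun_def by blast
  then show ?thesis unfolding HF_def by simp
qed

lemma HF_le_eq:
  assumes "gideal K" "J \<le> K" "HF J d \<le> HF K d"
  shows "J d = K d"
proof -
  have "sp.dim (K d) \<le> sp.dim (P d :: 'k mpoly set)"
    using assms(1) sp.dim_mono_fin_dim[OF _ fin_dim_P] unfolding gideal_def by blast
  moreover have "sp.dim (J d) \<le> sp.dim (P d :: 'k mpoly set)"
    by (rule sp.dim_mono_fin_dim[OF gideal_subset fin_dim_P])
  ultimately have "sp.dim (K d) \<le> sp.dim (J d)"
    using assms(3) unfolding HF_def by simp
  then show ?thesis
    using assms(1,2) sp.fin_dim_subset[OF _ fin_dim_P, of "K d" d] gideal_subspace
    by (intro sp.subspace_eq_if_dim_ge) (auto simp: gideal_def le_fun_def)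
qed

end

lemma adj_mono: "J \<le> K \<Longrightarrow> adj J a x \<le> adj K a x"
  unfolding le_fun_def adj_def by (simp add: subset_iff) blast

lemma colon_mono: "J \<le> K \<Longrightarrow> colon J a x \<le> colon K a x"
  unfolding le_fun_def colon_def by blast

lemma adj_least: "gideal K \<Longrightarrow> J \<le> K \<Longrightarrow> x \<in> K a \<Longrightarrow> adj J a x \<le> K"
  using adj_mono[of J K a x] adj_eq_self by metis

lemma gideal_P: "gideal P"
  by (rule gidealI) (auto simp: subspace_P P_mult)

lemma gideal_bot: "gideal (\<lambda>_. {0})"
  by (rule gidealI) (auto simp: P_zero)

lemma gideal_Inf:
  assumes "\<And>J. J \<in> \<J> \<Longrightarrow> gideal J" "\<J> \<noteq> {}"
  shows "gideal (\<lambda>d. \<Inter>J\<in>\<J>. J d)"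
proof (rule gidealI)
  show "(\<Inter>J\<in>\<J>. J d) \<subseteq> P d" for d
    using assms gideal_in_P by blast
  show "sp.subspace (\<Inter>J\<in>\<J>. J d)" for d
    using assms(1) gideal_subspace by (intro sp.subspace_Int) blast
  show "p * q \<in> (\<Inter>J\<in>\<J>. J (e + d))" if "p \<in> P e" "q \<in> (\<Inter>J\<in>\<J>. J d)" for p q d e
    using that gideal_mult[OF assms(1)] by auto
qed

text \<open>A generator carries its degree along because the zero polynomial is a form of every
  degree.\<close>

definition Gen :: "(nat \<times> 'k::field mpoly) set \<Rightarrow> 'k family"
  where "Gen S d = (\<Inter>J\<in>{J. gideal J \<and> (\<forall>(a, x)\<in>S. x \<in> J a)}. J d)"

definition forms :: "(nat \<times> 'k::field mpoly) set \<Rightarrow> bool"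
  where "forms S \<longleftrightarrow> (\<forall>(a, x)\<in>S. x \<in> P a)"

lemma gideal_Gen:
  assumes "forms S"
  shows "gideal (Gen S)"
proof -
  have "gideal (\<lambda>d. \<Inter>J\<in>{J. gideal J \<and> (\<forall>(a, x)\<in>S. x \<in> J a)}. J d)"
    using gideal_P assms unfolding forms_def by (intro gideal_Inf) auto
  then show ?thesis unfolding Gen_def .
qed

lemma Gen_least: "gideal J \<Longrightarrow> (\<And>a x. (a, x) \<in> S \<Longrightarrow> x \<in> J a) \<Longrightarrow> Gen S \<le> J"
  unfolding Gen_def le_fun_def by blast

lemma mem_Gen: "(a, x) \<in> S \<Longrightarrow> x \<in> Gen S a"
  unfolding Gen_def by blast

lemma Gen_empty: "Gen {} = (\<lambda>_. {0})"
proof (rule antisym)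
  show "Gen {} \<le> (\<lambda>_. {0})" by (rule Gen_least[OF gideal_bot]) auto
  show "(\<lambda>_. {0}) \<le> Gen {}"
    using gideal_zero[OF gideal_Gen[of "{}"]] by (auto simp: le_fun_def forms_def)
qed

lemma Gen_insert:
  assumes "forms (insert (a, x) S)"
  shows "Gen (insert (a, x) S) = adj (Gen S) a x"
proof (rule antisym)
  have S: "forms S" and x: "x \<in> P a" using assms unfolding forms_def by auto
  note g = gideal_Gen[OF S]
  show "Gen (insert (a, x) S) \<le> adj (Gen S) a x"
  proof (rule Gen_least[OF gideal_adj[OF g x]])
    show "y \<in> adj (Gen S) a x b" if "(b, y) \<in> insert (a, x) S" for b y
      using that mem_adj[OF g] mem_Gen[of b y S] adj_superset[of y "Gen S" b a x] by auto
  qed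
  show "adj (Gen S) a x \<le> Gen (insert (a, x) S)"
    using gideal_Gen[OF assms] by (intro adj_least Gen_least) (auto intro: mem_Gen)
qed

section \<open>The ascending chain condition\<close>

definition X :: "nat \<Rightarrow> 'k::field mpoly"
  where "X i = single (single i 1) 1"

lemma X_in_P: "i \<in> {1..n} \<Longrightarrow> X i \<in> P 1"
  using single_in_P[of "single i 1" 1] by (simp add: X_def)

lemma X_times_single: "single m c * X i = single (m + single i 1) c"
  by (simp add: X_def mult_single)

lemma monom_split:
  assumes "i \<in> keys m"
  obtains m' where "m = m' + single i (1::nat)"
proof
  show "m = (m - single i 1) + single i 1"
    using assms
    by (intro poly_mapping_eqI) (auto simp: lookup_add lookup_minus lookup_single when_def in_keys_iff)
qed

lemma gideal_all_variables:
  fixes J :: "'k::field family"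
  assumes J: "gideal J" and X: "\<And>i. i \<in> {1..n} \<Longrightarrow> X i \<in> J 1" and "d \<noteq> 0"
  shows "J d = P d"
proof (rule antisym[OF gideal_subset[OF J]], rule subsetI)
  fix p :: "'k mpoly" assume p: "p \<in> P d"
  have "single m c \<in> J d" if "m \<in> keys p" for m and c :: 'k
  proof -
    have m: "keys m \<subseteq> {1..n}" "monom_degree m = d"
      using that p unfolding P_iff by blast+
    have "m \<noteq> 0" using m(2) \<open>d \<noteq> 0\<close> by auto
    then obtain i where i: "i \<in> keys m"
      by (metis keys_eq_empty all_not_in_conv)
    obtain m' where m': "m = m' + single i 1"
      using monom_split[OF i] by blast
    have sub: "keys m' \<subseteq> keys m"
      unfolding m' by (auto simp: in_keys_iff lookup_add)
    have d: "monom_degree m' + 1 = d"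
      using m(2) unfolding m' by (simp add: monom_degree_add)
    have "single m' c \<in> P (monom_degree m')"
      using sub m(1) by (intro single_in_P) blast
    then have "single m' c * X i \<in> J (monom_degree m' + 1)"
      using gideal_mult[OF J _ X] i m(1) by blast
    then show ?thesis unfolding X_times_single d m'[symmetric] .
  qed
  then show "p \<in> J d" by (rule subspace_memI[OF gideal_subspace[OF J]])
qed

lemma gideal_one:
  assumes J: "gideal J" and "1 \<in> J 0"
  shows "J = P"
proof (rule ext)
  fix d
  have "p \<in> J d" if "p \<in> P d" for p
    using gideal_mult[OF J that assms(2)] by simp
  then show "J d = P d" using gideal_subset[OF J] by blast
qed

lemma gideal_degree_0:
  assumes J: "gideal J" and "J \<noteq> P"
  shows "J 0 = {0}"
proof (rule ccontr)
  assume "J 0 \<noteq> {0}"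
  then obtain p where p: "p \<in> J 0" "p \<noteq> 0" using gideal_zero[OF J] by blast
  obtain c where c: "p = single 0 c" using P_0_const[OF gideal_in_P[OF J p(1)]] by blast
  have "single 0 (inverse c) * p = 1"
    using p(2) unfolding c by (cases "c = 0") (simp_all add: mult_single)
  moreover have "single 0 (inverse c) * p \<in> J (0 + 0)"
    by (rule gideal_mult[OF J const_in_P p(1)])
  ultimately show False using gideal_one[OF J] assms(2) by simp
qed

text \<open>The ideal \<open>J : x^j\<close> for a linear form \<open>x\<close>.\<close>

definition colon_pow :: "nat \<Rightarrow> 'k mpoly \<Rightarrow> ('k::field family) \<Rightarrow> 'k family"
  where "colon_pow j x J = ((\<lambda>J. colon J 1 x) ^^ j) J"

lemma colon_pow_0 [simp]: "colon_pow 0 x J = J"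
  by (simp add: colon_pow_def)

lemma colon_pow_Suc: "colon_pow (Suc j) x J = colon (colon_pow j x J) 1 x"
  by (simp add: colon_pow_def)

lemma colon_pow_Suc': "colon_pow (Suc j) x J = colon_pow j x (colon J 1 x)"
  unfolding colon_pow_def by (simp add: funpow_Suc_right del: funpow.simps)

lemma gideal_colon_pow: "gideal J \<Longrightarrow> x \<in> P 1 \<Longrightarrow> gideal (colon_pow j x J)"
  by (induction j) (auto simp: colon_pow_Suc gideal_colon)

lemma colon_pow_mono: "J \<le> J' \<Longrightarrow> colon_pow j x J \<le> colon_pow j x J'"
  by (induction j) (auto simp: colon_pow_Suc colon_mono)

lemma colon_pow_increasing: "gideal J \<Longrightarrow> x \<in> P 1 \<Longrightarrow> i \<le> j \<Longrightarrow> colon_pow i x J \<le> colon_pow j x J"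
  by (rule lift_Suc_mono_le) (auto simp: colon_pow_Suc subset_colon gideal_colon_pow)

text \<open>An element of \<open>J'\<close> of degree \<open>d + 1\<close> lies in
  \<open>J + (x)\<close>, so it is \<open>u + x * v\<close> with \<open>u\<close> in
  \<open>J\<close>. Then \<open>v\<close> lies in \<open>J' : x\<close> in degree \<open>d\<close>,
  and the hypothesis is inherited by \<open>J : x\<close> and \<open>J' : x\<close>, so induction on
  the degree over all pairs of ideals puts \<open>v\<close> into \<open>J : x\<close>.\<close>

lemma gideal_eq_by_colon_pow:
  assumes "gideal J" "gideal J'" "J \<le> J'" and x: "x \<in> P 1"
    and "\<And>j. adj (colon_pow j x J) 1 x = adj (colon_pow j x J') 1 x"
  shows "J = J'"
proof -
  have "J' d \<subseteq> J d" for d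
    using assms(1,2,3,5)
  proof (induction d arbitrary: J J')
    case 0
    then show ?case using "0.prems"(4)[of 0] by (auto simp: adj_def fun_eq_iff dest!: spec[of _ 0])
  next
    case (Suc d)
    show ?case
    proof
      fix z assume z: "z \<in> J' (Suc d)"
      then have "z \<in> adj J 1 x (Suc d)"
        using Suc.prems(4)[of 0] adj_superset[of z J' "Suc d" 1 x] z by simp
      then obtain u v where uv: "u \<in> J (Suc d)" "v \<in> P d" "z = u + x * v"
        unfolding adj_def by auto
      have "x * v \<in> J' (Suc d)"
        using gideal_add_left[OF Suc.prems(2), of u] uv z Suc.prems(3) by (auto simp: le_fun_def)
      then have v: "v \<in> colon J' 1 x d" using uv(2) by (simp add: colon_def)
      have "adj (colon_pow j x (colon J 1 x)) 1 x = adj (colon_pow j x (colon J' 1 x)) 1 x" for j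
        using Suc.prems(4)[of "Suc j"] by (simp add: colon_pow_Suc')
      then have "colon J' 1 x d \<subseteq> colon J 1 x d"
        using Suc.prems x by (intro Suc.IH gideal_colon colon_mono)
      then have "x * v \<in> J (Suc d)" using v by (auto simp: colon_def)
      then show "z \<in> J (Suc d)" using uv gideal_add[OF Suc.prems(1)] by simp
    qed
  qed
  then show ?thesis using assms(3) by (intro antisym) (auto simp: le_fun_def)
qed

text \<open>Ideals containing all but the first \<open>i\<close> variables: the induction over \<open>i\<close> replaces an
  induction over the number of variables.\<close>

definition vars_above :: "nat \<Rightarrow> ('k::field family) \<Rightarrow> bool"
  where "vars_above i J \<longleftrightarrow> gideal J \<and> (\<forall>j. i < j \<and> j \<le> n \<longrightarrow> X j \<in> J 1)"

lemma vars_above_mono: "vars_above i J \<Longrightarrow> J \<le> J' \<Longrightarrow> gideal J' \<Longrightarrow> vars_above i J'"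
  unfolding vars_above_def le_fun_def by blast

lemma vars_above_adj:
  assumes "vars_above (Suc i) J" "Suc i \<le> n"
  shows "vars_above i (adj J 1 (X (Suc i)))"
proof -
  have J: "gideal J" using assms(1) unfolding vars_above_def by blast
  have "X j \<in> adj J 1 (X (Suc i)) 1" if "i < j" "j \<le> n" for j
  proof (cases "j = Suc i")
    case True
    then show ?thesis using mem_adj[OF J] by simp
  next
    case False
    then have "X j \<in> J 1" using that assms(1) unfolding vars_above_def by simp
    then show ?thesis by (rule adj_superset)
  qed
  moreover have "gideal (adj J 1 (X (Suc i)))"
    using gideal_adj[OF J X_in_P] assms(2) by simp
  ultimately show ?thesis unfolding vars_above_def by blast
qed

lemma vars_above_0_HF:
  assumes "vars_above 0 J" "d \<noteq> 0"
  shows "J d = P d"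
  using assms gideal_all_variables unfolding vars_above_def by force

text \<open>As in Hilbert's basis theorem, with \<open>(J k : x^j) + (x)\<close> in place of ideals
  of leading coefficients: these form an array increasing in both indices whose entries contain one
  more variable, so the induction hypothesis applies to its columns and its diagonal.
  \<open>gideal_eq_by_colon_pow\<close> recovers \<open>J k\<close> from its row.\<close>

lemma ascending_chain_vars_above:
  fixes J :: "nat \<Rightarrow> 'k::field family"
  assumes "i \<le> n" "\<And>k. vars_above i (J k)" "\<And>k l. k \<le> l \<Longrightarrow> J k \<le> J l"
  shows "\<exists>N. \<forall>k\<ge>N. J k = J N"
  using assms
proof (induction i arbitrary: J)
  case 0
  have g: "gideal (J k)" for k using "0.prems"(2) unfolding vars_above_def by blast
  show ?case
  proof (cases "\<exists>k. J k = P")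
    case True
    then obtain N where N: "J N = P" by blast
    have "J k = P" if "k \<ge> N" for k
      using "0.prems"(3)[OF that] gideal_subset[OF g, of k] unfolding N le_fun_def by (intro ext) blast
    then show ?thesis using N by metis
  next
    case False
    have "J k d = J 0 d" for k d
      using vars_above_0_HF[OF "0.prems"(2), of d] gideal_degree_0[OF g] False by (cases "d = 0") auto
    then show ?thesis by (intro exI[of _ 0]) auto
  qed
next
  case (Suc i)
  define x :: "'k mpoly" where "x = X (Suc i)"
  define L where "L k j = adj (colon_pow j x (J k)) 1 x" for k j
  have x: "x \<in> P 1" unfolding x_def using Suc.prems(1) by (intro X_in_P) simp
  have g: "gideal (J k)" for k using Suc.prems(2) unfolding vars_above_def by blast
  have Lv: "vars_above i (L k j)" for k j
  proof -
    have "J k \<le> colon_pow j x (J k)" using colon_pow_increasing[OF g x, of 0 j] by simp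
    then have "vars_above (Suc i) (colon_pow j x (J k))"
      using vars_above_mono Suc.prems(2) gideal_colon_pow[OF g x] by blast
    then show ?thesis unfolding L_def x_def using vars_above_adj Suc.prems(1) by blast
  qed
  have Lmono: "L k j \<le> L k' j'" if "k \<le> k'" "j \<le> j'" for k j k' j'
    unfolding L_def
    using colon_pow_mono[OF Suc.prems(3)[OF that(1)]] colon_pow_increasing[OF g x that(2)]
    by (intro adj_mono) (rule order_trans)
  have "\<exists>N. \<forall>k\<ge>N. L k k = L N N"
    using Suc.prems(1) Lv Lmono by (intro Suc.IH) auto
  then obtain M where M: "\<And>k. k \<ge> M \<Longrightarrow> L k k = L M M" by blast
  have "\<forall>j. \<exists>N. \<forall>k\<ge>N. L k j = L N j"
    using Suc.prems(1) Lv Lmono by (intro allI Suc.IH) auto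
  then obtain N where N: "\<And>j k. k \<ge> N j \<Longrightarrow> L k j = L (N j) j" by metis
  \<comment> \<open>Columns beyond \<open>M\<close> are squeezed between diagonal entries that are
    already stable; the finitely many columns up to \<open>M\<close> each stabilise at their own
    \<open>N j\<close>.\<close>
  define T where "T = Max (insert M (N ` {..M}))"
  have T: "M \<le> T" "\<And>j. j \<le> M \<Longrightarrow> N j \<le> T" unfolding T_def by (intro Max_ge; simp)+
  have "L k j = L T j" if "k \<ge> T" for k j
  proof (cases "j \<le> M")
    case True
    then have "N j \<le> T" by (rule T(2))
    then show ?thesis using N[of j k] N[of j T] that by simp
  next
    case False
    have "L k' j = L M M" if "k' \<ge> M" for k'
    proof (rule antisym)
      have "L k' j \<le> L (max k' j) (max k' j)" by (rule Lmono) auto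
      then show "L k' j \<le> L M M" using M[of "max k' j"] that by simp
      show "L M M \<le> L k' j" using False that by (intro Lmono) auto
    qed
    then show ?thesis using that T(1) by simp
  qed
  then have "J T = J k" if "k \<ge> T" for k
    using that unfolding L_def
    by (intro gideal_eq_by_colon_pow[OF g g Suc.prems(3)[OF that] x]) metis
  then show ?case by metis
qed

lemma ascending_chain:
  fixes J :: "nat \<Rightarrow> 'k::field family"
  assumes "\<And>k. gideal (J k)" "\<And>k l. k \<le> l \<Longrightarrow> J k \<le> J l"
  shows "\<exists>N. \<forall>k\<ge>N. J k = J N"
  using assms by (intro ascending_chain_vars_above[of n J]) (auto simp: vars_above_def)

text \<open>The larger ideal is the smaller element of this relation: well-founded induction becomes
  Noetherian induction, and a minimal element is a maximal ideal with the given property.\<close>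

lemma wf_gideal: "wf {(K :: 'k::field family, J). gideal J \<and> gideal K \<and> J < K}"
  unfolding wf_iff_no_infinite_down_chain
proof
  assume "\<exists>f. \<forall>i. (f (Suc i), f i) \<in> {(K :: 'k family, J). gideal J \<and> gideal K \<and> J < K}"
  then obtain f :: "nat \<Rightarrow> 'k family"
    where "\<forall>i. (f (Suc i), f i) \<in> {(K, J). gideal J \<and> gideal K \<and> J < K}"
    by (elim exE)
  then have f: "\<And>i. gideal (f i)" "\<And>i. f i < f (Suc i)" by auto
  have "f k \<le> f l" if "k \<le> l" for k l
    by (rule lift_Suc_mono_le[of f, OF less_imp_le[OF f(2)] that])
  then obtain N where N: "\<forall>k\<ge>N. f k = f N" using ascending_chain[of f] f(1) by blast
  have "f (Suc N) = f N" by (rule N[rule_format]) simp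
  then show False using f(2)[of N] by simp
qed

end

section \<open>Hilbert polynomials\<close>

lemma poly_eq_if_eventually_eq:
  fixes p q :: "'a::{idom, ring_char_0} poly"
  assumes "\<forall>\<^sub>F d in sequentially. poly p (of_nat d) = poly q (of_nat d)"
  shows "p = q"
proof (rule ccontr)
  assume "p \<noteq> q"
  then have fin: "finite {x. poly (p - q) x = 0}" by (intro poly_roots_finite) simp
  obtain N where "\<And>d. d \<ge> N \<Longrightarrow> poly p (of_nat d) = poly q (of_nat d)"
    using assms unfolding eventually_sequentially by blast
  then have "of_nat ` {N..} \<subseteq> {x. poly (p - q) x = 0}" by auto
  then have "finite ((of_nat :: nat \<Rightarrow> 'a) ` {N..})" using fin finite_subset by blast
  then have "finite {N..}" by (rule finite_imageD) (auto simp: inj_on_def)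
  then show False using infinite_Ici by blast
qed

text \<open>A uniform bound \<open>c\<close> instead of mere positivity carries the induction over
  the coefficients: \<open>d * c\<close> eventually outweighs the constant term \<open>a\<close>,
  from \<open>d = (c - a) / c\<close> on.\<close>

lemma poly_eventually_pos:
  fixes p :: "rat poly"
  assumes "lead_coeff p > 0"
  shows "\<exists>c>0. \<forall>\<^sub>F d in sequentially. poly p (of_nat d) \<ge> c"
  using assms
proof (induction p)
  case (pCons a q)
  show ?case
  proof (cases "q = 0")
    case True
    then show ?thesis using pCons.prems by (intro exI[of _ a]) auto
  next
    case False
    then obtain c N where c: "c > 0" "\<And>d. d \<ge> N \<Longrightarrow> poly q (of_nat d) \<ge> c"
      using pCons unfolding eventually_sequentially by auto
    obtain M where M: "of_nat M > (c - a) / c" using reals_Archimedean2 by blast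
    have "poly (pCons a q) (of_nat d) \<ge> c" if d: "d \<ge> max M N" for d
    proof -
      have "c - a \<le> of_nat M * c" using M c(1) by (simp add: divide_less_eq)
      also have "\<dots> \<le> of_nat d * c" using d c(1) by (intro mult_right_mono) auto
      also have "\<dots> \<le> of_nat d * poly q (of_nat d)" using d c(2) by (intro mult_left_mono) auto
      finally show ?thesis by simp
    qed
    then show ?thesis using c(1) unfolding eventually_sequentially by blast
  qed
qed auto

lemma lead_coeff_nonneg_if_eventually_nonneg:
  fixes p :: "rat poly"
  assumes "\<forall>\<^sub>F d in sequentially. poly p (of_nat d) \<ge> 0"
  shows "lead_coeff p \<ge> 0"
proof (rule ccontr)
  assume "\<not> lead_coeff p \<ge> 0"
  then have "lead_coeff (- p) > 0" by simp
  then obtain c where c: "c > 0" "\<forall>\<^sub>F d in sequentially. poly (- p) (of_nat d) \<ge> c"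
    using poly_eventually_pos by blast
  have "\<forall>\<^sub>F d in sequentially. False"
    using c(2) assms by eventually_elim (use c(1) in auto)
  then show False by simp
qed

text \<open>One more than the degree, with 0 kept apart from the nonzero constants: for a Hilbert
  polynomial this is the dimension of the quotient.\<close>

definition pdim :: "'a::zero poly \<Rightarrow> nat"
  where "pdim p = (if p = 0 then 0 else Suc (degree p))"

lemma pdim_le_iff: "pdim p \<le> m \<longleftrightarrow> (\<forall>i\<ge>m. coeff p i = 0)"
proof
  show "pdim p \<le> m \<Longrightarrow> \<forall>i\<ge>m. coeff p i = 0"
    by (auto simp: pdim_def coeff_eq_0 split: if_splits)
  show "pdim p \<le> m" if "\<forall>i\<ge>m. coeff p i = 0"
  proof (rule ccontr)
    assume "\<not> pdim p \<le> m"
    then have "p \<noteq> 0" "m \<le> degree p" by (auto simp: pdim_def split: if_splits)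
    then show False using that by auto
  qed
qed

text \<open>Everything is read off the sign of the leading coefficient of \<open>q - p\<close>,
  which would be that of \<open>- p\<close> if \<open>p\<close> had the larger degree.\<close>

lemma pdim_mono:
  fixes p q :: "rat poly"
  assumes "\<forall>\<^sub>F d in sequentially. 0 \<le> poly p (of_nat d)"
    and "\<forall>\<^sub>F d in sequentially. poly p (of_nat d) \<le> poly q (of_nat d)"
  shows "pdim p \<le> pdim q" "pdim p = pdim q \<Longrightarrow> lead_coeff p \<le> lead_coeff q"
proof -
  have p: "lead_coeff p \<ge> 0"
    by (rule lead_coeff_nonneg_if_eventually_nonneg[OF assms(1)])
  have qp: "lead_coeff (q - p) \<ge> 0"
    by (rule lead_coeff_nonneg_if_eventually_nonneg) (use assms(2) in eventually_elim, simp)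
  show le: "pdim p \<le> pdim q"
  proof (rule ccontr)
    assume neg: "\<not> pdim p \<le> pdim q"
    then have p0: "p \<noteq> 0" and q: "q = 0 \<or> degree q < degree p"
      by (auto simp: pdim_def split: if_splits)
    have cq: "coeff q (degree p) = 0" using q by (auto simp: coeff_eq_0)
    have "degree (q - p) \<le> degree p"
      using q by (intro degree_diff_le) auto
    moreover have "coeff (q - p) (degree p) \<noteq> 0" using cq p0 by simp
    ultimately have "degree (q - p) = degree p" using le_degree antisym by blast
    then have "lead_coeff (q - p) = - lead_coeff p" using cq by simp
    then show False using p qp p0 by simp
  qed
  show "lead_coeff p \<le> lead_coeff q" if "pdim p = pdim q"
  proof (cases "p = 0 \<or> q = 0")
    case True
    then show ?thesis using that by (auto simp: pdim_def split: if_splits)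
  next
    case False
    then have deg: "degree p = degree q" using that by (simp add: pdim_def)
    show ?thesis
    proof (rule ccontr)
      assume neg: "\<not> ?thesis"
      then have "coeff (q - p) (degree q) \<noteq> 0" using deg by simp
      moreover have "degree (q - p) \<le> degree q" using deg by (intro degree_diff_le) auto
      ultimately have "degree (q - p) = degree q" using le_degree antisym by blast
      then show False using qp neg deg by simp
    qed
  qed
qed

section \<open>Backward differences of polynomials\<close>

definition shift :: "nat \<Rightarrow> rat poly \<Rightarrow> rat poly"
  where "shift a p = pcompose p [:- of_nat a, 1:]"

text \<open>The effect on Hilbert polynomials of dividing out a regular form of degree
  \<open>a\<close>.\<close>

definition bdiff :: "nat \<Rightarrow> rat poly \<Rightarrow> rat poly"
  where "bdiff a p = p - shift a p"

lemma poly_shift: "a \<le> d \<Longrightarrow> poly (shift a p) (of_nat d) = poly p (of_nat (d - a))"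
  by (simp add: shift_def poly_pcompose of_nat_diff)

text \<open>Shifting \<open>x * q\<close> gives \<open>(x - a)\<close> times the shift of
  \<open>q\<close>; writing that shift as \<open>q - bdiff a q\<close> yields a recursion on
  coefficients in which no composition of polynomials is left.\<close>

lemma bdiff_pCons: "bdiff a (pCons c q) = pCons 0 (bdiff a q) + smult (of_nat a) (q - bdiff a q)"
  unfolding bdiff_def shift_def by (simp add: pcompose_pCons algebra_simps)

lemma bdiff_add: "bdiff a (p + q) = bdiff a p + bdiff a q"
  unfolding bdiff_def shift_def by (simp add: pcompose_add)

lemma coeff_bdiff:
  "degree p \<le> i \<Longrightarrow> coeff (bdiff a p) i = 0"
  "degree p = Suc m \<Longrightarrow> coeff (bdiff a p) m = of_nat (Suc m) * of_nat a * lead_coeff p"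
proof (induction p arbitrary: i m)
  case 0
  { case 1 show ?case by (simp add: bdiff_def shift_def) }
  { case 2 then show ?case by simp }
next
  case (pCons c q)
  {
    case (1 i)
    then show ?case
      using pCons.IH(1) by (cases i) (auto simp: bdiff_pCons coeff_eq_0 split: if_splits)
  next
    case (2 m)
    then have q: "q \<noteq> 0" "degree q = m" by (auto split: if_splits)
    show ?case
    proof (cases m)
      case 0
      then show ?thesis using q pCons.IH(1)[of 0] by (simp add: bdiff_pCons)
    next
      case (Suc m')
      then have "coeff (bdiff a q) m' = of_nat (Suc m') * of_nat a * lead_coeff q"
        "coeff (bdiff a q) m = 0"
        using q pCons.IH(2)[of m'] pCons.IH(1)[of m] by simp_all
      then show ?thesis using q Suc by (simp add: bdiff_pCons algebra_simps)
    qed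
  }
qed

text \<open>A discrete antiderivative: a monomial one degree higher cancels the leading term of
  \<open>q\<close>, its coefficient compensating the factor \<open>Suc (degree q)\<close> that
  differencing produces.\<close>

lemma bdiff_surj: "\<exists>p. bdiff 1 p = q"
proof (induction "pdim q" arbitrary: q rule: less_induct)
  case less
  show ?case
  proof (cases "q = 0")
    case True
    then show ?thesis by (intro exI[of _ 0]) (simp add: bdiff_def shift_def)
  next
    case False
    define p0 where "p0 = monom (lead_coeff q / of_nat (Suc (degree q))) (Suc (degree q))"
    have deg: "degree p0 = Suc (degree q)"
      using False unfolding p0_def by (simp add: degree_monom_eq)
    have "lead_coeff p0 = lead_coeff q / of_nat (Suc (degree q))"
      unfolding deg by (simp add: p0_def)
    then have "coeff (bdiff 1 p0) (degree q) = lead_coeff q"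
      using coeff_bdiff(2)[OF deg, of 1] by (simp del: of_nat_Suc)
    moreover have "coeff (bdiff 1 p0) i = 0" if "i > degree q" for i
      using coeff_bdiff(1)[of p0 i 1] deg that by simp
    ultimately have "\<forall>i\<ge>degree q. coeff (q - bdiff 1 p0) i = 0"
      by (auto simp: le_less coeff_eq_0)
    then have "pdim (q - bdiff 1 p0) \<le> degree q" by (simp add: pdim_le_iff)
    then have "pdim (q - bdiff 1 p0) < pdim q" using False by (simp add: pdim_def)
    then obtain p where "bdiff 1 p = q - bdiff 1 p0" using less by blast
    then have "bdiff 1 (p + p0) = q" by (simp add: bdiff_add)
    then show ?thesis by blast
  qed
qed

text \<open>The truncated subtraction fits: nonzero constants and 0 alike have difference 0.\<close>

lemma pdim_bdiff:
  assumes "a \<noteq> 0"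
  shows "pdim (bdiff a p) = pdim p - 1"
    and "degree p \<noteq> 0 \<Longrightarrow> lead_coeff (bdiff a p) = of_nat (degree p) * of_nat a * lead_coeff p"
proof -
  have *: "degree (bdiff a p) = m \<and> bdiff a p \<noteq> 0 \<and>
      lead_coeff (bdiff a p) = of_nat (degree p) * of_nat a * lead_coeff p"
    if m: "degree p = Suc m" for m
  proof -
    have "p \<noteq> 0" using m by auto
    then have "lead_coeff p \<noteq> 0" by simp
    then have c: "coeff (bdiff a p) m \<noteq> 0"
      using coeff_bdiff(2)[OF m, of a] assms by (simp del: of_nat_Suc)
    moreover have "degree (bdiff a p) \<le> m"
      using coeff_bdiff(1)[of p _ a] m by (intro degree_le) auto
    ultimately have "degree (bdiff a p) = m" using le_degree antisym by blast
    then show ?thesis using c coeff_bdiff(2)[OF m, of a] m by auto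
  qed
  show "pdim (bdiff a p) = pdim p - 1"
  proof (cases "degree p")
    case 0
    then have "bdiff a p = 0" using coeff_bdiff(1)[of p _ a] by (intro poly_eqI) simp
    then show ?thesis using 0 by (simp add: pdim_def)
  next
    case (Suc m)
    then have "p \<noteq> 0" by auto
    then show ?thesis using *[OF Suc] Suc by (simp add: pdim_def)
  qed
  show "degree p \<noteq> 0 \<Longrightarrow> lead_coeff (bdiff a p) = of_nat (degree p) * of_nat a * lead_coeff p"
    using * by (cases "degree p") blast+
qed

section \<open>Existence of the Hilbert polynomial\<close>

context poly_vars
begin

definition is_hilb :: "('k::field family) \<Rightarrow> rat poly \<Rightarrow> bool"
  where "is_hilb J p \<longleftrightarrow> (\<forall>\<^sub>F d in sequentially. of_nat (HF J d) = poly p (of_nat d))"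

lemma is_hilb_unique: "is_hilb J p \<Longrightarrow> is_hilb J q \<Longrightarrow> p = q"
  unfolding is_hilb_def by (rule poly_eq_if_eventually_eq) (erule (1) eventually_elim2, simp)

lemma is_hilb_adj_colon:
  assumes J: "gideal J" and x: "x \<in> P a"
    and p: "is_hilb (adj J a x) p" and q: "is_hilb (colon J a x) q"
  shows "is_hilb J (p + shift a q)"
proof -
  have "\<forall>\<^sub>F d in sequentially. of_nat (HF (colon J a x) (d - a)) = poly (shift a q) (of_nat d)"
  proof -
    obtain N where N: "\<And>d. d \<ge> N \<Longrightarrow> of_nat (HF (colon J a x) d) = poly q (of_nat d)"
      using q unfolding is_hilb_def eventually_sequentially by blast
    have "of_nat (HF (colon J a x) (d - a)) = poly (shift a q) (of_nat d)" if "d \<ge> N + a" for d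
      using N[of "d - a"] that by (simp add: poly_shift)
    then show ?thesis unfolding eventually_sequentially by blast
  qed
  moreover have "\<forall>\<^sub>F d in sequentially. a \<le> d" by (rule eventually_ge_at_top)
  ultimately show ?thesis
    using p unfolding is_hilb_def
  proof eventually_elim
    case (elim d)
    have "of_nat (HF J d) = (of_nat (HF (adj J a x) d) + of_nat (HF (colon J a x) (d - a)) :: rat)"
      using HF_adj_colon[OF J x elim(2)] by (metis of_nat_add)
    then show ?case using elim by simp
  qed
qed

text \<open>For regular \<open>x\<close> the Hilbert function of \<open>J + (x)\<close> is the
  difference of that of \<open>J\<close>, so the latter is eventually an antiderivative of
  \<open>q\<close> up to a constant, which is fixed at the threshold \<open>N\<close>.\<close>

lemma is_hilb_regular:
  assumes J: "gideal J" and x: "x \<in> P 1" and "colon J 1 x = J" and q: "is_hilb (adj J 1 x) q"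
  shows "\<exists>p. is_hilb J p"
proof -
  obtain p0 where p0: "bdiff 1 p0 = q" using bdiff_surj by blast
  obtain N where N: "\<And>d. d \<ge> N \<Longrightarrow> of_nat (HF (adj J 1 x) d) = poly q (of_nat d)"
    using q unfolding is_hilb_def eventually_sequentially by blast
  define c where "c = of_nat (HF J N) - poly p0 (of_nat N)"
  have "of_nat (HF J d) = poly (p0 + [:c:]) (of_nat d)" if "d \<ge> N" for d
    using that
  proof (induction d rule: dec_induct)
    case base
    then show ?case by (simp add: c_def)
  next
    case (step d)
    have "of_nat (HF J (Suc d)) = (of_nat (HF (adj J 1 x) (Suc d)) + of_nat (HF J d) :: rat)"
      using HF_adj_colon[OF J x, of "Suc d"] assms(3) by (simp flip: of_nat_add)
    also have "\<dots> = poly q (of_nat (Suc d)) + poly (p0 + [:c:]) (of_nat d)"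
      using N[of "Suc d"] step by simp
    also have "poly q (of_nat (Suc d)) = poly p0 (of_nat (Suc d)) - poly p0 (of_nat d)"
      unfolding p0[symmetric] bdiff_def by (simp only: poly_diff) (subst poly_shift, simp_all)
    finally show ?case by simp
  qed
  then show ?thesis unfolding is_hilb_def eventually_sequentially by blast
qed

text \<open>The ideals \<open>J : x^j\<close> become stationary, and \<open>x\<close> is regular
  modulo the last one, where the Hilbert polynomial comes from \<open>is_hilb_regular\<close>. From
  there additivity leads back to \<open>j = 0\<close> step by step; the ideals
  \<open>(J : x^j) + (x)\<close> contain one more variable and are covered by the induction
  hypothesis.\<close>

lemma ex_is_hilb_vars_above:
  fixes J :: "'k::field family"
  assumes "i \<le> n" "vars_above i J"
  shows "\<exists>p. is_hilb J p"
  using assms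
proof (induction i arbitrary: J)
  case 0
  have "HF J d = 0" if "d \<noteq> 0" for d
    using vars_above_0_HF[OF "0.prems"(2) that] by (simp add: HF_def)
  then have "is_hilb J 0"
    unfolding is_hilb_def eventually_sequentially by (intro exI[of _ 1]) auto
  then show ?case by blast
next
  case (Suc i)
  define x :: "'k mpoly" where "x = X (Suc i)"
  have x: "x \<in> P 1" unfolding x_def using Suc.prems(1) by (intro X_in_P) simp
  have J: "gideal J" using Suc.prems(2) unfolding vars_above_def by blast
  define C where "C j = colon_pow j x J" for j
  have C: "gideal (C j)" for j unfolding C_def by (rule gideal_colon_pow[OF J x])
  have C_mono: "C j \<le> C k" if "j \<le> k" for j k
    unfolding C_def by (rule colon_pow_increasing[OF J x that])
  have "vars_above (Suc i) (C j)" for j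
    using vars_above_mono[OF Suc.prems(2) _ C] C_mono[of 0 j] by (simp add: C_def)
  then have adj: "\<exists>q. is_hilb (adj (C j) 1 x) q" for j
    unfolding x_def using Suc.prems(1) by (intro Suc.IH vars_above_adj) auto
  obtain N where N: "\<forall>k\<ge>N. C k = C N" using ascending_chain[of C] C C_mono by blast
  have CN: "colon (C N) 1 x = C N"
    using N[rule_format, of "Suc N"] by (simp add: C_def colon_pow_Suc)
  have "\<exists>p. is_hilb (C j) p" if "j \<le> N" for j
    using that
  proof (induction j rule: inc_induct)
    case base
    then show ?case using is_hilb_regular[OF C x CN] adj by blast
  next
    case (step j)
    then obtain p where "is_hilb (colon (C j) 1 x) p" by (auto simp: C_def colon_pow_Suc)
    moreover obtain q where "is_hilb (adj (C j) 1 x) q" using adj by blast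
    ultimately show ?case using is_hilb_adj_colon[OF C x] by blast
  qed
  from this[of 0] show ?case by (simp add: C_def)
qed

definition hp :: "('k::field family) \<Rightarrow> rat poly"
  where "hp J = (THE p. is_hilb J p)"

lemma hp_eq: "is_hilb J p \<Longrightarrow> hp J = p"
  unfolding hp_def using is_hilb_unique by (intro the_equality)

lemma is_hilb_hp:
  assumes "gideal J"
  shows "is_hilb J (hp J)"
proof -
  have "vars_above n J" using assms unfolding vars_above_def by auto
  then obtain p where "is_hilb J p" using ex_is_hilb_vars_above[of n J] by blast
  then show ?thesis using hp_eq by metis
qed

section \<open>Dimension and multiplicity of a homogeneous ideal\<close>

definition gdim :: "('k::field family) \<Rightarrow> nat"
  where "gdim J = pdim (hp J)"

text \<open>The graded counterpart of \<open>ideal_degree\<close>. For a homogeneous ideal of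
  dimension 0 the Hilbert function has finite support, so the sum is the total dimension of the
  quotient.\<close>

definition gmult :: "('k::field family) \<Rightarrow> rat"
  where "gmult J = (if gdim J = 0 then of_nat (\<Sum>d | HF J d \<noteq> 0. HF J d)
    else fact (gdim J - 1) * lead_coeff (hp J))"

lemma hp_eventually_nonneg:
  assumes "gideal J"
  shows "\<forall>\<^sub>F d in sequentially. 0 \<le> poly (hp J) (of_nat d)"
  using is_hilb_hp[OF assms] unfolding is_hilb_def by eventually_elim (metis of_nat_0_le_iff)

lemma hp_eventually_mono:
  assumes "gideal J" "gideal K" "J \<le> K"
  shows "\<forall>\<^sub>F d in sequentially. poly (hp K) (of_nat d) \<le> poly (hp J) (of_nat d)"
  using is_hilb_hp[OF assms(1)] is_hilb_hp[OF assms(2)] unfolding is_hilb_def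
proof eventually_elim
  case (elim d)
  then show ?case using HF_antimono[OF assms, of d] by (metis of_nat_le_iff)
qed

lemma gdim_antimono: "gideal J \<Longrightarrow> gideal K \<Longrightarrow> J \<le> K \<Longrightarrow> gdim K \<le> gdim J"
  unfolding gdim_def by (rule pdim_mono(1)[OF hp_eventually_nonneg hp_eventually_mono])

lemma hp_adj_colon:
  assumes "gideal J" "x \<in> P a"
  shows "hp J = hp (adj J a x) + shift a (hp (colon J a x))"
  by (intro hp_eq is_hilb_adj_colon[OF assms] is_hilb_hp gideal_adj[OF assms] gideal_colon[OF assms])

lemma hp_regular:
  assumes "gideal J" "x \<in> P a" "colon J a x = J"
  shows "hp (adj J a x) = bdiff a (hp J)"
  using hp_adj_colon[OF assms(1,2)] assms(3) unfolding bdiff_def by (simp add: eq_diff_eq)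

lemma gdim_regular:
  assumes "gideal J" "x \<in> P a" "colon J a x = J" "a \<noteq> 0"
  shows "gdim (adj J a x) = gdim J - 1"
  unfolding gdim_def hp_regular[OF assms(1-3)] by (rule pdim_bdiff(1)[OF assms(4)])

lemma pdim_shift: "pdim (shift a p) = pdim p"
  by (auto simp: pdim_def shift_def degree_pcompose pcompose_eq_0_iff)

text \<open>Since \<open>J : x\<close> contains \<open>J\<close>, additivity bounds the Hilbert
  polynomial of \<open>J + (x)\<close> from below by \<open>bdiff a (hp J)\<close>, the value it
  takes for regular \<open>x\<close>. For \<open>gdim J\<close> at most 1 the claim is void by
  truncation.\<close>

lemma gdim_adj_ge:
  assumes J: "gideal J" and x: "x \<in> P a" and a: "a \<noteq> 0"
  shows "gdim J - 1 \<le> gdim (adj J a x)"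
proof (cases "gdim J \<le> 1")
  case False
  then have deg: "degree (hp J) \<noteq> 0" by (auto simp: gdim_def pdim_def split: if_splits)
  have "lead_coeff (hp J) \<ge> 0"
    by (rule lead_coeff_nonneg_if_eventually_nonneg[OF hp_eventually_nonneg[OF J]])
  moreover have "lead_coeff (hp J) \<noteq> 0" using deg by auto
  ultimately have "lead_coeff (hp J) > 0" by (metis order_le_less)
  then have "lead_coeff (bdiff a (hp J)) > 0"
    using pdim_bdiff(2)[OF a deg] deg a by (simp del: leading_coeff_0_iff)
  then obtain c where c: "c > 0" "\<forall>\<^sub>F d in sequentially. poly (bdiff a (hp J)) (of_nat d) \<ge> c"
    using poly_eventually_pos by blast
  have "\<forall>\<^sub>F d in sequentially. 0 \<le> poly (bdiff a (hp J)) (of_nat d)"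
    using c(2) by (rule eventually_mono) (use c(1) in auto)
  moreover have "\<forall>\<^sub>F d in sequentially. poly (bdiff a (hp J)) (of_nat d) \<le> poly (hp (adj J a x)) (of_nat d)"
  proof -
    have "\<forall>\<^sub>F d in sequentially. poly (hp (colon J a x)) (of_nat d) \<le> poly (hp J) (of_nat d)"
      by (rule hp_eventually_mono[OF J gideal_colon[OF J x] subset_colon[OF J x]])
    then obtain N where N: "\<And>d. d \<ge> N \<Longrightarrow> poly (hp (colon J a x)) (of_nat d) \<le> poly (hp J) (of_nat d)"
      unfolding eventually_sequentially by blast
    have "poly (bdiff a (hp J)) (of_nat d) \<le> poly (hp (adj J a x)) (of_nat d)" if "d \<ge> N + a" for d
    proof -
      have "poly (shift a (hp (colon J a x))) (of_nat d) \<le> poly (shift a (hp J)) (of_nat d)"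
        using that N[of "d - a"] by (simp add: poly_shift)
      moreover have "poly (hp J) (of_nat d) =
          poly (hp (adj J a x)) (of_nat d) + poly (shift a (hp (colon J a x))) (of_nat d)"
        by (subst hp_adj_colon[OF J x]) simp
      ultimately show ?thesis unfolding bdiff_def by simp
    qed
    then show ?thesis unfolding eventually_sequentially by blast
  qed
  ultimately have "pdim (bdiff a (hp J)) \<le> pdim (hp (adj J a x))" by (rule pdim_mono(1))
  then show ?thesis unfolding pdim_bdiff(1)[OF a] gdim_def .
qed simp

lemma gmult_mono:
  assumes J: "gideal J" and K: "gideal K" and "J \<le> K" and dim: "gdim J = gdim K"
  shows "gmult K \<le> gmult J"
proof (cases "gdim J = 0")
  case True
  have fin: "finite {d. HF M d \<noteq> 0}" if M: "gdim M = 0" "gideal M" for M :: "'a family"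
  proof -
    have "hp M = 0" using M(1) by (auto simp: gdim_def pdim_def split: if_splits)
    then obtain N where N: "\<And>d. d \<ge> N \<Longrightarrow> HF M d = 0"
      using is_hilb_hp[OF M(2)] unfolding is_hilb_def eventually_sequentially by auto
    have "d < N" if "HF M d \<noteq> 0" for d
      using N[of d] that by (cases "d < N") auto
    then have "{d. HF M d \<noteq> 0} \<subseteq> {..<N}" by blast
    then show ?thesis using finite_subset by blast
  qed
  have sub: "{d. HF K d \<noteq> 0} \<subseteq> {d. HF J d \<noteq> 0}"
    using HF_antimono[OF J K assms(3)] by (metis (mono_tags, lifting) Collect_mono le_zero_eq)
  have "(\<Sum>d | HF K d \<noteq> 0. HF K d) \<le> (\<Sum>d | HF K d \<noteq> 0. HF J d)"
    by (intro sum_mono HF_antimono[OF J K assms(3)])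
  also have "\<dots> \<le> (\<Sum>d | HF J d \<noteq> 0. HF J d)"
    using sub fin[OF True J] by (intro sum_mono2) auto
  finally show ?thesis using True dim unfolding gmult_def by (simp del: of_nat_sum)
next
  case False
  have "lead_coeff (hp K) \<le> lead_coeff (hp J)"
    using dim unfolding gdim_def
    by (intro pdim_mono(2)[OF hp_eventually_nonneg[OF K] hp_eventually_mono[OF assms(1-3)]]) simp
  then show ?thesis using False dim unfolding gmult_def by (simp add: mult_left_mono)
qed

lemma gdim_0_HF:
  assumes "gideal J" "gdim J = 0"
  obtains N where "\<And>d. d \<ge> N \<Longrightarrow> HF J d = 0"
proof -
  have "hp J = 0" using assms(2) by (auto simp: gdim_def pdim_def split: if_splits)
  then show thesis
    using is_hilb_hp[OF assms(1)] that unfolding is_hilb_def eventually_sequentially by auto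
qed

lemma gmult_gdim_0:
  assumes "gdim J = 0" "\<And>d. d \<ge> N \<Longrightarrow> HF J d = 0"
  shows "gmult J = of_nat (\<Sum>d<N. HF J d)"
proof -
  have "d < N" if "HF J d \<noteq> 0" for d
    using assms(2)[of d] that by (cases "d < N") auto
  then have "{d. HF J d \<noteq> 0} \<subseteq> {..<N}" by blast
  then have "(\<Sum>d | HF J d \<noteq> 0. HF J d) = (\<Sum>d<N. HF J d)"
    by (intro sum.mono_neutral_left) auto
  then show ?thesis using assms(1) by (simp add: gmult_def)
qed

lemma gdim_1_HF:
  assumes "gideal J" "gdim J = 1"
  obtains N c where "c \<noteq> 0" "\<And>d. d \<ge> N \<Longrightarrow> HF J d = c" "gmult J = of_nat c"
proof -
  have "degree (hp J) = 0" "hp J \<noteq> 0"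
    using assms(2) by (auto simp: gdim_def pdim_def split: if_splits)
  then obtain c where c: "hp J = [:c:]" "c \<noteq> 0" using degree_0_id by (metis pCons_0_0)
  then obtain N where N: "\<And>d. d \<ge> N \<Longrightarrow> of_nat (HF J d) = c"
    using is_hilb_hp[OF assms(1)] unfolding is_hilb_def eventually_sequentially by auto
  show thesis
  proof
    show "HF J N \<noteq> 0" using N[of N] c(2) by auto
    show "HF J d = HF J N" if "d \<ge> N" for d using N[OF that] N[of N] by (metis of_nat_eq_iff order_refl)
    show "gmult J = of_nat (HF J N)" using assms(2) c(1) N[of N] by (simp add: gmult_def)
  qed
qed

text \<open>Differencing multiplies the leading coefficient by \<open>a\<close> times the degree,
  and the factorial absorbs the degree. Dimension one is separate because the result has dimension
  0, where multiplicity is a sum and no longer a leading coefficient.\<close>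

lemma gmult_regular:
  assumes J: "gideal J" and x: "x \<in> P a" and reg: "colon J a x = J" and a: "a \<noteq> 0" and "gdim J \<noteq> 0"
  shows "gmult (adj J a x) = of_nat a * gmult J"
proof (cases "gdim J = 1")
  case True
  obtain N c where c: "\<And>d. d \<ge> N \<Longrightarrow> HF J d = c" "gmult J = of_nat c"
    using gdim_1_HF[OF J True] by metis
  have eq: "HF (adj J a x) d + HF J (d - a) = HF J d" if "a \<le> d" for d
    using HF_adj_colon[OF J x that] reg by simp
  have lt: "HF (adj J a x) d = HF J d" if "d < a" for d
    using that by (simp add: HF_def adj_def)
  have d0: "gdim (adj J a x) = 0" using gdim_regular[OF J x reg a] True by simp
  have "HF (adj J a x) d = 0" if "d \<ge> N + a" for d
    using eq[of d] c(1)[of d] c(1)[of "d - a"] that by simp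
  then have "gmult (adj J a x) = of_nat (\<Sum>d<N + a. HF (adj J a x) d)"
    by (rule gmult_gdim_0[OF d0])
  \<comment> \<open>Summing additivity over all degrees below \<open>N + a\<close> telescopes: what
    remains are the last \<open>a\<close> values of the Hilbert function of \<open>J\<close>, all
    equal to \<open>c\<close>.\<close>
  moreover have "(\<Sum>d<N + a. HF (adj J a x) d) + (\<Sum>d<N. HF J d) = (\<Sum>d<N + a. HF J d)"
  proof -
    have "(\<Sum>d<N + a. f d) = (\<Sum>d<a. f d) + (\<Sum>d<N. f (d + a))" for f :: "nat \<Rightarrow> nat"
      by (induction N) (simp_all add: ac_simps)
    then have "(\<Sum>d<N + a. HF (adj J a x) d) + (\<Sum>d<N. HF J d) =
        (\<Sum>d<a. HF J d) + (\<Sum>d<N. HF (adj J a x) (d + a) + HF J d)"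
      by (simp add: lt sum.distrib)
    also have "(\<Sum>d<N. HF (adj J a x) (d + a) + HF J d) = (\<Sum>d<N. HF J (d + a))"
    proof (rule sum.cong)
      show "HF (adj J a x) (d + a) + HF J d = HF J (d + a)" for d using eq[of "d + a"] by simp
    qed simp
    finally show ?thesis
      using \<open>\<And>f :: nat \<Rightarrow> nat. (\<Sum>d<N + a. f d) = _ f\<close> by simp
  qed
  moreover have "(\<Sum>d<N + a. HF J d) = (\<Sum>d<N. HF J d) + a * c"
    by (induction a) (simp_all add: c(1))
  ultimately show ?thesis using c(2) by (simp del: of_nat_sum)
next
  case False
  with assms(5) have deg: "degree (hp J) \<noteq> 0" "gdim J = Suc (degree (hp J))"
    by (auto simp: gdim_def pdim_def split: if_splits)
  have "gdim (adj J a x) = degree (hp J)" using gdim_regular[OF J x reg a] deg by simp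
  moreover have "lead_coeff (hp (adj J a x)) = of_nat (degree (hp J)) * of_nat a * lead_coeff (hp J)"
    unfolding hp_regular[OF J x reg] by (rule pdim_bdiff(2)[OF a deg(1)])
  moreover have "(fact (degree (hp J)) :: rat) = of_nat (degree (hp J)) * fact (degree (hp J) - 1)"
    using deg(1) by (simp add: fact_reduce)
  ultimately show ?thesis using deg unfolding gmult_def by simp
qed

section \<open>Graded primes and generic elements\<close>

text \<open>Primality is tested on forms only; \<open>primeideal_tot\<close> shows that this yields
  genuine prime ideals.\<close>

definition gprime :: "('k::field family) \<Rightarrow> bool"
  where "gprime Q \<longleftrightarrow> gideal Q \<and> 1 \<notin> Q 0 \<and>
    (\<forall>a b. \<forall>x\<in>P a. \<forall>y\<in>P b. x * y \<in> Q (a + b) \<longrightarrow> x \<in> Q a \<or> y \<in> Q b)"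

lemma gprime_gideal: "gprime Q \<Longrightarrow> gideal Q"
  unfolding gprime_def by blast

lemma gprimeD: "gprime Q \<Longrightarrow> x \<in> P a \<Longrightarrow> y \<in> P b \<Longrightarrow> x * y \<in> Q (a + b) \<Longrightarrow> x \<in> Q a \<or> y \<in> Q b"
  unfolding gprime_def by blast

lemma gprime_colon:
  assumes "gprime Q" "x \<in> P a" "x \<notin> Q a"
  shows "colon Q a x = Q"
proof (rule antisym)
  show "colon Q a x \<le> Q"
    using gprimeD[OF assms(1,2)] assms(3) by (auto simp: colon_def le_fun_def)
  show "Q \<le> colon Q a x" by (rule subset_colon[OF gprime_gideal[OF assms(1)] assms(2)])
qed

lemma gdim_eq_0I:
  assumes "\<And>d. d \<ge> N \<Longrightarrow> HF J d = 0"
  shows "gdim J = 0"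
proof -
  have "is_hilb J 0" unfolding is_hilb_def eventually_sequentially using assms by auto
  then show ?thesis using hp_eq by (simp add: gdim_def pdim_def)
qed

lemma gdim_P: "gdim P = 0"
  by (rule gdim_eq_0I[of 0]) (simp add: HF_def)

text \<open>A form of \<open>K\<close> outside the prime \<open>Q\<close> is regular modulo
  \<open>Q\<close>, so adjoining it already lowers the dimension. In degree 0 such a form is a unit,
  and then \<open>K\<close> is the whole ring.\<close>

lemma gdim_less_if_gprime_less:
  assumes "gprime Q" "Q < K" "gideal K" "gdim Q \<noteq> 0"
  shows "gdim K < gdim Q"
proof -
  have "\<not> K \<le> Q" using assms(2) by (simp add: less_le_not_le)
  then obtain a x where x: "x \<in> K a" "x \<notin> Q a" unfolding le_fun_def by blast
  note Q = gprime_gideal[OF assms(1)] and xP = gideal_in_P[OF assms(3) x(1)]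
  show ?thesis
  proof (cases "a = 0")
    case True
    then have "K 0 \<noteq> {0}" using x gideal_zero[OF Q] by auto
    then have "K = P" using gideal_degree_0[OF assms(3)] by blast
    then show ?thesis using assms(4) by (simp add: gdim_P)
  next
    case False
    have "gdim K \<le> gdim (adj Q a x)"
      using assms(2) x(1)
      by (intro gdim_antimono gideal_adj[OF Q xP] assms(3) adj_least) (simp_all add: less_le)
    also have "\<dots> < gdim Q"
      using gdim_regular[OF Q xP gprime_colon[OF assms(1) xP x(2)] False] assms(4) by simp
    finally show ?thesis .
  qed
qed

text \<open>Take \<open>Q\<close> maximal among the ideals above \<open>J\<close> of the same
  dimension. If \<open>x * y\<close> lies in \<open>Q\<close> but neither factor does, then
  \<open>Q + (x)\<close> and \<open>Q : x\<close> are both strictly larger, hence of smaller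
  dimension; but their Hilbert polynomials, one of them shifted, add up to that of
  \<open>Q\<close>.\<close>

lemma ex_gprime_gdim_eq:
  assumes J: "gideal J" and pos: "gdim J \<noteq> 0"
  shows "\<exists>Q. gprime Q \<and> J \<le> Q \<and> gdim Q = gdim J"
proof -
  let ?S = "{Q. gideal Q \<and> J \<le> Q \<and> gdim Q = gdim J}"
  have "J \<in> ?S" using J by simp
  from wf_gideal[unfolded wf_eq_minimal, rule_format, OF this] obtain Q where Q: "Q \<in> ?S"
    and max: "\<forall>K. (K, Q) \<in> {(K, J). gideal J \<and> gideal K \<and> J < K} \<longrightarrow> K \<notin> ?S"
    by (elim bexE) (rule that)
  have gQ: "gideal Q" and JQ: "J \<le> Q" and dQ: "gdim Q = gdim J" using Q by auto
  have less: "gdim K < gdim J" if K: "gideal K" "Q < K" for K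
  proof -
    have "K \<notin> ?S" by (rule max[rule_format]) (use K gQ in auto)
    then have "gdim K \<noteq> gdim J" using K JQ by auto
    moreover have "gdim K \<le> gdim Q" using K gQ by (intro gdim_antimono) auto
    ultimately show ?thesis using dQ by simp
  qed
  have "gprime Q"
    unfolding gprime_def
  proof (intro conjI allI ballI impI)
    show "gideal Q" by (rule gQ)
    show "1 \<notin> Q 0" using gideal_one[OF gQ] gdim_P dQ pos by metis
    fix a b x y assume x: "x \<in> P a" and y: "y \<in> P b" and xy: "x * y \<in> Q (a + b)"
    show "x \<in> Q a \<or> y \<in> Q b"
    proof (rule ccontr)
      assume neg: "\<not> ?thesis"
      have "x \<in> adj Q a x a" by (rule mem_adj[OF gQ])
      then have "Q \<noteq> adj Q a x" using neg by metis
      then have 1: "gdim (adj Q a x) < gdim J"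
        using less[OF gideal_adj[OF gQ x]] adj_subset[OF gQ, of a x] by (simp add: less_le)
      have "y \<in> colon Q a x b" using y xy by (simp add: colon_def)
      then have "Q \<noteq> colon Q a x" using neg by metis
      then have 2: "gdim (colon Q a x) < gdim J"
        using less[OF gideal_colon[OF gQ x]] subset_colon[OF gQ x] by (simp add: less_le)
      obtain m where m: "gdim J = Suc m" using pos not0_implies_Suc by blast
      have "pdim (hp (adj Q a x)) \<le> m" "pdim (shift a (hp (colon Q a x))) \<le> m"
        using 1 2 m unfolding gdim_def pdim_shift by simp_all
      then have "pdim (hp Q) \<le> m"
        unfolding hp_adj_colon[OF gQ x] pdim_le_iff by simp
      then show False using dQ m unfolding gdim_def by simp
    qed
  qed
  then show ?thesis using JQ dQ by blast
qed

definition irrelevant :: "'k::field family"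
  where "irrelevant d = (if d = 0 then {0} else P d)"

lemma gprime_irrelevant: "gprime irrelevant"
  unfolding gprime_def
proof (intro conjI allI ballI impI)
  show "gideal (irrelevant :: 'a family)"
    by (rule gidealI) (auto simp: irrelevant_def P_zero subspace_P P_mult split: if_splits)
  show "(1 :: 'a mpoly) \<notin> irrelevant 0" by (simp add: irrelevant_def)
  show "x \<in> irrelevant a \<or> y \<in> irrelevant b"
    if "x \<in> P a" "y \<in> P b" "x * y \<in> irrelevant (a + b)" for a b and x y :: "'a mpoly"
    using that by (auto simp: irrelevant_def split: if_splits)
qed

lemma le_irrelevant: "gideal J \<Longrightarrow> J \<noteq> P \<Longrightarrow> J \<le> irrelevant"
  using gideal_degree_0[of J] gideal_subset[of J] by (auto simp: irrelevant_def le_fun_def)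

text \<open>Noetherian induction: if \<open>x * y\<close> lies in \<open>J\<close> but neither
  factor does, every prime above \<open>J\<close> contains \<open>J + (x)\<close> or
  \<open>J + (y)\<close>, so the finite sets of these two ideals can be united.\<close>

lemma finite_minimal_gprimes:
  assumes "gideal J"
  shows "\<exists>\<Q>. finite \<Q> \<and> (\<forall>Q\<in>\<Q>. gprime Q \<and> J \<le> Q) \<and>
    (\<forall>Q. gprime Q \<and> J \<le> Q \<longrightarrow> (\<exists>Q'\<in>\<Q>. Q' \<le> Q))"
  using assms
proof (induction J rule: wf_induct_rule[OF wf_gideal])
  case (1 J)
  note J = 1(2)
  consider "gprime J" | "1 \<in> J 0" |
    a b x y where "x \<in> P a" "y \<in> P b" "x * y \<in> J (a + b)" "x \<notin> J a" "y \<notin> J b"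
    using J unfolding gprime_def by blast
  then show ?case
  proof cases
    case 1
    then show ?thesis by (intro exI[of _ "{J}"]) auto
  next
    case 2
    have "\<not> (gprime Q \<and> J \<le> Q)" for Q
      using 2 by (auto simp: gprime_def le_fun_def)
    then show ?thesis by (intro exI[of _ "{}"]) auto
  next
    case 3
    have IH: "\<exists>\<Q>. finite \<Q> \<and> (\<forall>Q\<in>\<Q>. gprime Q \<and> adj J c z \<le> Q) \<and>
        (\<forall>Q. gprime Q \<and> adj J c z \<le> Q \<longrightarrow> (\<exists>Q'\<in>\<Q>. Q' \<le> Q))"
      if z: "z \<in> P c" "z \<notin> J c" for c z
    proof (rule 1(1))
      show g: "gideal (adj J c z)" by (rule gideal_adj[OF J z(1)])
      have "J \<noteq> adj J c z" using mem_adj[OF J, of z c] z(2) by metis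
      then show "(adj J c z, J) \<in> {(K, J). gideal J \<and> gideal K \<and> J < K}"
        using J g adj_subset[OF J, of c z] by (simp add: less_le)
    qed
    obtain \<Q>1 where Q1: "finite \<Q>1" "\<forall>Q\<in>\<Q>1. gprime Q \<and> adj J a x \<le> Q"
        "\<forall>Q. gprime Q \<and> adj J a x \<le> Q \<longrightarrow> (\<exists>Q'\<in>\<Q>1. Q' \<le> Q)"
      using IH[OF 3(1,4)] by blast
    obtain \<Q>2 where Q2: "finite \<Q>2" "\<forall>Q\<in>\<Q>2. gprime Q \<and> adj J b y \<le> Q"
        "\<forall>Q. gprime Q \<and> adj J b y \<le> Q \<longrightarrow> (\<exists>Q'\<in>\<Q>2. Q' \<le> Q)"
      using IH[OF 3(2,5)] by blast
    show ?thesis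
    proof (intro exI[of _ "\<Q>1 \<union> \<Q>2"] conjI ballI allI impI)
      show "finite (\<Q>1 \<union> \<Q>2)" using Q1(1) Q2(1) by simp
      fix Q
      { assume "Q \<in> \<Q>1 \<union> \<Q>2"
        then show "gprime Q" using Q1(2) Q2(2) by blast }
      { assume "Q \<in> \<Q>1 \<union> \<Q>2"
        then show "J \<le> Q"
          using Q1(2) Q2(2) order_trans[OF adj_subset[OF J]] by blast }
      { assume Q: "gprime Q \<and> J \<le> Q"
        then have "x * y \<in> Q (a + b)" using 3(3) by (auto simp: le_fun_def)
        then have "x \<in> Q a \<or> y \<in> Q b" using gprimeD Q 3(1,2) by blast
        then have "adj J a x \<le> Q \<or> adj J b y \<le> Q"
          using adj_least[OF gprime_gideal] Q by blast
        then show "\<exists>Q'\<in>\<Q>1 \<union> \<Q>2. Q' \<le> Q" using Q Q1(3) Q2(3) by blast }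
    qed
  qed
qed

text \<open>If the dimension did not drop, there would be a prime \<open>R\<close> above
  \<open>J + (x)\<close> of dimension \<open>gdim J\<close>. It contains some member of the finite
  set, which is then of the same dimension and therefore equal to \<open>R\<close>, although it
  avoids \<open>x\<close>.\<close>

lemma finite_top_gprimes:
  assumes J: "gideal J" and pos: "gdim J \<noteq> 0"
  shows "\<exists>\<Q>. finite \<Q> \<and> (\<forall>Q\<in>\<Q>. gprime Q \<and> J \<le> Q \<and> gdim Q = gdim J) \<and>
    (\<forall>a. \<forall>x\<in>P a. (\<forall>Q\<in>\<Q>. x \<notin> Q a) \<longrightarrow> gdim (adj J a x) < gdim J)"
proof -
  obtain \<Q> where Q: "finite \<Q>" "\<forall>Q\<in>\<Q>. gprime Q \<and> J \<le> Q"
      "\<forall>Q. gprime Q \<and> J \<le> Q \<longrightarrow> (\<exists>Q'\<in>\<Q>. Q' \<le> Q)"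
    using finite_minimal_gprimes[OF J] by blast
  let ?T = "{Q \<in> \<Q>. gdim Q = gdim J}"
  have "gdim (adj J a x) < gdim J" if x: "x \<in> P a" and avoid: "\<forall>Q\<in>?T. x \<notin> Q a" for a x
  proof (rule ccontr)
    note gadj = gideal_adj[OF J x]
    assume "\<not> ?thesis"
    then have eq: "gdim (adj J a x) = gdim J"
      using gdim_antimono[OF J gadj adj_subset[OF J]] by simp
    then obtain R where R: "gprime R" "adj J a x \<le> R" "gdim R = gdim J"
      using ex_gprime_gdim_eq[OF gadj] pos by auto
    have JR: "J \<le> R" using order_trans[OF adj_subset[OF J] R(2)] .
    then obtain Q' where Q': "Q' \<in> \<Q>" "Q' \<le> R" using Q(3) R(1) by blast
    have gQ': "gprime Q'" "J \<le> Q'" using Q(2) Q'(1) by auto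
    have "gdim R \<le> gdim Q'" "gdim Q' \<le> gdim J"
      using gdim_antimono gprime_gideal gQ' R(1) J Q'(2) by blast+
    then have d: "gdim Q' = gdim J" using R(3) by simp
    have "Q' = R"
    proof (rule ccontr)
      assume "Q' \<noteq> R"
      then have "Q' < R" using Q'(2) by (simp add: less_le)
      then have "gdim R < gdim Q'"
        using gdim_less_if_gprime_less[OF gQ'(1) _ gprime_gideal[OF R(1)]] d pos by simp
      then show False using d R(3) by simp
    qed
    moreover have "x \<in> R a" using R(2) mem_adj[OF J, of x a] by (auto simp: le_fun_def)
    ultimately show False using avoid Q'(1) d by blast
  qed
  then show ?thesis using Q by (intro exI[of _ ?T]) simp
qed

text \<open>The coset \<open>f + W\<close> and the finite set of ideals cover two uses: a linear
  form generic for two systems at once (\<open>f = 0\<close>), and a given generator corrected by an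
  element of a prescribed subspace.\<close>

lemma generic_element:
  fixes \<J> :: "('k::field family) set"
  assumes inf: "infinite (UNIV :: 'k set)" and fin: "finite \<J>"
    and \<J>: "\<And>J. J \<in> \<J> \<Longrightarrow> gideal J \<and> gdim J \<noteq> 0"
    and W: "sp.subspace W" "W \<subseteq> P a" "f \<in> P a"
    and avoid: "\<And>J Q. J \<in> \<J> \<Longrightarrow> gprime Q \<Longrightarrow> J \<le> Q \<Longrightarrow> gdim Q = gdim J \<Longrightarrow> \<exists>w\<in>W. f + w \<notin> Q a"
  shows "\<exists>w\<in>W. \<forall>J\<in>\<J>. gdim (adj J a (f + w)) < gdim J"
proof -
  have "\<forall>J\<in>\<J>. \<exists>\<Q>. finite \<Q> \<and> (\<forall>Q\<in>\<Q>. gprime Q \<and> J \<le> Q \<and> gdim Q = gdim J) \<and>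
      (\<forall>a. \<forall>x\<in>P a. (\<forall>Q\<in>\<Q>. x \<notin> Q a) \<longrightarrow> gdim (adj J a x) < gdim J)"
    using finite_top_gprimes \<J> by blast
  from bchoice[OF this] obtain \<Q> where
    "\<forall>J\<in>\<J>. finite (\<Q> J) \<and> (\<forall>Q\<in>\<Q> J. gprime Q \<and> J \<le> Q \<and> gdim Q = gdim J) \<and>
      (\<forall>a. \<forall>x\<in>P a. (\<forall>Q\<in>\<Q> J. x \<notin> Q a) \<longrightarrow> gdim (adj J a x) < gdim J)"
    by (elim exE)
  note h = bspec[OF this]
  have Q1: "finite (\<Q> J)" if "J \<in> \<J>" for J
    using h[OF that] by (elim conjE)
  have Q2: "gprime Q \<and> J \<le> Q \<and> gdim Q = gdim J" if "J \<in> \<J>" "Q \<in> \<Q> J" for J Q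
    by (rule bspec[OF conjunct1[OF conjunct2[OF h[OF that(1)]]] that(2)])
  have Q3: "gdim (adj J a x) < gdim J" if "J \<in> \<J>" "x \<in> P a" "\<forall>Q\<in>\<Q> J. x \<notin> Q a" for J a x
    using h[OF that(1)] that(2,3) by simp
  \<comment> \<open>The subspaces to avoid are the degree \<open>a\<close> pieces of the
    top-dimensional primes of all ideals in \<open>\<J>\<close>.\<close>
  have "\<exists>w\<in>W. \<forall>R\<in>(\<lambda>(J, Q). Q a) ` Sigma \<J> \<Q>. f + w \<notin> R"
  proof (rule sp.avoid_subspaces[OF inf _ _ W(1)])
    show "finite ((\<lambda>(J, Q). Q a) ` Sigma \<J> \<Q>)" using fin Q1 by (intro finite_imageI finite_SigmaI)
    fix R assume "R \<in> (\<lambda>(J, Q). Q a) ` Sigma \<J> \<Q>"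
    then obtain J Q where JQ: "J \<in> \<J>" "Q \<in> \<Q> J" "R = Q a" by auto
    then show "sp.subspace R" using Q2[OF JQ(1,2)] gideal_subspace[OF gprime_gideal, of Q a] by simp
    show "\<exists>w\<in>W. f + w \<notin> R" using Q2[OF JQ(1,2)] avoid[OF JQ(1), of Q] JQ(3) by simp
  qed
  then obtain w where w: "w \<in> W" "\<forall>R\<in>(\<lambda>(J, Q). Q a) ` Sigma \<J> \<Q>. f + w \<notin> R" ..
  have w2: "f + w \<notin> Q a" if "J \<in> \<J>" "Q \<in> \<Q> J" for J Q
  proof -
    have "Q a \<in> (\<lambda>(J, Q). Q a) ` Sigma \<J> \<Q>" using that by force
    then show ?thesis by (rule bspec[OF w(2)])
  qed
  have "f + w \<in> P a" using P_add W w(1) by blast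
  then have "\<forall>J\<in>\<J>. gdim (adj J a (f + w)) < gdim J"
    using w2 by (intro ballI Q3) simp_all
  then show ?thesis using w(1) by blast
qed

lemma ex_linear_form_notin:
  assumes "gideal Q" "gdim Q \<noteq> 0"
  shows "\<exists>w\<in>P 1. w \<notin> Q 1"
proof (rule ccontr)
  assume "\<not> ?thesis"
  then have "X i \<in> Q 1" if "i \<in> {1..n}" for i using X_in_P[OF that] by blast
  then have "Q d = P d" if "d \<noteq> 0" for d using gideal_all_variables[OF assms(1) _ that] by blast
  then have "gdim Q = 0" by (intro gdim_eq_0I[of 1]) (simp add: HF_def)
  then show False using assms(2) by simp
qed

lemma generic_linear_form:
  fixes \<J> :: "('k::field family) set"
  assumes "infinite (UNIV :: 'k set)" "finite \<J>" "\<And>J. J \<in> \<J> \<Longrightarrow> gideal J \<and> gdim J \<noteq> 0"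
  shows "\<exists>w\<in>P 1. \<forall>J\<in>\<J>. gdim (adj J 1 w) = gdim J - 1"
proof -
  have "\<exists>w\<in>P 1. \<forall>J\<in>\<J>. gdim (adj J 1 (0 + w)) < gdim J"
  proof (rule generic_element[OF assms subspace_P subset_refl P_zero])
    fix J Q :: "'k family"
    assume "J \<in> \<J>" "gprime Q" "J \<le> Q" "gdim Q = gdim J"
    then show "\<exists>w\<in>P 1. 0 + w \<notin> Q 1"
      using ex_linear_form_notin[OF gprime_gideal, of Q] assms(3)[of J] by simp
  qed
  then obtain w where w: "w \<in> P 1" "\<And>J. J \<in> \<J> \<Longrightarrow> gdim (adj J 1 w) < gdim J" by auto
  have "gdim (adj J 1 w) = gdim J - 1" if "J \<in> \<J>" for J
    using w(2)[OF that] gdim_adj_ge[OF _ w(1), of J] assms(3)[OF that] by simp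
  then show ?thesis using w(1) by blast
qed

text \<open>A top-dimensional prime above \<open>J\<close> starts the chain; adjoining a linear form
  outside it lowers the dimension by exactly one, and the recursion continues above that ideal. In
  dimension 0 the irrelevant ideal alone is the chain.\<close>

lemma gprime_chain:
  assumes "gideal J" "J \<noteq> P"
  shows "\<exists>Q. (\<forall>i \<le> gdim J. gprime (Q i)) \<and> J \<le> Q 0 \<and> (\<forall>i < gdim J. Q i < Q (Suc i))"
  using assms
proof (induction "gdim J" arbitrary: J)
  case 0
  then show ?case
    using gprime_irrelevant le_irrelevant by (intro exI[of _ "\<lambda>_. irrelevant"]) auto
next
  case (Suc s)
  have dJ: "gdim J \<noteq> 0" using Suc.hyps(2) by simp
  obtain Q0 where Q0: "gprime Q0" "J \<le> Q0" "gdim Q0 = gdim J"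
    using ex_gprime_gdim_eq[OF Suc.prems(1) dJ] by blast
  note g = gprime_gideal[OF Q0(1)]
  have "gdim Q0 \<noteq> 0" using Q0(3) dJ by simp
  then obtain w where w: "w \<in> P 1" "w \<notin> Q0 1"
    using ex_linear_form_notin[OF g] by blast
  define K where "K = adj Q0 1 w"
  have K: "gideal K" unfolding K_def by (rule gideal_adj[OF g w(1)])
  have "s = gdim K"
    using gdim_regular[OF g w(1) gprime_colon[OF Q0(1) w]] Q0(3) Suc.hyps(2) unfolding K_def by simp
  moreover have "K \<noteq> P"
  \<comment> \<open>Adjoining a form of degree 1 changes nothing in degree 0, so 1 stays
    outside.\<close>
  proof
    assume "K = P"
    then have "1 \<in> K 0" using one_in_P by simp
    then show False using Q0(1) by (simp add: K_def adj_def gprime_def)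
  qed
  ultimately obtain Q where Q: "\<And>i. i \<le> s \<Longrightarrow> gprime (Q i)" "K \<le> Q 0" "\<And>i. i < s \<Longrightarrow> Q i < Q (Suc i)"
    using Suc.hyps(1)[of K] K by blast
  have less: "Q0 < Q 0"
  proof -
    have "Q0 \<noteq> K" using mem_adj[OF g, of w 1] w(2) unfolding K_def by metis
    then have "Q0 < K" using adj_subset[OF g, of 1 w] unfolding K_def by (simp add: less_le)
    then show ?thesis using Q(2) by (rule less_le_trans)
  qed
  show ?case
  proof (intro exI[of _ "\<lambda>i. case i of 0 \<Rightarrow> Q0 | Suc i \<Rightarrow> Q i"] conjI allI impI)
    show "gprime (case i of 0 \<Rightarrow> Q0 | Suc i \<Rightarrow> Q i)" if "i \<le> gdim J" for i
      using that Suc.hyps(2) Q(1) Q0(1) by (cases i) auto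
    show "J \<le> (case 0 of 0 \<Rightarrow> Q0 | Suc i \<Rightarrow> Q i)" using Q0(2) by simp
    show "(case i of 0 \<Rightarrow> Q0 | Suc i \<Rightarrow> Q i) < (case Suc i of 0 \<Rightarrow> Q0 | Suc i \<Rightarrow> Q i)"
      if "i < gdim J" for i
      using that Suc.hyps(2) Q(3) less by (cases i) auto
  qed
qed

section \<open>Regular sequences of parameters\<close>

lemma colon_eqI:
  assumes "gideal J" "x \<in> P a" "\<And>d z. z \<in> P d \<Longrightarrow> x * z \<in> J (a + d) \<Longrightarrow> z \<in> J d"
  shows "colon J a x = J"
proof (rule antisym)
  show "colon J a x \<le> J" using assms(3) by (auto simp: colon_def le_fun_def)
  show "J \<le> colon J a x" by (rule subset_colon[OF assms(1,2)])
qed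

lemma regularD:
  assumes "colon J a x = J" "z \<in> P d" "x * z \<in> J (a + d)"
  shows "z \<in> J d"
proof -
  have "z \<in> colon J a x d" using assms(2,3) by (simp add: colon_def)
  then show ?thesis using assms(1) by simp
qed

lemma regular_power:
  assumes "x \<in> P a" "colon J a x = J" "z \<in> P d" "x ^ k * z \<in> J (k * a + d)"
  shows "z \<in> J d"
  using assms(4)
proof (induction k)
  case (Suc k)
  have "x ^ k * z \<in> P (k * a + d)" by (rule P_mult[OF P_power[OF assms(1)] assms(3)])
  moreover have "x * (x ^ k * z) \<in> J (a + (k * a + d))" using Suc.prems by (simp add: ac_simps)
  ultimately have "x ^ k * z \<in> J (k * a + d)" by (rule regularD[OF assms(2)])
  then show ?case by (rule Suc.IH)
qed simp

text \<open>If \<open>y * z\<close> lies in \<open>J\<close>, then \<open>z = u + x * v\<close> with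
  \<open>u\<close> in \<open>J\<close>, and cancelling \<open>x\<close> gives \<open>y * v\<close>
  in \<open>J\<close>. The degree of \<open>v\<close> is smaller because \<open>a\<close> is
  positive, so induction on the degree takes the place of Nakayama's lemma.\<close>

lemma regular_exchange_left:
  assumes J: "gideal J" and x: "x \<in> P a" "a \<noteq> 0" "colon J a x = J"
    and y: "y \<in> P b" "colon (adj J a x) b y = adj J a x"
  shows "colon J b y = J"
proof (rule colon_eqI[OF J y(1)])
  show "z \<in> J d" if "z \<in> P d" "y * z \<in> J (b + d)" for d z
    using that
  proof (induction d arbitrary: z rule: less_induct)
    case (less d)
    have "y * z \<in> adj J a x (b + d)" using less.prems(2) by (rule adj_superset)
    then have z: "z \<in> adj J a x d" by (rule regularD[OF y(2) less.prems(1)])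
    show ?case
    proof (cases "a \<le> d")
      case True
      then obtain u v where uv: "u \<in> J d" "v \<in> P (d - a)" "z = u + x * v"
        using z unfolding adj_def by auto
      have "y * z = y * u + x * (y * v)" unfolding uv(3) by (simp add: algebra_simps)
      then have "x * (y * v) \<in> J (b + d)"
        using gideal_add_left[OF J gideal_mult[OF J y(1) uv(1)]] less.prems(2) by simp
      then have "x * (y * v) \<in> J (a + (b + (d - a)))" using True by simp
      then have "y * v \<in> J (b + (d - a))"
        by (rule regularD[OF x(3) P_mult[OF y(1) uv(2)]])
      then have "v \<in> J (d - a)" using less.IH[of "d - a" v] uv(2) True x(2) by simp
      then have "x * v \<in> J (a + (d - a))" by (rule gideal_mult[OF J x(1)])
      then show ?thesis using uv gideal_add[OF J] True by simp
    qed (use z in \<open>simp add: adj_def\<close>)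
  qed
qed

text \<open>From \<open>x * z = u + y * w\<close> the product \<open>y * w\<close> lies in
  \<open>J + (x)\<close>, hence so does \<open>w = u' + x * w'\<close>. Then
  \<open>x * (z - y * w')\<close> lies in \<open>J\<close>, and \<open>x\<close> cancels. The case
  distinctions only track degrees in which a cofactor is absent.\<close>

lemma regular_exchange_right:
  assumes J: "gideal J" and x: "x \<in> P a" "a \<noteq> 0" "colon J a x = J"
    and y: "y \<in> P b" "colon (adj J a x) b y = adj J a x"
  shows "colon (adj J b y) a x = adj J b y"
proof (rule colon_eqI[OF gideal_adj[OF J y(1)] x(1)])
  fix d z assume z: "z \<in> P d" and xz: "x * z \<in> adj J b y (a + d)"
  show "z \<in> adj J b y d"
  proof (cases "b \<le> a + d")
    case False
    then have "x * z \<in> J (a + d)" using xz by (simp add: adj_def)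
    then show ?thesis using regularD[OF x(3) z] adj_superset by blast
  next
    case True
    then obtain u w where uw: "u \<in> J (a + d)" "w \<in> P (a + d - b)" "x * z = u + y * w"
      using xz unfolding adj_def by auto
    have "y * w = - u + x * z" using uw(3) by simp
    moreover have "- u \<in> J (a + d)" using gideal_diff[OF J gideal_zero[OF J] uw(1)] by simp
    ultimately have "y * w \<in> adj J a x (a + d)" using adjI[of a "a + d" "- u" J z x] z by simp
    then have "w \<in> adj J a x (a + d - b)" using regularD[OF y(2) uw(2)] True by simp
    show ?thesis
    proof (cases "b \<le> d")
      case bd: True
      have "a \<le> a + d - b" "a + d - b - a = d - b" using bd by simp_all
      then obtain u' w' where w: "u' \<in> J (a + d - b)" "w' \<in> P (d - b)" "w = u' + x * w'"
        using \<open>w \<in> adj J a x (a + d - b)\<close> unfolding adj_def by auto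
      have "x * (z - y * w') = u + y * u'"
        using uw(3) unfolding w(3) by (simp add: algebra_simps)
      moreover have "y * u' \<in> J (a + d)" using gideal_mult[OF J y(1) w(1)] True by simp
      ultimately have "x * (z - y * w') \<in> J (a + d)" using gideal_add[OF J uw(1)] by simp
      moreover have "y * w' \<in> P d" using P_mult[OF y(1) w(2)] bd by simp
      ultimately have "z - y * w' \<in> J d" using regularD[OF x(3) P_diff[OF z]] by blast
      then have "(z - y * w') + y * w' \<in> adj J b y d" by (rule adjI[OF bd _ w(2)])
      then show ?thesis by simp
    next
      case bd: False
      \<comment> \<open>Here \<open>w\<close> has degree below \<open>a\<close>, so membership in
        \<open>J + (x)\<close> is membership in \<open>J\<close>.\<close>
      then have "\<not> a \<le> a + d - b" using True by arith
      then have "w \<in> J (a + d - b)"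
        using \<open>w \<in> adj J a x (a + d - b)\<close> unfolding adj_def by (auto split: if_splits)
      then have "y * w \<in> J (a + d)" using gideal_mult[OF J y(1)] True by fastforce
      then have "x * z \<in> J (a + d)" using uw gideal_add[OF J] by simp
      then show ?thesis using regularD[OF x(3) z] adj_superset by blast
    qed
  qed
qed

text \<open>In dimension one, a parameter is bijective on the quotient in large degrees by counting
  dimensions, and multiplication by powers of a regular element reduces to large degrees.\<close>

lemma regular_if_gdim_1:
  assumes J: "gideal J" "gdim J = 1" and y: "y \<in> P b" "b \<noteq> 0" "colon J b y = J"
    and h: "h \<in> P a" "gdim (adj J a h) = 0"
  shows "colon J a h = J"
proof -
  obtain N c where N: "\<And>d. d \<ge> N \<Longrightarrow> HF J d = c" using gdim_1_HF[OF J] by metis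
  obtain M where M: "\<And>d. d \<ge> M \<Longrightarrow> HF (adj J a h) d = 0"
    using gdim_0_HF[OF gideal_adj[OF J(1) h(1)] h(2)] by metis
  note C = gideal_colon[OF J(1) h(1)]
  have large: "colon J a h d = J d" if "d \<ge> N + M" for d
  proof -
    have "HF (colon J a h) d = HF J d"
      using HF_adj_colon[OF J(1) h(1), of "d + a"] M[of "d + a"] N[of "d + a"] N[of d] that by simp
    then show ?thesis
      using HF_le_eq[OF J(1) C subset_colon[OF J(1) h(1)], of d] by simp
  qed
  show ?thesis
  proof (rule colon_eqI[OF J(1) h(1)])
    fix d z assume z: "z \<in> P d" and hz: "h * z \<in> J (a + d)"
    define k where "k = N + M"
    have "z \<in> colon J a h d" using z hz by (simp add: colon_def)
    then have "y ^ k * z \<in> colon J a h (k * b + d)" by (rule gideal_mult[OF C P_power[OF y(1)]])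
    moreover have "k * b + d \<ge> N + M"
      using y(2) unfolding k_def by (metis le_add1 mult_le_mono2 mult.right_neutral less_one not_less order_trans)
    ultimately have "y ^ k * z \<in> J (k * b + d)" using large by simp
    then show "z \<in> J d" by (rule regular_power[OF y(1,3) z])
  qed
qed

text \<open>In dimension 0 a high power of \<open>x\<close> falls into \<open>J\<close>; cancelling
  it puts 1 into \<open>J\<close>.\<close>

lemma gdim_neq_0_if_regular:
  assumes J: "gideal J" "J \<noteq> P" and x: "x \<in> P a" "a \<noteq> 0" "colon J a x = J"
  shows "gdim J \<noteq> 0"
proof
  assume "gdim J = 0"
  then obtain N where N: "\<And>d. d \<ge> N \<Longrightarrow> HF J d = 0" using gdim_0_HF[OF J(1)] by metis
  have "J (N * a) = P (N * a)"
  proof (rule HF_le_eq[OF J(1) gideal_P])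
    show "J \<le> P" using gideal_subset[OF J(1)] by (simp add: le_fun_def)
    show "HF J (N * a) \<le> HF P (N * a)" using N[of "N * a"] x(2) by simp
  qed
  then have "x ^ N * 1 \<in> J (N * a + 0)" using P_power[OF x(1), of N] by simp
  then have "1 \<in> J 0" by (rule regular_power[OF x(1,3) one_in_P])
  then show False using gideal_one J by blast
qed

section \<open>Systems of \<open>n\<close> forms and the model case of the variables\<close>

definition fml :: "(nat \<Rightarrow> nat \<times> 'k::field mpoly) \<Rightarrow> bool"
  where "fml H \<longleftrightarrow> (\<forall>i\<in>{1..n}. fst (H i) \<noteq> 0 \<and> snd (H i) \<in> P (fst (H i)))"

text \<open>Each member is regular modulo every subset of the others, instead of modulo its
  predecessors in a fixed order: this symmetric form allows an arbitrary member to be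
  exchanged.\<close>

definition regular_fml :: "(nat \<Rightarrow> nat \<times> 'k::field mpoly) \<Rightarrow> bool"
  where "regular_fml H \<longleftrightarrow> (\<forall>T\<subseteq>{1..n}. \<forall>j\<in>{1..n} - T.
    colon (Gen (H ` T)) (fst (H j)) (snd (H j)) = Gen (H ` T))"

lemma fmlD: "fml H \<Longrightarrow> i \<in> {1..n} \<Longrightarrow> fst (H i) \<noteq> 0 \<and> snd (H i) \<in> P (fst (H i))"
  unfolding fml_def by blast

lemma regular_fmlD: "regular_fml H \<Longrightarrow> T \<subseteq> {1..n} \<Longrightarrow> j \<in> {1..n} \<Longrightarrow> j \<notin> T \<Longrightarrow>
    colon (Gen (H ` T)) (fst (H j)) (snd (H j)) = Gen (H ` T)"
  unfolding regular_fml_def by blast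

lemma fml_upd: "fml H \<Longrightarrow> b \<noteq> 0 \<Longrightarrow> y \<in> P b \<Longrightarrow> fml (H(i := (b, y)))"
  unfolding fml_def by simp

lemma forms_fml:
  assumes "fml H" "T \<subseteq> {1..n}"
  shows "forms (H ` T)"
  unfolding forms_def
proof clarify
  fix a x i assume i: "(a, x) = H i" "i \<in> T"
  then have "snd (H i) \<in> P (fst (H i))" using fmlD[OF assms(1), of i] assms(2) by blast
  then show "x \<in> P a" unfolding i(1)[symmetric] by simp
qed

lemma gideal_Gen_fml: "fml H \<Longrightarrow> T \<subseteq> {1..n} \<Longrightarrow> gideal (Gen (H ` T))"
  using gideal_Gen forms_fml by blast

lemma Gen_fml_insert:
  assumes "fml H" "insert j T \<subseteq> {1..n}"
  shows "Gen (H ` insert j T) = adj (Gen (H ` T)) (fst (H j)) (snd (H j))"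
  using Gen_insert[of "fst (H j)" "snd (H j)" "H ` T"] forms_fml[OF assms] by simp

lemma Gen_fml_neq_P:
  assumes "fml H" "T \<subseteq> {1..n}"
  shows "Gen (H ` T) \<noteq> P"
proof
  assume "Gen (H ` T) = P"
  then have 1: "1 \<in> Gen (H ` T) 0" using one_in_P by simp
  have "Gen (H ` T) \<le> irrelevant"
  proof (rule Gen_least[OF gprime_gideal[OF gprime_irrelevant]])
    fix a x assume "(a, x) \<in> H ` T"
    then obtain i where "i \<in> {1..n}" "H i = (a, x)" using assms(2) by auto
    then show "x \<in> irrelevant a" using fmlD[OF assms(1), of i] by (simp add: irrelevant_def)
  qed
  then have "Gen (H ` T) 0 \<subseteq> irrelevant 0" by (rule le_funD)
  then show False using 1 by (auto simp: irrelevant_def)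
qed

lemma regular_fml_insert:
  assumes H: "fml H" "regular_fml H" and j: "insert j T \<subseteq> {1..n}" "j \<notin> T"
  shows "gdim (Gen (H ` T)) = Suc (gdim (Gen (H ` insert j T)))"
    and "gmult (Gen (H ` insert j T)) = of_nat (fst (H j)) * gmult (Gen (H ` T))"
proof -
  have T: "T \<subseteq> {1..n}" and j': "j \<in> {1..n}" using j by auto
  note g = gideal_Gen_fml[OF H(1) T] and Hj = fmlD[OF H(1) j']
  note reg = regular_fmlD[OF H(2) T j' j(2)]
  have d: "gdim (Gen (H ` T)) \<noteq> 0"
    using gdim_neq_0_if_regular[OF g Gen_fml_neq_P[OF H(1) T] _ _ reg] Hj by blast
  show "gdim (Gen (H ` T)) = Suc (gdim (Gen (H ` insert j T)))"
    using gdim_regular[OF g _ reg] d Hj unfolding Gen_fml_insert[OF H(1) j(1)] by simp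
  show "gmult (Gen (H ` insert j T)) = of_nat (fst (H j)) * gmult (Gen (H ` T))"
    using gmult_regular[OF g _ reg] d Hj unfolding Gen_fml_insert[OF H(1) j(1)] by blast
qed

definition var_fml :: "nat \<Rightarrow> nat \<times> 'k::field mpoly"
  where "var_fml i = (1, X i)"

lemma fml_var: "fml var_fml"
  unfolding fml_def var_fml_def fst_conv snd_conv using X_in_P one_neq_zero by blast

lemma lookup_X_times: "lookup (X j * z) (m + single j 1) = lookup z m"
proof -
  have "X j * z = (\<Sum>m\<in>keys z. single m (lookup z m) * X j)"
    by (subst (1) mpoly_eq_sum_monomials[of z]) (simp add: sum_distrib_left mult.commute)
  then have "lookup (X j * z) (m + single j 1)
    = (\<Sum>m'\<in>keys z. (lookup z m' when m' = m))"
    by (simp add: lookup_sum X_times_single lookup_single)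
  also have "\<dots> = lookup z m"
    by (auto simp: when_def in_keys_iff)
  finally show ?thesis .
qed

text \<open>For an ideal generated by variables membership is decided monomial by monomial, which
  makes the regularity of the remaining variables evident.\<close>

lemma Gen_var_fml:
  assumes T: "T \<subseteq> {1..n}"
  shows "Gen (var_fml ` T) d =
    {f \<in> P d. \<forall>m\<in>keys f. \<exists>i\<in>T. lookup m i \<noteq> 0}"
proof -
  note g = gideal_Gen_fml[OF fml_var T]
  define V :: "'a family" where
    "V d = {f \<in> P d. \<forall>m\<in>keys f. \<exists>i\<in>T. lookup m i \<noteq> 0}" for d
  have "Gen (var_fml ` T) \<le> V"
  proof (rule Gen_least)
    show "gideal V"
    proof (rule gidealI)
      show "V d \<subseteq> P d" for d unfolding V_def by blast
      have "V d = P d \<inter> {f. \<forall>m\<in>keys f. \<exists>i\<in>T. lookup m i \<noteq> 0}" for d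
        unfolding V_def by blast
      then show "sp.subspace (V d)" for d
        using sp.subspace_inter[OF subspace_P subspace_keys] by simp
      fix d e and p q :: "'a mpoly" assume p: "p \<in> P e" and q: "q \<in> V d"
      have "\<exists>i\<in>T. lookup m i \<noteq> 0" if m: "m \<in> keys (p * q)" for m
      proof -
        obtain a b where "a \<in> keys p" "b \<in> keys q" "m = a + b"
          by (rule keys_mult_cases[OF m])
        then show ?thesis using q unfolding V_def by (auto simp: lookup_add)
      qed
      then show "p * q \<in> V (e + d)" using P_mult[OF p] q unfolding V_def by blast
    qed
    show "x \<in> V a" if ax: "(a, x) \<in> var_fml ` T" for a x
    proof -
      obtain i where i: "i \<in> T" "a = 1" "x = X i" using ax by (auto simp: var_fml_def)
      have "lookup m i \<noteq> 0" if "m \<in> keys (X i :: 'a mpoly)" for m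
        using that by (simp add: X_def)
      moreover have "X i \<in> P 1" using i(1) T X_in_P by blast
      ultimately show ?thesis using i unfolding V_def by blast
    qed
  qed
  moreover have "V d \<subseteq> Gen (var_fml ` T) d" for d
  proof
    fix f assume f: "f \<in> V d"
    have "single m c \<in> Gen (var_fml ` T) d" if m: "m \<in> keys f" for m and c :: 'a
    proof -
      have md: "keys m \<subseteq> {1..n}" "monom_degree m = d"
        using f m unfolding V_def P_iff by auto
      obtain i where "i \<in> T" "lookup m i \<noteq> 0"
        using f m unfolding V_def by blast
      then have i: "i \<in> T" "i \<in> keys m" by (auto simp: in_keys_iff)
      obtain m' where m': "m = m' + single i 1"
        using monom_split[OF i(2)] by blast
      have "keys m' \<subseteq> keys m"
        unfolding m' by (auto simp: in_keys_iff lookup_add)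
      then have "single m' c \<in> P (monom_degree m')"
        using md(1) by (intro single_in_P) blast
      moreover have "X i \<in> Gen (var_fml ` T) 1"
        by (rule mem_Gen) (use i(1) in \<open>auto simp: var_fml_def\<close>)
      ultimately have "single m' c * X i \<in> Gen (var_fml ` T) (monom_degree m' + 1)"
        by (rule gideal_mult[OF g])
      moreover have "monom_degree m' + 1 = d"
        using md(2) unfolding m' by (simp add: monom_degree_add)
      ultimately show ?thesis unfolding X_times_single m'[symmetric] by simp
    qed
    then show "f \<in> Gen (var_fml ` T) d" by (rule subspace_memI[OF gideal_subspace[OF g]])
  qed
  ultimately have "Gen (var_fml ` T) d = V d" by (intro antisym) (auto simp: le_fun_def)
  then show ?thesis unfolding V_def .
qed

lemma regular_fml_var: "regular_fml var_fml"
  unfolding regular_fml_def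
proof (intro allI impI ballI)
  fix T j assume T: "T \<subseteq> {1..n}" and j: "j \<in> {1..n} - T"
  have "colon (Gen (var_fml ` T)) 1 (X j) = Gen (var_fml ` T)"
  proof (rule colon_eqI[OF gideal_Gen_fml[OF fml_var T]])
    show "X j \<in> P 1" using X_in_P j by blast
    fix d z assume z: "z \<in> P d" and Xz: "X j * z \<in> Gen (var_fml ` T) (1 + d)"
    have "\<exists>i\<in>T. lookup m i \<noteq> 0" if "m \<in> keys z" for m
    proof -
      have "m + single j 1 \<in> keys (X j * z)"
        using that lookup_X_times[of j z m] by (simp add: in_keys_iff)
      then obtain i where "i \<in> T" "lookup (m + single j 1) i \<noteq> 0"
        using Xz unfolding Gen_var_fml[OF T] by blast
      then show ?thesis
        using j by (intro bexI[of _ i]) (auto simp: lookup_add lookup_single when_def split: if_splits)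
    qed
    then show "z \<in> Gen (var_fml ` T) d" using z unfolding Gen_var_fml[OF T] by blast
  qed
  then show "colon (Gen (var_fml ` T)) (fst (var_fml j)) (snd (var_fml j)) = Gen (var_fml ` T)"
    by (simp add: var_fml_def)
qed

text \<open>The quotient by all variables is the ground field in degree 0. This anchors the
  normalisation of dimension and multiplicity.\<close>

lemma Gen_all_vars:
  "gdim (Gen (var_fml ` {1..n}) :: 'k::field family) = 0"
  "gmult (Gen (var_fml ` {1..n}) :: 'k family) = 1"
proof -
  define J :: "'k family" where "J = Gen (var_fml ` {1..n})"
  have g: "gideal J" unfolding J_def by (rule gideal_Gen_fml[OF fml_var]) simp
  have "X i \<in> J 1" if "i \<in> {1..n}" for i
    unfolding J_def by (rule mem_Gen) (use that in \<open>auto simp: var_fml_def\<close>)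
  then have pos: "HF J d = 0" if "d \<noteq> 0" for d
    using gideal_all_variables[OF g _ that] by (simp add: HF_def)
  then have d: "gdim J = 0" by (intro gdim_eq_0I[of 1]) simp
  have "J \<noteq> P" unfolding J_def by (rule Gen_fml_neq_P[OF fml_var]) simp
  then have J0: "J 0 = {0}" using gideal_degree_0[OF g] by blast
  have "P 0 = sp.span {1 :: 'k mpoly}"
  proof
    have "single 0 c = scl c 1" for c :: 'k by (simp add: scl_def)
    then show "P 0 \<subseteq> sp.span {1 :: 'k mpoly}"
      using P_0_const by (metis sp.span_base sp.span_scale singletonI subsetI)
    show "sp.span {1 :: 'k mpoly} \<subseteq> P 0"
      using one_in_P by (intro sp.span_minimal subspace_P) simp
  qed
  then have "sp.dim (P 0 :: 'k mpoly set) = 1"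
    using sp.dim_eq_card[of "{1 :: 'k mpoly}" "P 0"] by (simp add: sp.span_span)
  moreover have "sp.dim (J 0) = 0"
    unfolding J0 by (rule sp.dim_zero)
  ultimately have "HF J 0 = 1" by (simp add: HF_def)
  then have m: "gmult J = 1" using gmult_gdim_0[OF d, of 1] pos by simp
  show "gdim (Gen (var_fml ` {1..n}) :: 'k family) = 0"
    "gmult (Gen (var_fml ` {1..n}) :: 'k family) = 1"
    using d m unfolding J_def by simp_all
qed

lemma regular_fml_Gen:
  fixes H :: "nat \<Rightarrow> nat \<times> 'k::field mpoly"
  assumes H: "fml H" "regular_fml H" and T: "T \<subseteq> {1..n}"
  shows "gdim (Gen {} :: 'k family) = gdim (Gen (H ` T)) + card T"
    and "gmult (Gen (H ` T)) = of_nat (\<Prod>i\<in>T. fst (H i)) * gmult (Gen {} :: 'k family)"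
proof -
  have "finite T" using T finite_subset by blast
  then have "gdim (Gen {} :: 'k family) = gdim (Gen (H ` T)) + card T \<and>
    gmult (Gen (H ` T)) = of_nat (\<Prod>i\<in>T. fst (H i)) * gmult (Gen {} :: 'k family)"
    using T
  proof (induction T)
    case (insert j T)
    then show ?case
      using regular_fml_insert[OF H insert.prems insert.hyps(2)] by (simp del: image_insert of_nat_prod)
  qed simp
  then show "gdim (Gen {} :: 'k family) = gdim (Gen (H ` T)) + card T"
    "gmult (Gen (H ` T)) = of_nat (\<Prod>i\<in>T. fst (H i)) * gmult (Gen {} :: 'k family)"
    by blast+
qed

text \<open>The zero ideal is reached backwards from the ideal of all variables along the regular
  family they form, so no monomials have to be counted.\<close>

lemma Gen_empty_gdim: "gdim (Gen {} :: 'k::field family) = n"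
  using regular_fml_Gen(1)[where 'k = 'k, OF fml_var regular_fml_var order_refl]
    Gen_all_vars(1)[where 'k = 'k] by simp

lemma Gen_empty_gmult: "gmult (Gen {} :: 'k::field family) = 1"
  using regular_fml_Gen(2)[where 'k = 'k, OF fml_var regular_fml_var order_refl]
    Gen_all_vars(2)[where 'k = 'k] by (simp add: var_fml_def)

lemma gdim_Gen_ge:
  assumes "fml H" "T \<subseteq> {1..n}"
  shows "n \<le> gdim (Gen (H ` T)) + card T"
proof -
  have "finite T" using assms(2) finite_subset by blast
  then show ?thesis
    using assms(2)
  proof (induction T)
    case empty
    then show ?case by (simp add: Gen_empty_gdim)
  next
    case (insert j T)
    have "gdim (Gen (H ` T)) - 1 \<le> gdim (Gen (H ` insert j T))"
      unfolding Gen_fml_insert[OF assms(1) insert.prems]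
      using fmlD[OF assms(1)] insert.prems
      by (intro gdim_adj_ge gideal_Gen_fml[OF assms(1)]) auto
    then show ?case using insert by simp
  qed
qed

text \<open>The ideal of the other members has dimension one, and the old member is regular modulo
  it, so the new one is as well. \<open>regular_exchange_left\<close> then carries the regularity of
  \<open>y\<close> down to every subset of the others, and \<open>regular_exchange_right\<close>
  keeps the others regular once \<open>y\<close> is adjoined.\<close>

lemma regular_fml_upd:
  assumes H: "fml H" "regular_fml H" and i: "i \<in> {1..n}" and y: "b \<noteq> 0" "y \<in> P b"
    and d: "gdim (Gen (H(i := (b, y)) ` {1..n})) = 0"
  shows "regular_fml (H(i := (b, y)))"
proof -
  define H' where "H' = H(i := (b, y))"
  have H': "fml H'" unfolding H'_def by (rule fml_upd[OF H(1) y])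
  define S where "S = {1..n} - {i}"
  have S: "S \<subseteq> {1..n}" "i \<notin> S" "insert i S = {1..n}" unfolding S_def using i by auto
  have im: "H' ` T = H ` T" if "i \<notin> T" for T unfolding H'_def using that by auto
  have img: "Gen (H' ` insert i T) = adj (Gen (H ` T)) b y" if "T \<subseteq> S" for T
  proof -
    have T: "i \<notin> T" "insert i T \<subseteq> {1..n}" using that S i by auto
    have "H' i = (b, y)" unfolding H'_def by simp
    then show ?thesis using Gen_fml_insert[OF H' T(2)] unfolding im[OF T(1)] by simp
  qed
  note Hi = fmlD[OF H(1) i]
  have "gdim (Gen (H ` S)) = 1"
  proof -
    have "gdim (Gen (H ` {1..n})) = 0"
      using regular_fml_Gen(1)[OF H order_refl] Gen_empty_gdim[where 'k = 'a] by simp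
    then show ?thesis using regular_fml_insert(1)[OF H, of i S] S by simp
  qed
  then have regS: "colon (Gen (H ` S)) b y = Gen (H ` S)"
    using regular_if_gdim_1[OF gideal_Gen_fml[OF H(1) S(1)] _ _ _ regular_fmlD[OF H(2) S(1) i S(2)] y(2)]
      Hi d img[of S] S(3) unfolding H'_def by simp
  \<comment> \<open>Induction on the set \<open>U\<close> of members that have been dropped from
    \<open>S\<close>.\<close>
  have reg: "colon (Gen (H ` (S - U))) b y = Gen (H ` (S - U))" if "finite U" "U \<subseteq> S" for U
    using that
  proof (induction U)
    case empty
    then show ?case using regS by simp
  next
    case (insert z U)
    define T where "T = S - insert z U"
    have z: "insert z T = S - U" "z \<notin> T" "z \<in> {1..n}" "T \<subseteq> {1..n}"
      using insert.hyps insert.prems S unfolding T_def by auto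
    have zT: "insert z T \<subseteq> {1..n}" using z(3,4) by blast
    have "colon (Gen (H ` insert z T)) b y = Gen (H ` insert z T)"
      using insert unfolding z(1) by blast
    then have "colon (adj (Gen (H ` T)) (fst (H z)) (snd (H z))) b y
        = adj (Gen (H ` T)) (fst (H z)) (snd (H z))"
      unfolding Gen_fml_insert[OF H(1) zT] .
    then show ?case
      unfolding T_def[symmetric] using fmlD[OF H(1) z(3)]
      by (intro regular_exchange_left[OF gideal_Gen_fml[OF H(1) z(4)] _ _
            regular_fmlD[OF H(2) z(4,3,2)] y(2)]) auto
  qed
  have reg': "colon (Gen (H ` T)) b y = Gen (H ` T)" if "T \<subseteq> S" for T
  proof -
    have "T = S - (S - T)" using that by blast
    moreover have "finite (S - T)" unfolding S_def by simp
    ultimately show ?thesis using reg[of "S - T"] by (metis Diff_subset)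
  qed
  show ?thesis
    unfolding regular_fml_def H'_def[symmetric]
  proof (intro allI impI ballI)
    fix T j assume T: "T \<subseteq> {1..n}" and j: "j \<in> {1..n} - T"
    show "colon (Gen (H' ` T)) (fst (H' j)) (snd (H' j)) = Gen (H' ` T)"
    proof (cases "j = i")
      case True
      then have "T \<subseteq> S" "i \<notin> T" using T j unfolding S_def by auto
      then show ?thesis using reg' im True unfolding H'_def by simp
    next
      case ji: False
      then have Hj: "H' j = H j" unfolding H'_def by simp
      show ?thesis
      proof (cases "i \<in> T")
        case False
        then show ?thesis using im regular_fmlD[OF H(2) T] j Hj by simp
      next
        case True
        define T0 where "T0 = T - {i}"
        have T0: "T0 \<subseteq> S" "T = insert i T0" "insert j T0 \<subseteq> S" "j \<notin> T0" "T0 \<subseteq> {1..n}"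
          using T True j ji unfolding T0_def S_def by auto
        have jn: "j \<in> {1..n}" "insert j T0 \<subseteq> {1..n}" using j T0(5) by auto
        have "colon (adj (Gen (H ` T0)) b y) (fst (H j)) (snd (H j)) = adj (Gen (H ` T0)) b y"
          using fmlD[OF H(1) jn(1)] reg'[OF T0(3)] unfolding Gen_fml_insert[OF H(1) jn(2)]
          by (intro regular_exchange_right[OF gideal_Gen_fml[OF H(1) T0(5)] _ _
                regular_fmlD[OF H(2) T0(5) jn(1) T0(4)] y(2)]) auto
        then show ?thesis unfolding T0(2) img[OF T0(1)] Hj .
      qed
    qed
  qed
qed

text \<open>Pass from the variables to a generic system of linear forms, and from there to the given
  system, exchanging one element at a time.\<close>

lemma parameters_regular:
  fixes H :: "nat \<Rightarrow> nat \<times> 'k::field mpoly"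
  assumes inf: "infinite (UNIV :: 'k set)" and H: "fml H" "gdim (Gen (H ` {1..n})) = 0"
  shows "regular_fml H"
proof -
  \<comment> \<open>\<open>A\<close> starts at \<open>H\<close> and \<open>B\<close> at the
    variables; step \<open>i\<close> puts the same generic linear form into position
    \<open>i\<close> of both. Regularity is preserved forwards along \<open>B\<close> and traced
    backwards along \<open>A\<close>, and after \<open>n\<close> steps the two systems
    coincide.\<close>
  have "\<exists>A B :: nat \<Rightarrow> nat \<times> 'k mpoly. fml A \<and> fml B \<and> gdim (Gen (A ` {1..n})) = 0 \<and>
      regular_fml B \<and> (regular_fml A \<longrightarrow> regular_fml H) \<and> (\<forall>k\<in>{1..i}. A k = B k)"
    if "i \<le> n" for i
    using that
  proof (induction i)
    case 0
    show ?case
      by (rule exI[of _ H], rule exI[of _ var_fml]) (use H fml_var regular_fml_var in auto)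
  next
    case (Suc i)
    then obtain A B :: "nat \<Rightarrow> nat \<times> 'k mpoly" where A: "fml A" "gdim (Gen (A ` {1..n})) = 0"
        "regular_fml A \<longrightarrow> regular_fml H"
      and B: "fml B" "regular_fml B" and AB: "\<forall>k\<in>{1..i}. A k = B k" by auto
    define S where "S = {1..n} - {Suc i}"
    have S: "S \<subseteq> {1..n}" "insert (Suc i) S = {1..n}" "card S = n - 1" "Suc i \<in> {1..n}" "Suc i \<notin> S"
      using Suc.prems unfolding S_def by auto
    have B0: "gdim (Gen (B ` {1..n})) = 0"
      using regular_fml_Gen(1)[OF B order_refl] Gen_empty_gdim[where 'k = 'k] by simp
    \<comment> \<open>At most one because one more form reaches dimension 0, at least one because
      \<open>n - 1\<close> forms lower the dimension \<open>n\<close> at most \<open>n - 1\<close>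
      times.\<close>
    have d1: "gdim (Gen (F ` S)) = 1" if F: "fml F" "gdim (Gen (F ` {1..n})) = 0"
      for F :: "nat \<Rightarrow> nat \<times> 'k mpoly"
    proof -
      have "gdim (Gen (F ` S)) - 1 \<le> gdim (Gen (F ` insert (Suc i) S))"
        unfolding Gen_fml_insert[OF F(1) S(2)[THEN equalityD1]]
        using fmlD[OF F(1) S(4)] by (intro gdim_adj_ge gideal_Gen_fml[OF F(1) S(1)]) auto
      moreover have "n \<le> gdim (Gen (F ` S)) + card S" by (rule gdim_Gen_ge[OF F(1) S(1)])
      ultimately show ?thesis using F(2) S Suc.prems by simp
    qed
    have "\<exists>w\<in>P 1. \<forall>J\<in>{Gen (A ` S), Gen (B ` S)}. gdim (adj J 1 w) = gdim J - 1"
      by (rule generic_linear_form[OF inf])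
        (use gideal_Gen_fml[OF A(1) S(1)] gideal_Gen_fml[OF B(1) S(1)] d1[OF A(1,2)] d1[OF B(1) B0]
          in auto)
    then obtain w where w: "w \<in> P 1"
      "\<forall>J\<in>{Gen (A ` S), Gen (B ` S)}. gdim (adj J 1 w) = gdim J - 1" by blast
    have upd: "fml (F(Suc i := (1, w)))" "gdim (Gen (F(Suc i := (1, w)) ` {1..n})) = 0"
      if F: "fml F" "gdim (adj (Gen (F ` S)) 1 w) = 0" for F :: "nat \<Rightarrow> nat \<times> 'k mpoly"
    proof -
      show f: "fml (F(Suc i := (1, w)))" using fml_upd[OF F(1) _ w(1)] by simp
      have "F(Suc i := (1, w)) ` S = F ` S" using S(5) by auto
      then show "gdim (Gen (F(Suc i := (1, w)) ` {1..n})) = 0"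
        using Gen_fml_insert[OF f, of "Suc i" S] S(2) F(2) by simp
    qed
    have A0: "gdim (adj (Gen (A ` S)) 1 w) = 0" and B0': "gdim (adj (Gen (B ` S)) 1 w) = 0"
      using w(2) d1[OF A(1,2)] d1[OF B(1) B0] by auto
    note A' = upd[OF A(1) A0] and B' = upd[OF B(1) B0']
    show ?case
    proof (rule exI[of _ "A(Suc i := (1, w))"], rule exI[of _ "B(Suc i := (1, w))"], intro conjI impI)
      show "fml (A(Suc i := (1, w)))" "fml (B(Suc i := (1, w)))"
        "gdim (Gen (A(Suc i := (1, w)) ` {1..n})) = 0"
        using A' B' by blast+
      show "regular_fml (B(Suc i := (1, w)))"
        by (rule regular_fml_upd[OF B S(4) _ w(1) B'(2)]) simp
    next
      assume r: "regular_fml (A(Suc i := (1, w)))"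
      \<comment> \<open>The exchange lemma is symmetric: \<open>A\<close> arises from the changed
        system by putting its old member back, which is again a parameter.\<close>
      have undo: "(A(Suc i := (1, w)))(Suc i := (fst (A (Suc i)), snd (A (Suc i)))) = A" by simp
      have "regular_fml ((A(Suc i := (1, w)))(Suc i := (fst (A (Suc i)), snd (A (Suc i)))))"
        using fmlD[OF A(1) S(4)] A(2) by (intro regular_fml_upd[OF A'(1) r S(4)]) (auto simp: undo)
      then show "regular_fml H" using A(3) unfolding undo by blast
    next
      show "\<forall>k\<in>{1..Suc i}. (A(Suc i := (1, w))) k = (B(Suc i := (1, w))) k"
        using AB by (auto simp: le_Suc_eq)
    qed
  qed
  from this[of n] obtain A B :: "nat \<Rightarrow> nat \<times> 'k mpoly" where
    "regular_fml B" "regular_fml A \<longrightarrow> regular_fml H" and AB: "\<forall>k\<in>{1..n}. A k = B k" by auto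
  moreover have "regular_fml A"
  proof -
    have "A ` T = B ` T" if "T \<subseteq> {1..n}" for T using AB that by (intro image_cong) auto
    then show ?thesis using \<open>regular_fml B\<close> AB unfolding regular_fml_def by simp
  qed
  ultimately show ?thesis by blast
qed

lemma extend_parameters:
  fixes H :: "nat \<Rightarrow> nat \<times> 'k::field mpoly"
  assumes inf: "infinite (UNIV :: 'k set)" and H: "fml H" "c \<le> n" "gdim (Gen (H ` {1..c})) = n - c"
    and m: "c \<le> m" "m \<le> n"
  shows "\<exists>H'. fml H' \<and> (\<forall>i\<in>{1..c}. H' i = H i) \<and> gdim (Gen (H' ` {1..m})) = n - m"
  using m
proof (induction m rule: dec_induct)
  case base
  then show ?case using H by blast
next
  case (step m)
  then obtain H' where H': "fml H'" "\<forall>i\<in>{1..c}. H' i = H i" "gdim (Gen (H' ` {1..m})) = n - m"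
    by auto
  have sub: "{1..m} \<subseteq> {1..n}" "insert (Suc m) {1..m} \<subseteq> {1..n}" "insert (Suc m) {1..m} = {1..Suc m}"
    using step.prems by auto
  obtain w where w: "w \<in> P 1" "gdim (adj (Gen (H' ` {1..m})) 1 w) = n - m - 1"
    using generic_linear_form[OF inf, of "{Gen (H' ` {1..m})}"] gideal_Gen_fml[OF H'(1) sub(1)]
      H'(3) step.prems by auto
  have f: "fml (H'(Suc m := (1, w)))" using fml_upd[OF H'(1) _ w(1)] by simp
  have im: "H'(Suc m := (1, w)) ` {1..m} = H' ` {1..m}" by auto
  have "gdim (Gen (H'(Suc m := (1, w)) ` {1..Suc m})) = n - Suc m"
    using Gen_fml_insert[OF f sub(2)] w(2) unfolding im sub(3) by simp
  moreover have "\<forall>i\<in>{1..c}. (H'(Suc m := (1, w))) i = H i" using H'(2) step by auto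
  ultimately show ?case using f by blast
qed

lemma gmult_le_prod:
  fixes J :: "'k::field family"
  assumes inf: "infinite (UNIV :: 'k set)" and H: "fml H" "c \<le> n" "gdim (Gen (H ` {1..c})) = n - c"
    and J: "gideal J" "Gen (H ` {1..c}) \<le> J" "gdim J = n - c"
  shows "gmult J \<le> of_nat (\<Prod>i=1..c. fst (H i))"
proof -
  \<comment> \<open>\<open>parameters_regular\<close> concerns full systems of \<open>n\<close>
    forms; the completion leaves the first \<open>c\<close> members, and with them the product of
    degrees, untouched.\<close>
  obtain H' where H': "fml H'" "\<forall>i\<in>{1..c}. H' i = H i" "gdim (Gen (H' ` {1..n})) = 0"
    using extend_parameters[OF inf H H(2) order_refl] by auto
  have c: "{1..c} \<subseteq> {1..n}" using H(2) by simp
  have im: "H' ` {1..c} = H ` {1..c}" using H'(2) by (intro image_cong) auto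
  have "gmult J \<le> gmult (Gen (H ` {1..c}))"
    by (rule gmult_mono[OF gideal_Gen_fml[OF H(1) c] J(1,2)]) (simp only: H(3) J(3))
  also have "\<dots> = of_nat (\<Prod>i=1..c. fst (H' i))"
    using regular_fml_Gen(2)[OF H'(1) parameters_regular[OF inf H'(1,3)] c]
    unfolding im Gen_empty_gmult by simp
  also have "(\<Prod>i=1..c. fst (H' i)) = (\<Prod>i=1..c. fst (H i))"
    using H'(2) by (intro prod.cong) auto
  finally show ?thesis .
qed

section \<open>Ideals of the polynomial ring and of its quotients\<close>

abbreviation C :: "'k::field mpoly set"
  where "C \<equiv> carrier (mpoly_ring n)"

lemma C_iff: "p \<in> C \<longleftrightarrow> (\<forall>m\<in>keys p. keys m \<subseteq> {1..n})"
  by (simp add: mpoly_ring_def)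

lemma C_closed:
  fixes p q :: "'k::field mpoly"
  shows "p \<in> C \<Longrightarrow> q \<in> C \<Longrightarrow> p + q \<in> C" "p \<in> C \<Longrightarrow> q \<in> C \<Longrightarrow> p * q \<in> C"
    "0 \<in> (C :: 'k mpoly set)" "1 \<in> (C :: 'k mpoly set)" "p \<in> C \<Longrightarrow> - p \<in> C"
proof -
  interpret R: cring "mpoly_ring n :: 'k mpoly ring" by (rule mpoly_ring_cring)
  show "p \<in> C \<Longrightarrow> q \<in> C \<Longrightarrow> p + q \<in> C" "p \<in> C \<Longrightarrow> q \<in> C \<Longrightarrow> p * q \<in> C"
    "0 \<in> (C :: 'k mpoly set)" "1 \<in> (C :: 'k mpoly set)"
    using R.a_closed[of p q] R.m_closed[of p q] R.zero_closed R.one_closed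
    by (simp_all add: mpoly_ring_simps)
  show "p \<in> C \<Longrightarrow> - p \<in> C" by (simp add: C_iff)
qed

lemma P_le_subset_C: "P_le d \<subseteq> C"
  unfolding P_le_def C_iff[abs_def] by (auto simp: C_iff simp del: One_nat_def)

lemma P_subset_C: "P d \<subseteq> C"
  unfolding homogeneous_component_def by blast

lemma C_P_le:
  assumes "p \<in> C"
  obtains d where "p \<in> P_le d"
proof
  show "p \<in> P_le (Max (insert 0 (monom_degree ` keys p)))"
    unfolding P_le_def
  proof (intro CollectI ballI conjI)
    fix m assume m: "m \<in> keys p"
    then show "keys m \<subseteq> {1..n}" using assms C_iff by blast
    show "monom_degree m \<le> Max (insert 0 (monom_degree ` keys p))"
      using m by (intro Max_ge) auto
  qed
qed

lemma const_in_C: "single 0 c \<in> C"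
  using const_in_P P_subset_C by blast

lemma scl_in_C: "p \<in> C \<Longrightarrow> scl c p \<in> C"
  unfolding scl_def by (rule C_closed(2)[OF const_in_C])

context
  fixes I :: "'k::field mpoly set"
  assumes I: "ideal I (mpoly_ring n)"
begin

lemma ideal_subset_C: "I \<subseteq> C"
  using additive_subgroup.a_subset[OF ideal.axioms(1)[OF I]] .

lemma ideal_zero: "0 \<in> I"
  using additive_subgroup.zero_closed[OF ideal.axioms(1)[OF I]] by (simp add: mpoly_ring_simps)

lemma ideal_add: "p \<in> I \<Longrightarrow> q \<in> I \<Longrightarrow> p + q \<in> I"
  using additive_subgroup.a_closed[OF ideal.axioms(1)[OF I]] by (simp add: mpoly_ring_simps)

lemma ideal_mult: "p \<in> C \<Longrightarrow> q \<in> I \<Longrightarrow> p * q \<in> I"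
  using ideal.I_l_closed[OF I] by (simp add: mpoly_ring_simps)

lemma ideal_scl: "q \<in> I \<Longrightarrow> scl c q \<in> I"
  unfolding scl_def by (rule ideal_mult[OF const_in_C])

lemma ideal_uminus: "q \<in> I \<Longrightarrow> - q \<in> I"
  using ideal_mult[of "- 1" q] C_closed(4,5) by fastforce

lemma ideal_diff: "p \<in> I \<Longrightarrow> q \<in> I \<Longrightarrow> p - q \<in> I"
  using ideal_add[of p "- q"] ideal_uminus by simp

lemma ideal_subspace: "sp.subspace I"
  by (rule sp.subspaceI[OF ideal_zero ideal_add ideal_scl])

lemma ideal_one_notin:
  assumes "I \<noteq> C"
  shows "1 \<notin> I"
proof
  assume 1: "1 \<in> I"
  have "q \<in> I" if "q \<in> C" for q using ideal_mult[OF that 1] by simp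
  then show False using assms ideal_subset_C by blast
qed

abbreviation coset :: "'k mpoly \<Rightarrow> 'k mpoly set"
  where "coset p \<equiv> I +>\<^bsub>mpoly_ring n\<^esub> p"

lemma coset_alt: "coset p = (\<lambda>i. i + p) ` I"
  by (auto simp: a_r_coset_def' mpoly_ring_simps)

lemma coset_eq_iff: "coset p = coset q \<longleftrightarrow> p - q \<in> I"
proof
  assume "coset p = coset q"
  moreover have "0 + p \<in> coset p" unfolding coset_alt using ideal_zero by blast
  ultimately obtain i where "i \<in> I" "p = i + q" unfolding coset_alt by auto
  then show "p - q \<in> I" by simp
next
  assume pq: "p - q \<in> I"
  show "coset p = coset q"
    unfolding coset_alt
  proof (intro equalityI image_subsetI)
    fix i assume i: "i \<in> I"
    show "i + p \<in> (\<lambda>i. i + q) ` I"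
      using ideal_add[OF i pq] by (intro image_eqI[of _ _ "i + (p - q)"]) simp_all
    show "i + q \<in> (\<lambda>i. i + p) ` I"
      using ideal_diff[OF i pq] by (intro image_eqI[of _ _ "i - (p - q)"]) simp_all
  qed
qed

lemma coset_zero: "coset 0 = I"
  unfolding coset_alt by simp

lemma coset_eq_zero_iff: "coset p = I \<longleftrightarrow> p \<in> I"
  using coset_eq_iff[of p 0] unfolding coset_zero by simp

lemma quot_hom:
  shows "p \<in> C \<Longrightarrow> q \<in> C \<Longrightarrow> coset (p + q) = coset p \<oplus>\<^bsub>mpoly_ring n Quot I\<^esub> coset q"
    and "p \<in> C \<Longrightarrow> q \<in> C \<Longrightarrow> coset (p * q) = coset p \<otimes>\<^bsub>mpoly_ring n Quot I\<^esub> coset q"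
    and "p \<in> C \<Longrightarrow> coset p \<in> carrier (mpoly_ring n Quot I)"
  using ring_hom_add[OF ideal.rcos_ring_hom[OF I]] ring_hom_mult[OF ideal.rcos_ring_hom[OF I]]
    ring_hom_closed[OF ideal.rcos_ring_hom[OF I]]
  by (simp_all add: mpoly_ring_simps)

lemma quot_carrier:
  assumes "a \<in> carrier (mpoly_ring n Quot I)"
  obtains p where "p \<in> C" "a = coset p"
  using assms unfolding FactRing_def A_RCOSETS_def' by auto

lemma quot_zero: "\<zero>\<^bsub>mpoly_ring n Quot I\<^esub> = I"
  by (simp add: FactRing_def)

lemma primeideal_vimage_quot:
  assumes "primeideal q (mpoly_ring n Quot I)"
  shows "primeideal {r \<in> C. coset r \<in> q} (mpoly_ring n)" and "I \<subseteq> {r \<in> C. coset r \<in> q}"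
proof -
  show "primeideal {r \<in> C. coset r \<in> q} (mpoly_ring n)"
    by (rule ring_hom_ring.primeideal_vimage[OF ideal.rcos_ring_hom_ring[OF I] mpoly_ring_cring assms])
  have "I \<in> q"
    using additive_subgroup.zero_closed[OF ideal.axioms(1)[OF primeideal.axioms(1)[OF assms]]]
    by (simp add: quot_zero)
  moreover have "coset r = I" if "r \<in> I" for r using that by (simp add: coset_eq_zero_iff)
  ultimately show "I \<subseteq> {r \<in> C. coset r \<in> q}" using ideal_subset_C by auto
qed

lemma primeideal_vimage_quot_strict:
  assumes "primeideal q' (mpoly_ring n Quot I)" "q \<subset> q'"
  shows "{r \<in> C. coset r \<in> q} \<subset> {r \<in> C. coset r \<in> q'}"
proof -
  obtain a where a: "a \<in> q'" "a \<notin> q" using assms(2) by blast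
  then have "a \<in> carrier (mpoly_ring n Quot I)"
    using additive_subgroup.a_subset[OF ideal.axioms(1)[OF primeideal.axioms(1)[OF assms(1)]]] by blast
  then obtain r where "r \<in> C" "a = coset r" by (rule quot_carrier)
  then show ?thesis using a assms(2) by blast
qed

lemma coset_image_mem_iff:
  assumes "ideal p (mpoly_ring n)" "I \<subseteq> p"
  shows "coset r \<in> coset ` p \<longleftrightarrow> r \<in> p"
proof
  assume "coset r \<in> coset ` p"
  then obtain s where s: "s \<in> p" "r - s \<in> I" by (auto simp: coset_eq_iff)
  then have "r - s \<in> p" using assms(2) by blast
  then have "(r - s) \<oplus>\<^bsub>mpoly_ring n\<^esub> s \<in> p"
    by (rule additive_subgroup.a_closed[OF ideal.axioms(1)[OF assms(1)] _ s(1)])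
  then show "r \<in> p" by (simp add: mpoly_ring_simps)
qed simp

lemma primeideal_image_quot:
  assumes p: "primeideal p (mpoly_ring n)" "I \<subseteq> p"
  shows "primeideal (coset ` p) (mpoly_ring n Quot I)"
proof (rule primeidealI)
  note ip = primeideal.axioms(1)[OF p(1)]
  show "ideal (coset ` p) (mpoly_ring n Quot I)"
    by (rule ring.ring_ideal_imp_quot_ideal[OF mpoly_ring_ring I ip])
  show "cring (mpoly_ring n Quot I)"
    by (rule ideal.quotient_is_cring[OF I mpoly_ring_cring])
  have "p \<noteq> C" using primeideal.I_notcarr[OF p(1)] by simp
  then obtain r where "r \<in> C" "r \<notin> p"
    using additive_subgroup.a_subset[OF ideal.axioms(1)[OF ip]] by blast
  then show "carrier (mpoly_ring n Quot I) \<noteq> coset ` p"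
    using quot_hom(3)[of r] coset_image_mem_iff[OF ip p(2), of r] by auto
  fix a b assume "a \<in> carrier (mpoly_ring n Quot I)" "b \<in> carrier (mpoly_ring n Quot I)"
    and ab: "a \<otimes>\<^bsub>mpoly_ring n Quot I\<^esub> b \<in> coset ` p"
  obtain x where x: "x \<in> C" "a = coset x"
    by (rule quot_carrier[OF \<open>a \<in> carrier (mpoly_ring n Quot I)\<close>])
  obtain y where y: "y \<in> C" "b = coset y"
    by (rule quot_carrier[OF \<open>b \<in> carrier (mpoly_ring n Quot I)\<close>])
  have "coset (x * y) \<in> coset ` p"
    using ab unfolding x(2) y(2) quot_hom(2)[OF x(1) y(1)] .
  then have "x * y \<in> p" unfolding coset_image_mem_iff[OF ip p(2)] .
  then have "x \<in> p \<or> y \<in> p"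
    using primeideal.I_prime[OF p(1) x(1) y(1)] by (simp add: mpoly_ring_simps)
  then show "a \<in> coset ` p \<or> b \<in> coset ` p" using x y by blast
qed

end

section \<open>Homogeneous components; passage between ideals and families\<close>

definition hcomp :: "nat \<Rightarrow> 'k::field mpoly \<Rightarrow> 'k mpoly"
  where "hcomp d p = (\<Sum>m\<in>{m \<in> keys p. monom_degree m = d}.
    single m (lookup p m))"

lemma lookup_hcomp:
  "lookup (hcomp d p) m = (if monom_degree m = d then lookup p m else 0)"
  unfolding hcomp_def by (auto simp: lookup_sum lookup_single when_def in_keys_iff)

lemma hcomp_add: "hcomp d (p + q) = hcomp d p + hcomp d q"
  by (rule poly_mapping_eqI) (simp add: lookup_hcomp lookup_add)

lemma hcomp_zero [simp]: "hcomp d 0 = 0"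
  by (rule poly_mapping_eqI) (simp add: lookup_hcomp)

lemma hcomp_sum: "hcomp d (sum f A) = (\<Sum>x\<in>A. hcomp d (f x))"
  by (induction A rule: infinite_finite_induct) (simp_all add: hcomp_add)

lemma hcomp_in_P: "p \<in> C \<Longrightarrow> hcomp d p \<in> P d"
  unfolding P_iff C_iff by (auto simp: in_keys_iff lookup_hcomp split: if_splits simp del: One_nat_def)

lemma hcomp_homogeneous: "p \<in> P e \<Longrightarrow> hcomp d p = (if d = e then p else 0)"
  unfolding P_iff by (intro poly_mapping_eqI) (auto simp: lookup_hcomp in_keys_iff)

lemma P_le_sum_hcomp:
  assumes "p \<in> P_le D" "D \<le> A"
  shows "p = (\<Sum>d\<le>A. hcomp d p)"
proof (rule poly_mapping_eqI)
  fix m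
  have "monom_degree m \<le> A" if "lookup p m \<noteq> 0"
  proof -
    have "m \<in> keys p" using that by (simp add: in_keys_iff)
    then have "monom_degree m \<le> D" using assms(1) unfolding P_le_def by blast
    then show ?thesis using assms(2) by simp
  qed
  then show "lookup p m = lookup (\<Sum>d\<le>A. hcomp d p) m"
    by (auto simp: lookup_sum lookup_hcomp)
qed

lemma hcomp_mult:
  assumes p: "p \<in> C" and q: "q \<in> C"
  shows "hcomp N (p * q) = (\<Sum>i\<le>N. hcomp i p * hcomp (N - i) q)"
proof -
  obtain D E where D: "p \<in> P_le D" and E: "q \<in> P_le E" using C_P_le p q by metis
  define A where "A = max N (max D E)"
  have A: "D \<le> A" "E \<le> A" "N \<le> A" unfolding A_def by auto
  have "p * q = (\<Sum>i\<le>A. \<Sum>j\<le>A. hcomp i p * hcomp j q)"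
    by (subst (1) P_le_sum_hcomp[OF D A(1)], subst (1) P_le_sum_hcomp[OF E A(2)])
      (simp add: sum_product)
  then have "hcomp N (p * q) = (\<Sum>i\<le>A. \<Sum>j\<le>A. hcomp N (hcomp i p * hcomp j q))"
    by (simp add: hcomp_sum)
  also have "\<dots> = (\<Sum>i\<le>A. \<Sum>j\<le>A. if N = i + j then hcomp i p * hcomp j q else 0)"
    by (intro sum.cong refl hcomp_homogeneous[OF P_mult[OF hcomp_in_P[OF p] hcomp_in_P[OF q]]])
  also have "\<dots> = (\<Sum>i\<le>A. if i \<le> N then hcomp i p * hcomp (N - i) q else 0)"
  proof (intro sum.cong refl)
    fix i
    show "(\<Sum>j\<le>A. if N = i + j then hcomp i p * hcomp j q else 0)
        = (if i \<le> N then hcomp i p * hcomp (N - i) q else 0)"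
    proof (cases "i \<le> N")
      case True
      then have "N = i + j \<longleftrightarrow> j = N - i" for j by auto
      then show ?thesis using True A(3) by simp
    next
      case False
      then have "N \<noteq> i + j" for j by simp
      then show ?thesis using False by simp
    qed
  qed
  also have "\<dots> = (\<Sum>i\<le>N. hcomp i p * hcomp (N - i) q)"
    using A(3) by (intro sum.mono_neutral_cong_right) auto
  finally show ?thesis .
qed

text \<open>The direct sum of the pieces, encoded by components. Together with \<open>hpart\<close>
  it is the dictionary between families and ideals generated by forms.\<close>

definition tot :: "('k::field family) \<Rightarrow> 'k mpoly set"
  where "tot Q = {p \<in> C. \<forall>d. hcomp d p \<in> Q d}"

definition hpart :: "'k::field mpoly set \<Rightarrow> 'k family"
  where "hpart I d = I \<inter> P d"

lemma hpart_tot: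
  assumes Q: "gideal Q"
  shows "hpart (tot Q) = Q"
proof (rule ext)
  fix d
  have "p \<in> tot Q \<longleftrightarrow> p \<in> Q d" if "p \<in> P d" for p
    using that P_subset_C gideal_zero[OF Q] unfolding tot_def by (auto simp: hcomp_homogeneous)
  then show "hpart (tot Q) d = Q d" using gideal_subset[OF Q] unfolding hpart_def by blast
qed

lemma ideal_tot:
  fixes Q :: "'k::field family"
  assumes Q: "gideal Q"
  shows "ideal (tot Q) (mpoly_ring n)"
proof -
  have mult: "x * a \<in> tot Q" if "a \<in> tot Q" "x \<in> C" for a x
  proof -
    have a: "a \<in> C" "\<And>d. hcomp d a \<in> Q d" using that(1) unfolding tot_def by auto
    have "hcomp d (x * a) \<in> Q d" for d
      unfolding hcomp_mult[OF that(2) a(1)]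
    proof (rule sp.subspace_sum[OF gideal_subspace[OF Q]])
      fix i assume "i \<in> {..d}"
      then show "hcomp i x * hcomp (d - i) a \<in> Q d"
        using gideal_mult[OF Q hcomp_in_P[OF that(2)] a(2), of i "d - i"] by simp
    qed
    then show ?thesis unfolding tot_def using C_closed(2)[OF that(2) a(1)] by blast
  qed
  have "ring (mpoly_ring n :: 'k mpoly ring)" using mpoly_ring_ring .
  then show ?thesis
  proof (rule idealI)
    interpret R: cring "mpoly_ring n :: 'k mpoly ring" by (rule mpoly_ring_cring)
    show "subgroup (tot Q) (add_monoid (mpoly_ring n))"
    proof (rule R.add.subgroupI)
      show "tot Q \<subseteq> C" unfolding tot_def by blast
      show "tot Q \<noteq> {}" using C_closed(3) gideal_zero[OF Q] unfolding tot_def by force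
      fix a assume a: "a \<in> tot Q"
      have "- 1 * a \<in> tot Q" using mult[OF a C_closed(5)[OF C_closed(4)]] .
      then have ma: "- a \<in> tot Q" by simp
      have aC: "a \<in> C" using a unfolding tot_def by blast
      have "\<ominus>\<^bsub>mpoly_ring n\<^esub> a = - a"
        by (rule R.minus_equality) (simp_all add: mpoly_ring_simps aC C_closed(5))
      then show "\<ominus>\<^bsub>mpoly_ring n\<^esub> a \<in> tot Q" using ma by simp
    next
      fix a b assume "a \<in> tot Q" "b \<in> tot Q"
      then show "a \<oplus>\<^bsub>mpoly_ring n\<^esub> b \<in> tot Q"
        unfolding tot_def mpoly_ring_simps using C_closed(1)[of a b] gideal_add[OF Q] by (simp add: hcomp_add)
    qed
    show "x \<otimes>\<^bsub>mpoly_ring n\<^esub> a \<in> tot Q" "a \<otimes>\<^bsub>mpoly_ring n\<^esub> x \<in> tot Q"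
      if "a \<in> tot Q" "x \<in> C" for a x
      using mult[OF that] by (simp_all add: mpoly_ring_simps mult.commute)
  qed
qed

text \<open>If neither factor lies in the ideal, take the lowest components of each outside
  \<open>Q\<close>, in degrees \<open>i\<close> and \<open>j\<close>. In degree \<open>i + j\<close>
  of the product every other summand has a factor in \<open>Q\<close>, so the product of these two
  components would lie in \<open>Q\<close>.\<close>

lemma primeideal_tot:
  fixes Q :: "'k::field family"
  assumes Q: "gprime Q"
  shows "primeideal (tot Q) (mpoly_ring n)"
proof (rule primeidealI[OF ideal_tot[OF gprime_gideal[OF Q]] mpoly_ring_cring])
  note g = gprime_gideal[OF Q]
  have "hcomp 0 1 \<notin> Q 0" using Q by (simp add: hcomp_homogeneous[OF one_in_P] gprime_def)
  then have "1 \<notin> tot Q" unfolding tot_def by blast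
  then show "C \<noteq> tot Q" using C_closed(4) by blast
  fix a b :: "'k mpoly" assume a: "a \<in> C" and b: "b \<in> C" and ab: "a \<otimes>\<^bsub>mpoly_ring n\<^esub> b \<in> tot Q"
  show "a \<in> tot Q \<or> b \<in> tot Q"
  proof (rule ccontr)
    assume "\<not> ?thesis"
    then have "\<exists>i. hcomp i a \<notin> Q i" "\<exists>j. hcomp j b \<notin> Q j" using a b unfolding tot_def by auto
    then obtain i j where i: "hcomp i a \<notin> Q i" "\<forall>k<i. \<not> hcomp k a \<notin> Q k"
      and j: "hcomp j b \<notin> Q j" "\<forall>k<j. \<not> hcomp k b \<notin> Q k"
      unfolding exists_least_iff[of "\<lambda>i. hcomp i a \<notin> Q i"] exists_least_iff[of "\<lambda>j. hcomp j b \<notin> Q j"]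
      by blast
    have ab_mem: "hcomp (i + j) (a * b) \<in> Q (i + j)"
      using ab unfolding tot_def by (simp add: mpoly_ring_simps)
    have ab_eq: "hcomp (i + j) (a * b) =
        (\<Sum>k\<in>{..i + j} - {i}. hcomp k a * hcomp (i + j - k) b) + hcomp i a * hcomp j b"
      unfolding hcomp_mult[OF a b] by (subst sum.remove[of _ i]) (simp_all add: add.commute)
    have "(\<Sum>k\<in>{..i + j} - {i}. hcomp k a * hcomp (i + j - k) b) \<in> Q (i + j)"
    proof (rule sp.subspace_sum[OF gideal_subspace[OF g]])
      fix k assume k: "k \<in> {..i + j} - {i}"
      show "hcomp k a * hcomp (i + j - k) b \<in> Q (i + j)"
      proof (cases "k < i")
        case True
        then show ?thesis
          using gideal_mult_right[OF g hcomp_in_P[OF b], of "hcomp k a" k "i + j - k"] i(2) by simp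
      next
        case False
        then have "i + j - k < j" using k by auto
        then show ?thesis
          using gideal_mult[OF g hcomp_in_P[OF a], of "hcomp (i + j - k) b" "i + j - k" k] j(2) k by simp
      qed
    qed
    then have "hcomp i a * hcomp j b \<in> Q (i + j)"
      by (rule gideal_add_left[OF g _ ab_mem[unfolded ab_eq]])
    then show False using gprimeD[OF Q hcomp_in_P[OF a] hcomp_in_P[OF b]] i(1) j(1) by blast
  qed
qed

lemma gideal_hpart:
  assumes I: "ideal I (mpoly_ring n)"
  shows "gideal (hpart I)"
proof (rule gidealI)
  show "hpart I d \<subseteq> P d" for d unfolding hpart_def by blast
  show "sp.subspace (hpart I d)" for d
    unfolding hpart_def by (rule sp.subspace_inter[OF ideal_subspace[OF I] subspace_P])
  show "p * q \<in> hpart I (e + d)" if "p \<in> P e" "q \<in> hpart I d" for p q d e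
    using that ideal_mult[OF I, of p q] P_subset_C P_mult unfolding hpart_def by blast
qed

lemma hpart_neq_P:
  assumes "ideal I (mpoly_ring n)" "I \<noteq> C"
  shows "hpart I \<noteq> P"
proof
  assume "hpart I = P"
  then have "1 \<in> hpart I 0" using one_in_P by simp
  then show False using ideal_one_notin[OF assms] unfolding hpart_def by blast
qed

lemma homogeneous_in_P:
  assumes "p \<in> C" "homogeneous p"
  shows "p \<in> P (total_degree p)"
proof (cases "p = 0")
  case False
  obtain d where d: "\<forall>m\<in>keys p. monom_degree m = d"
    using assms(2) unfolding homogeneous_def by blast
  have "monom_degree ` keys p = (\<lambda>_. d) ` keys p"
    using d by (intro image_cong) auto
  then have "monom_degree ` keys p = {d}" using False by (simp add: image_constant_conv)
  then have "total_degree p = d" unfolding total_degree_def by simp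
  then show ?thesis using assms(1) d unfolding P_iff C_iff by blast
qed (simp add: P_zero)

text \<open>\<open>tot K\<close> is an ideal containing the generators, so minimality of the
  generated ideal carries over to families.\<close>

lemma gideal_hpart_least:
  assumes F: "F \<subseteq> C" "\<And>f. f \<in> F \<Longrightarrow> homogeneous f" and K: "gideal K"
    and FK: "\<And>f. f \<in> F \<Longrightarrow> f \<in> K (total_degree f)"
  shows "hpart (Idl\<^bsub>mpoly_ring n\<^esub> F) \<le> K"
proof -
  have "F \<subseteq> tot K"
  proof
    fix f assume f: "f \<in> F"
    then have "hcomp d f \<in> K d" for d
      using hcomp_homogeneous[OF homogeneous_in_P, of f d] F FK[OF f] gideal_zero[OF K] by auto
    then show "f \<in> tot K" using f F(1) unfolding tot_def by blast
  qed
  then have "Idl\<^bsub>mpoly_ring n\<^esub> F \<subseteq> tot K"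
    using ring.genideal_minimal[OF mpoly_ring_ring ideal_tot[OF K]] by blast
  then have "hpart (Idl\<^bsub>mpoly_ring n\<^esub> F) d \<subseteq> hpart (tot K) d" for d unfolding hpart_def by blast
  then show ?thesis unfolding hpart_tot[OF K] by (intro le_funI)
qed

lemma tot_hpart:
  assumes F: "F \<subseteq> C" "\<And>f. f \<in> F \<Longrightarrow> homogeneous f" and I: "I = Idl\<^bsub>mpoly_ring n\<^esub> F"
  shows "tot (hpart I) = I"
proof
  have ideal: "ideal I (mpoly_ring n)"
    unfolding I by (rule ring.genideal_ideal[OF mpoly_ring_ring F(1)])
  show "tot (hpart I) \<subseteq> I"
  proof
    fix p assume p: "p \<in> tot (hpart I)"
    then obtain D where D: "p \<in> P_le D" using C_P_le unfolding tot_def by blast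
    have "(\<Sum>d\<le>D. hcomp d p) \<in> I"
      using p unfolding tot_def hpart_def by (intro sp.subspace_sum[OF ideal_subspace[OF ideal]]) auto
    then show "p \<in> I" using P_le_sum_hcomp[OF D order_refl] by simp
  qed
  have "F \<subseteq> I" unfolding I by (rule ring.genideal_self[OF mpoly_ring_ring F(1)])
  have "F \<subseteq> tot (hpart I)"
  proof
    fix f assume f: "f \<in> F"
    note fP = homogeneous_in_P[OF subsetD[OF F(1) f] F(2)[OF f]]
    then have "hcomp d f \<in> hpart I d" for d
      using hcomp_homogeneous[OF fP, of d] \<open>F \<subseteq> I\<close> f gideal_zero[OF gideal_hpart[OF ideal]]
      by (auto simp: hpart_def)
    then show "f \<in> tot (hpart I)" using f F(1) unfolding tot_def by blast
  qed
  then show "I \<subseteq> tot (hpart I)"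
    unfolding I[unfolded I] using ring.genideal_minimal[OF mpoly_ring_ring
        ideal_tot[OF gideal_hpart[OF ideal]]] I by blast
qed

section \<open>Krull dimension and vector space dimension of the quotient\<close>

text \<open>For finite-dimensional \<open>U\<close>, the dimension of the image of \<open>U\<close>
  in the quotient by \<open>I\<close>.\<close>

definition codim :: "'k::field mpoly set \<Rightarrow> 'k mpoly set \<Rightarrow> nat"
  where "codim U I = sp.dim U - sp.dim (I \<inter> U)"

lemma codim_plus_dim: "sp.fin_dim U \<Longrightarrow> codim U I + sp.dim (I \<inter> U) = sp.dim U"
  unfolding codim_def using sp.dim_mono_fin_dim[of "I \<inter> U" U] by simp

lemma HF_hpart: "HF (hpart I) d = codim (P d) I"
  by (simp add: HF_def codim_def hpart_def)

lemma codim_P_le_mono: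
  fixes I :: "'k::field mpoly set"
  assumes I: "ideal I (mpoly_ring n)" and "t \<le> t'"
  shows "codim (P_le t) I \<le> codim (P_le t') I"
proof -
  have A: "sp.subspace (I \<inter> P_le t')" by (rule sp.subspace_inter[OF ideal_subspace[OF I] subspace_P_le])
  have fA: "sp.fin_dim (I \<inter> P_le t')" by (rule sp.fin_dim_subset[OF _ fin_dim_P_le]) blast
  have sub: "P_le t \<subseteq> (P_le t' :: 'k mpoly set)" by (rule P_le_mono[OF assms(2)])
  \<comment> \<open>The factor 1 presents the inclusion map as a multiplication, so that
    \<open>linear_mult\<close> and rank-nullity apply to it.\<close>
  have "sp.dim {a + 1 * u |a u. a \<in> I \<inter> P_le t' \<and> u \<in> P_le t} + sp.dim {u \<in> P_le t. 1 * u \<in> I \<inter> P_le t'}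
      = sp.dim (I \<inter> P_le t') + sp.dim (P_le t :: 'k mpoly set)"
    by (rule sp.dim_sum_image[OF linear_mult A fA subspace_P_le fin_dim_P_le])
  moreover have "{u \<in> P_le t. 1 * u \<in> I \<inter> P_le t'} = I \<inter> P_le t" using sub by auto
  moreover have "{a + 1 * u |a u. a \<in> I \<inter> P_le t' \<and> u \<in> P_le t} \<subseteq> P_le t'"
    using sub sp.subspace_add[OF subspace_P_le] by auto
  then have "sp.dim {a + 1 * u |a u. a \<in> I \<inter> P_le t' \<and> u \<in> P_le t} \<le> sp.dim (P_le t' :: 'k mpoly set)"
    by (rule sp.dim_mono_fin_dim[OF _ fin_dim_P_le])
  ultimately show ?thesis
    using codim_plus_dim[OF fin_dim_P_le, of t I] codim_plus_dim[OF fin_dim_P_le, of t' I] by simp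
qed

text \<open>Multiplication by \<open>x\<close> embeds \<open>R / p\<close> into \<open>p' / p\<close>.\<close>

lemma codim_prime_step:
  fixes p p' :: "'k::field mpoly set"
  assumes p: "primeideal p (mpoly_ring n)" and p': "ideal p' (mpoly_ring n)" "p \<subseteq> p'"
    and x: "x \<in> p'" "x \<notin> p" "x \<in> P_le a"
  shows "codim (P_le (t + a)) p' + codim (P_le t) p \<le> codim (P_le (t + a)) p"
proof -
  note ip = primeideal.axioms(1)[OF p]
  let ?A = "p \<inter> P_le (t + a)"
  have A: "sp.subspace ?A" by (rule sp.subspace_inter[OF ideal_subspace[OF ip] subspace_P_le])
  have fA: "sp.fin_dim ?A" by (rule sp.fin_dim_subset[OF _ fin_dim_P_le]) blast
  have mult: "x * u \<in> P_le (t + a)" if "u \<in> P_le t" for u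
    using P_le_mult[OF x(3) that] by (simp add: add.commute)
  have "sp.dim {b + x * u |b u. b \<in> ?A \<and> u \<in> P_le t} + sp.dim {u \<in> P_le t. x * u \<in> ?A}
      = sp.dim ?A + sp.dim (P_le t :: 'k mpoly set)"
    by (rule sp.dim_sum_image[OF linear_mult A fA subspace_P_le fin_dim_P_le])
  moreover have "{u \<in> P_le t. x * u \<in> ?A} = p \<inter> P_le t"
  proof -
    have "u \<in> p" if "u \<in> P_le t" "x * u \<in> p" for u
      using primeideal.I_prime[OF p, of x u] that x P_le_subset_C by (auto simp: mpoly_ring_simps)
    moreover have "x * u \<in> p" if "u \<in> p" for u
      using ideal_mult[OF ip _ that] x(3) P_le_subset_C by blast
    ultimately show ?thesis using mult by blast
  qed
  moreover have "{b + x * u |b u. b \<in> ?A \<and> u \<in> P_le t} \<subseteq> p' \<inter> P_le (t + a)"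
  proof clarify
    fix b u :: "'k mpoly" assume b: "b \<in> p" "b \<in> P_le (t + a)" and u: "u \<in> P_le t"
    have "u * x \<in> p'" using ideal_mult[OF p'(1) _ x(1)] u P_le_subset_C by blast
    then have "b + x * u \<in> p'" using ideal_add[OF p'(1)] b(1) p'(2) by (auto simp: mult.commute)
    then show "b + x * u \<in> p' \<inter> P_le (t + a)"
      using sp.subspace_add[OF subspace_P_le b(2) mult[OF u]] by blast
  qed
  then have "sp.dim {b + x * u |b u. b \<in> ?A \<and> u \<in> P_le t} \<le> sp.dim (p' \<inter> P_le (t + a))"
    by (rule sp.dim_mono_fin_dim) (rule sp.fin_dim_subset[OF _ fin_dim_P_le], blast)
  ultimately show ?thesis
    using codim_plus_dim[OF fin_dim_P_le, of t p] codim_plus_dim[OF fin_dim_P_le, of "t + a" p]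
      codim_plus_dim[OF fin_dim_P_le, of "t + a" p'] by simp
qed

lemma one_in_P_le: "1 \<in> P_le t"
  using one_in_P P_subset_P_le by blast

text \<open>One step of the chain turns into Pascal's rule: passing from \<open>s\<close> to
  \<open>s + 1\<close> adds at least the growth modulo the next prime, bounded below by
  \<open>s choose l\<close>. A chain of length \<open>l\<close> thus forces growth of order
  \<open>s^l\<close>.\<close>

lemma prime_chain_growth:
  fixes p :: "'k::field family"
  assumes "\<And>i. i \<le> l \<Longrightarrow> primeideal (p i) (mpoly_ring n)" "\<And>i. i < l \<Longrightarrow> p i \<subset> p (Suc i)"
  shows "\<exists>A>0. \<forall>s. s choose l \<le> codim (P_le (A * s)) (p 0)"
  using assms
proof (induction l arbitrary: p)
  case 0
  have prime: "primeideal (p 0) (mpoly_ring n)" using "0.prems"(1) by simp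
  note ip = primeideal.axioms(1)[OF prime]
  have "1 \<notin> p 0"
    using ideal_one_notin[OF ip] primeideal.I_notcarr[OF prime] by blast
  have "1 \<le> codim (P_le t) (p 0)" for t
  proof (rule ccontr)
    assume "\<not> ?thesis"
    then have "sp.dim (P_le t :: 'k mpoly set) \<le> sp.dim (p 0 \<inter> P_le t)"
      using codim_plus_dim[OF fin_dim_P_le, of t "p 0"] by simp
    then have "p 0 \<inter> P_le t = P_le t"
      by (intro sp.subspace_eq_if_dim_ge sp.subspace_inter[OF ideal_subspace[OF ip]]
          subspace_P_le fin_dim_P_le) auto
    then show False using one_in_P_le \<open>1 \<notin> p 0\<close> by blast
  qed
  then show ?case by (intro exI[of _ 1]) simp
next
  case (Suc l)
  have "\<exists>A>0. \<forall>s. s choose l \<le> codim (P_le (A * s)) (p (Suc 0))"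
    using Suc.IH[of "\<lambda>i. p (Suc i)"] Suc.prems by simp
  then obtain B where B: "B > 0" "\<And>s. s choose l \<le> codim (P_le (B * s)) (p (Suc 0))" by blast
  have p0: "primeideal (p 0) (mpoly_ring n)" and p1: "primeideal (p (Suc 0)) (mpoly_ring n)"
    using Suc.prems(1) by simp_all
  note i1 = primeideal.axioms(1)[OF p1]
  have sub: "p 0 \<subset> p (Suc 0)" using Suc.prems(2) by simp
  then obtain x where x: "x \<in> p (Suc 0)" "x \<notin> p 0" by blast
  then obtain a where a: "x \<in> P_le a" using C_P_le ideal_subset_C[OF i1] by blast
  \<comment> \<open>Both the degree bound \<open>a\<close> of the element \<open>x\<close> and the
    scale \<open>B\<close> of the shorter chain must fit into one step.\<close>
  define A where "A = max a B"
  have xA: "x \<in> P_le A" using a P_le_mono[of a A] unfolding A_def by auto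
  have "s choose Suc l \<le> codim (P_le (A * s)) (p 0)" for s
  proof (induction s)
    case (Suc s)
    have "s choose l \<le> Suc s choose l" by (rule binomial_right_mono) simp
    also have "\<dots> \<le> codim (P_le (B * Suc s)) (p (Suc 0))" by (rule B(2))
    also have "\<dots> \<le> codim (P_le (A * Suc s)) (p (Suc 0))"
      by (intro codim_P_le_mono[OF i1] mult_right_mono) (simp_all add: A_def)
    finally have "s choose l \<le> codim (P_le (A * s + A)) (p (Suc 0))" by (simp add: add.commute)
    moreover have "codim (P_le (A * s + A)) (p (Suc 0)) + codim (P_le (A * s)) (p 0)
        \<le> codim (P_le (A * s + A)) (p 0)"
      using sub by (intro codim_prime_step[OF p0 i1 _ x xA]) blast
    ultimately show ?case using Suc by (simp add: add.commute)
  qed simp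
  moreover have "A > 0" using B(1) by (simp add: A_def)
  ultimately show ?case by blast
qed

lemma P_le_0: "P_le 0 = P 0"
  unfolding P_le_def by (rule Set.set_eqI) (simp only: mem_Collect_eq P_iff le_zero_eq)

text \<open>\<open>P_le (Suc t)\<close> is the direct sum of \<open>P_le t\<close> and the forms of
  degree \<open>Suc t\<close>, and \<open>I\<close> meets it in at least the sum of its
  intersections with both. For inhomogeneous \<open>I\<close> it may meet it in more, hence an
  inequality.\<close>

lemma codim_P_le_Suc:
  fixes I :: "'k::field mpoly set"
  assumes I: "ideal I (mpoly_ring n)"
  shows "codim (P_le (Suc t)) I \<le> codim (P_le t) I + codim (P (Suc t)) I"
proof -
  let ?L = "P_le t :: 'k mpoly set" and ?H = "P (Suc t) :: 'k mpoly set"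
  have disj: "?L \<inter> ?H = {0}"
  proof -
    have "q = 0" if "q \<in> ?L" "q \<in> ?H" for q
    proof -
      have "keys q = {}" using that unfolding P_le_def P_iff by fastforce
      then show ?thesis by simp
    qed
    then show ?thesis using P_zero sp.subspace_0[OF subspace_P_le] by blast
  qed
  have sum: "sp.dim {a + 1 * u |a u. a \<in> A \<and> u \<in> B} = sp.dim A + sp.dim B"
    if A: "sp.subspace A" "A \<subseteq> ?L" and B: "sp.subspace B" "B \<subseteq> ?H" for A B
  proof -
    have "sp.dim {a + 1 * u |a u. a \<in> A \<and> u \<in> B} + sp.dim {u \<in> B. 1 * u \<in> A} = sp.dim A + sp.dim B"
      using A B by (intro sp.dim_sum_image[OF linear_mult] sp.fin_dim_subset[OF A(2) fin_dim_P_le]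
          sp.fin_dim_subset[OF B(2) fin_dim_P])
    moreover have "{u \<in> B. 1 * u \<in> A} = {0}"
      using A B disj sp.subspace_0[OF A(1)] sp.subspace_0[OF B(1)] by auto
    ultimately show ?thesis by (simp add: sp.dim_zero)
  qed
  have inc: "a + 1 * u \<in> P_le (Suc t)" if a: "a \<in> ?L" and u: "u \<in> ?H" for a u
  proof -
    have "a \<in> P_le (Suc t)" by (rule subsetD[OF P_le_mono a]) simp
    moreover have "1 * u \<in> P_le (Suc t)" using subsetD[OF P_subset_P_le u, of "Suc t"] by simp
    ultimately show ?thesis by (rule sp.subspace_add[OF subspace_P_le])
  qed
  have "P_le (Suc t) = {a + 1 * u |a u. a \<in> ?L \<and> u \<in> ?H}"
  proof
    show "{a + 1 * u |a u. a \<in> ?L \<and> u \<in> ?H} \<subseteq> P_le (Suc t)" using inc by blast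
    show "P_le (Suc t) \<subseteq> {a + 1 * u |a u. a \<in> ?L \<and> u \<in> ?H}"
    proof
      fix q :: "'k mpoly" assume q: "q \<in> P_le (Suc t)"
      have "hcomp (Suc t) q \<in> ?H" using hcomp_in_P q P_le_subset_C by blast
      moreover have "q - hcomp (Suc t) q \<in> ?L"
        unfolding P_le_def
      proof (intro CollectI ballI conjI)
        fix m assume "m \<in> keys (q - hcomp (Suc t) q)"
        then have m: "monom_degree m \<noteq> Suc t" "m \<in> keys q"
          by (auto simp: in_keys_iff lookup_minus lookup_hcomp split: if_splits)
        then show "keys m \<subseteq> {1..n}" using q unfolding P_le_def by blast
        have "monom_degree m \<le> Suc t" using m q unfolding P_le_def by blast
        then show "monom_degree m \<le> t" using m(1) by simp
      qed
      moreover have "q = (q - hcomp (Suc t) q) + 1 * hcomp (Suc t) q" by simp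
      ultimately show "q \<in> {a + 1 * u |a u. a \<in> ?L \<and> u \<in> ?H}" by blast
    qed
  qed
  then have d1: "sp.dim (P_le (Suc t) :: 'k mpoly set) = sp.dim ?L + sp.dim ?H"
    using sum[OF subspace_P_le subset_refl subspace_P subset_refl] by simp
  have "{a + 1 * u |a u. a \<in> I \<inter> ?L \<and> u \<in> I \<inter> ?H} \<subseteq> I \<inter> P_le (Suc t)"
    using inc ideal_add[OF I] by auto
  then have "sp.dim {a + 1 * u |a u. a \<in> I \<inter> ?L \<and> u \<in> I \<inter> ?H} \<le> sp.dim (I \<inter> P_le (Suc t))"
    by (rule sp.dim_mono_fin_dim) (rule sp.fin_dim_subset[OF _ fin_dim_P_le], blast)
  moreover have "sp.dim {a + 1 * u |a u. a \<in> I \<inter> ?L \<and> u \<in> I \<inter> ?H} = sp.dim (I \<inter> ?L) + sp.dim (I \<inter> ?H)"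
    by (intro sum sp.subspace_inter[OF ideal_subspace[OF I]] subspace_P subspace_P_le) auto
  ultimately show ?thesis
    using d1 codim_plus_dim[OF fin_dim_P_le, of t I] codim_plus_dim[OF fin_dim_P_le, of "Suc t" I]
      codim_plus_dim[OF fin_dim_P, of "Suc t" I] by simp
qed

lemma codim_P_le_sum:
  assumes "ideal I (mpoly_ring n)"
  shows "codim (P_le t) I \<le> (\<Sum>d\<le>t. HF (hpart I) d)"
proof (induction t)
  case (Suc t)
  then show ?case using codim_P_le_Suc[OF assms, of t] unfolding HF_hpart by simp
qed (simp add: P_le_0 HF_hpart)

text \<open>Partial sums are a discrete antiderivative, which raises \<open>pdim\<close> by at most
  one; the constant \<open>c\<close> matches the values at \<open>N\<close>.\<close>

lemma sum_HF_poly: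
  assumes "gideal J"
  obtains S :: "rat poly" where "pdim S \<le> Suc (gdim J)"
    "\<forall>\<^sub>F t in sequentially. of_nat (\<Sum>d\<le>t. HF J d) = poly S (of_nat t)"
proof -
  obtain q where q: "bdiff 1 q = hp J" using bdiff_surj by blast
  obtain N where N: "\<And>d. d \<ge> N \<Longrightarrow> of_nat (HF J d) = poly (hp J) (of_nat d)"
    using is_hilb_hp[OF assms] unfolding is_hilb_def eventually_sequentially by blast
  define c where "c = of_nat (\<Sum>d\<le>N. HF J d) - poly q (of_nat N)"
  have "bdiff 1 [:c:] = 0" by (simp add: bdiff_def shift_def)
  then have "pdim (q + [:c:]) - 1 = gdim J"
    using pdim_bdiff(1)[of 1 "q + [:c:]"] q by (simp add: bdiff_add gdim_def)
  then have "pdim (q + [:c:]) \<le> Suc (gdim J)" by simp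
  moreover have "of_nat (\<Sum>d\<le>t. HF J d) = poly (q + [:c:]) (of_nat t)" if "t \<ge> N" for t
    using that
  proof (induction t rule: dec_induct)
    case base
    then show ?case by (simp add: c_def)
  next
    case (step t)
    have "of_nat (\<Sum>d\<le>Suc t. HF J d) = of_nat (\<Sum>d\<le>t. HF J d) + poly (hp J) (of_nat (Suc t))"
      using N[of "Suc t"] step by simp
    moreover have "poly (hp J) (of_nat (Suc t)) = poly q (of_nat (Suc t)) - poly q (of_nat t)"
      unfolding q[symmetric] bdiff_def by (simp only: poly_diff) (subst poly_shift, simp_all)
    ultimately show ?case using step.IH by simp
  qed
  ultimately show thesis using that unfolding eventually_sequentially by blast
qed

text \<open>The growth forced by the chain has order \<open>s^l\<close>, while the filtered quotient
  by \<open>I\<close> grows no faster than a polynomial of degree at most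
  \<open>gdim (hpart I)\<close>; comparing the two polynomials bounds \<open>l\<close>.\<close>

lemma prime_chain_length_le:
  fixes p :: "'k::field family"
  assumes p: "\<And>i. i \<le> l \<Longrightarrow> primeideal (p i) (mpoly_ring n)" "\<And>i. i < l \<Longrightarrow> p i \<subset> p (Suc i)"
    and I: "ideal I (mpoly_ring n)" "I \<subseteq> p 0"
  shows "l \<le> gdim (hpart I)"
proof -
  obtain A where A: "A > 0" "\<And>s. s choose l \<le> codim (P_le (A * s)) (p 0)"
    using prime_chain_growth[of l p] p by blast
  note g = gideal_hpart[OF I(1)]
  obtain S :: "rat poly" where S: "pdim S \<le> Suc (gdim (hpart I))"
    "\<forall>\<^sub>F t in sequentially. of_nat (\<Sum>d\<le>t. HF (hpart I) d) = poly S (of_nat t)"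
    using sum_HF_poly[OF g] by blast
  \<comment> \<open>The growth lemma measures degrees in multiples of \<open>A\<close>; rescaling
    the argument leaves \<open>pdim\<close> unchanged.\<close>
  define S' where "S' = pcompose S [:0, of_nat A:]"
  have "pdim S' = pdim S"
    unfolding S'_def pdim_def using A(1) by (auto simp: degree_pcompose pcompose_eq_0_iff)
  \<comment> \<open>The polynomial \<open>(s / l)^l\<close>, a lower bound for
    \<open>s choose l\<close> once \<open>s\<close> is at least \<open>l\<close>; for
    \<open>l = 0\<close> it is the constant 1.\<close>
  define M where "M = monom (1 / of_nat l ^ l :: rat) l"
  have "pdim M = Suc l"
    unfolding M_def pdim_def by (cases l) (simp_all add: degree_monom_eq)
  have "codim (P_le t) (p 0) \<le> codim (P_le t) I" for t
  proof -
    have "sp.dim (I \<inter> P_le t) \<le> sp.dim (p 0 \<inter> P_le t)"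
      using I(2) by (intro sp.dim_mono_fin_dim) (auto intro: sp.fin_dim_subset[OF _ fin_dim_P_le])
    then show ?thesis unfolding codim_def by simp
  qed
  then have "s choose l \<le> (\<Sum>d\<le>A * s. HF (hpart I) d)" for s
    using A(2) codim_P_le_sum[OF I(1)] order_trans by meson
  then have le: "(of_nat (s choose l) :: rat) \<le> of_nat (\<Sum>d\<le>A * s. HF (hpart I) d)" for s
    by (simp only: of_nat_le_iff)
  obtain N where N: "\<And>t. t \<ge> N \<Longrightarrow> of_nat (\<Sum>d\<le>t. HF (hpart I) d) = poly S (of_nat t)"
    using S(2) unfolding eventually_sequentially by blast
  have "poly M (of_nat s) \<le> poly S' (of_nat s)" if s: "s \<ge> max N l" for s
  proof -
    have "poly M (of_nat s) = (of_nat s / of_nat l) ^ l"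
      unfolding M_def by (simp add: poly_monom power_divide)
    also have "\<dots> \<le> of_nat (s choose l)" using s by (intro binomial_ge_n_over_k_pow_k) simp
    also have "\<dots> \<le> of_nat (\<Sum>d\<le>A * s. HF (hpart I) d)" by (rule le)
    also have "\<dots> = poly S (of_nat (A * s))"
    proof (rule N)
      have "N \<le> s" using s by simp
      also have "s \<le> A * s" using A(1) by simp
      finally show "N \<le> A * s" .
    qed
    also have "\<dots> = poly S' (of_nat s)" unfolding S'_def by (simp add: poly_pcompose mult.commute)
    finally show ?thesis .
  qed
  then have "\<forall>\<^sub>F s in sequentially. poly M (of_nat s) \<le> poly S' (of_nat s)"
    unfolding eventually_sequentially by blast
  moreover have "\<forall>\<^sub>F s in sequentially. 0 \<le> poly M (of_nat s)"
    unfolding M_def by (simp add: poly_monom)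
  ultimately have "pdim M \<le> pdim S'" by (intro pdim_mono(1))
  then show ?thesis using \<open>pdim M = _\<close> \<open>pdim S' = _\<close> S(1) by simp
qed

text \<open>For the upper bound an arbitrary chain of primes is pulled back to the polynomial ring.
  For attainment the graded chain, which exists because \<open>I\<close> is proper, is pushed
  forward to the quotient.\<close>

lemma krull_dim_quot:
  fixes F :: "'k::field mpoly set"
  assumes F: "F \<subseteq> C" "\<And>f. f \<in> F \<Longrightarrow> homogeneous f" and I: "I = Idl\<^bsub>mpoly_ring n\<^esub> F" "I \<noteq> C"
  shows "krull_dim (mpoly_ring n Quot I) = enat (gdim (hpart I))"
proof -
  have ideal: "ideal I (mpoly_ring n)"
    unfolding I(1) by (rule ring.genideal_ideal[OF mpoly_ring_ring F(1)])
  note g = gideal_hpart[OF ideal]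
  let ?S = "{enat l |l. \<exists>p :: nat \<Rightarrow> 'k mpoly set set.
    (\<forall>i \<le> l. primeideal (p i) (mpoly_ring n Quot I)) \<and> (\<forall>i < l. p i \<subset> p (Suc i))}"
  have "Sup ?S \<le> enat (gdim (hpart I))"
  proof (rule Sup_least)
    fix e assume "e \<in> ?S"
    then obtain l and p :: "nat \<Rightarrow> 'k mpoly set set" where l: "e = enat l"
      "\<And>i. i \<le> l \<Longrightarrow> primeideal (p i) (mpoly_ring n Quot I)" "\<And>i. i < l \<Longrightarrow> p i \<subset> p (Suc i)"
      by blast
    define q where "q i = {r \<in> C. coset I r \<in> p i}" for i
    have "l \<le> gdim (hpart I)"
    proof (rule prime_chain_length_le[of l q, OF _ _ ideal])
      show "primeideal (q i) (mpoly_ring n)" if "i \<le> l" for i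
        unfolding q_def by (rule primeideal_vimage_quot(1)[OF ideal l(2)[OF that]])
      show "q i \<subset> q (Suc i)" if "i < l" for i
        unfolding q_def using that
        by (intro primeideal_vimage_quot_strict[OF ideal l(2) l(3)]) simp_all
      show "I \<subseteq> q 0" unfolding q_def by (rule primeideal_vimage_quot(2)[OF ideal l(2)]) simp
    qed
    then show "e \<le> enat (gdim (hpart I))" using l(1) by simp
  qed
  moreover have "enat (gdim (hpart I)) \<in> ?S"
  proof -
    obtain Q where Q: "\<And>i. i \<le> gdim (hpart I) \<Longrightarrow> gprime (Q i)" "hpart I \<le> Q 0"
      "\<And>i. i < gdim (hpart I) \<Longrightarrow> Q i < Q (Suc i)"
      using gprime_chain[OF g hpart_neq_P[OF ideal I(2)]] by blast
    have tot_mono: "tot A \<subseteq> tot B" if "A \<le> B" for A B :: "'k family"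
      using that unfolding tot_def le_fun_def by blast
    have Q0: "Q 0 \<le> Q i" if "i \<le> gdim (hpart I)" for i
      using that by (induction i) (auto dest!: Q(3) Suc_le_lessD intro: order_trans less_imp_le)
    have sub: "I \<subseteq> tot (Q i)" if "i \<le> gdim (hpart I)" for i
      using tot_mono[OF order_trans[OF Q(2) Q0[OF that]]] tot_hpart[OF F I(1)] by simp
    have strict: "tot (Q i) \<subset> tot (Q (Suc i))" if "i < gdim (hpart I)" for i
    proof
      show "tot (Q i) \<subseteq> tot (Q (Suc i))" using tot_mono Q(3)[OF that] by (simp add: less_imp_le)
      show "tot (Q i) \<noteq> tot (Q (Suc i))"
      proof
        assume "tot (Q i) = tot (Q (Suc i))"
        then have "hpart (tot (Q i)) = hpart (tot (Q (Suc i)))" by simp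
        moreover have "gideal (Q i)" "gideal (Q (Suc i))" using Q(1) that by (simp_all add: gprime_gideal)
        ultimately show False using Q(3)[OF that] by (simp add: hpart_tot)
      qed
    qed
    define p where "p i = coset I ` tot (Q i)" for i
    have "primeideal (p i) (mpoly_ring n Quot I)" if "i \<le> gdim (hpart I)" for i
      unfolding p_def by (rule primeideal_image_quot[OF ideal primeideal_tot[OF Q(1)[OF that]] sub[OF that]])
    moreover have "p i \<subset> p (Suc i)" if i: "i < gdim (hpart I)" for i
    proof -
      obtain r where r: "r \<in> tot (Q (Suc i))" "r \<notin> tot (Q i)" using strict[OF i] by blast
      have "coset I r \<notin> p i"
        unfolding p_def using coset_image_mem_iff[OF ideal ideal_tot[OF gprime_gideal[OF Q(1)[OF less_imp_le[OF i]]]]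
            sub[OF less_imp_le[OF i]], of r] r(2) by simp
      moreover have "p i \<subseteq> p (Suc i)" unfolding p_def using strict[OF i] by blast
      ultimately show ?thesis using r(1) unfolding p_def by blast
    qed
    ultimately show ?thesis by blast
  qed
  then have "enat (gdim (hpart I)) \<le> Sup ?S" by (rule Sup_upper)
  ultimately show ?thesis unfolding krull_dim_def by (rule antisym)
qed

section \<open>Dimension over the ground field inside the quotient ring\<close>

lemma consts_subfield: "subfield (range (single 0)) (mpoly_ring n :: 'k::field mpoly ring)"
proof -
  let ?R = "mpoly_ring n :: 'k mpoly ring" and ?K = "range (single 0) :: 'k mpoly set"
  interpret R: cring ?R by (rule mpoly_ring_cring)
  have sub: "?K \<subseteq> carrier ?R" using const_in_C by blast
  have uminus: "\<ominus>\<^bsub>?R\<^esub> single 0 c = single 0 (- c)" for c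
    by (rule R.minus_equality) (simp_all add: mpoly_ring_simps const_in_C C_closed(5) single_uminus)
  have "subring ?K ?R"
  proof (rule R.subringI[OF sub])
    show "\<one>\<^bsub>?R\<^esub> \<in> ?K" using single_one by (metis mpoly_ring_simps(4) rangeI)
    show "\<ominus>\<^bsub>?R\<^esub> h \<in> ?K" if "h \<in> ?K" for h using that uminus by auto
    show "h1 \<otimes>\<^bsub>?R\<^esub> h2 \<in> ?K" if "h1 \<in> ?K" "h2 \<in> ?K" for h1 h2
      using that by (auto simp: mpoly_ring_simps mult_single)
    show "h1 \<oplus>\<^bsub>?R\<^esub> h2 \<in> ?K" if "h1 \<in> ?K" "h2 \<in> ?K" for h1 h2
      using that by (auto simp: mpoly_ring_simps simp flip: single_add)
  qed
  then have "cring (?R\<lparr>carrier := ?K\<rparr>)"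
    using R.subcringI' R.subcring_iff[OF sub] by blast
  then have "field (?R\<lparr>carrier := ?K\<rparr>)"
  proof (rule cring.cring_fieldI2)
    show "\<zero>\<^bsub>?R\<lparr>carrier := ?K\<rparr>\<^esub> \<noteq> \<one>\<^bsub>?R\<lparr>carrier := ?K\<rparr>\<^esub>" by (simp add: mpoly_ring_simps)
    fix a assume a: "a \<in> carrier (?R\<lparr>carrier := ?K\<rparr>)" "a \<noteq> \<zero>\<^bsub>?R\<lparr>carrier := ?K\<rparr>\<^esub>"
    obtain c where c: "a = single 0 c" using a(1) by auto
    then have "c \<noteq> 0" using a(2) by (auto simp: mpoly_ring_simps)
    then have "a * single 0 (inverse c) = 1" unfolding c by (simp add: mult_single)
    then show "\<exists>b\<in>carrier (?R\<lparr>carrier := ?K\<rparr>). a \<otimes>\<^bsub>?R\<lparr>carrier := ?K\<rparr>\<^esub> b = \<one>\<^bsub>?R\<lparr>carrier := ?K\<rparr>\<^esub>"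
      by (auto simp: mpoly_ring_simps)
  qed
  then show ?thesis by (rule R.subfield_iff(1)[OF _ sub])
qed

text \<open>Bridge from \<open>ring.dim\<close>, built by line extensions over a subfield, to
  \<open>dim\<close> of vector spaces: \<open>U\<close> is reached from \<open>I \<inter> U\<close>,
  whose image is zero, by adding vectors one at a time, and each vector that is new in
  \<open>U\<close> is also new modulo \<open>I\<close>.\<close>

lemma ring_dim_coset_image:
  fixes I :: "'k::field mpoly set"
  assumes I: "ideal I (mpoly_ring n)" "I \<noteq> C" and U: "sp.subspace U" "sp.fin_dim U" "U \<subseteq> C"
  shows "ring.dim (mpoly_ring n Quot I) (quot_consts n I) (coset I ` U) = codim U I"
proof -
  let ?Q = "mpoly_ring n Quot I" and ?K = "quot_consts n I"
  let ?\<pi> = "\<lambda>p. coset I p"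
  interpret Q: ring ?Q by (rule ideal.quotient_is_ring[OF I(1)])
  interpret h: ring_hom_ring "mpoly_ring n" ?Q ?\<pi> by (rule ideal.rcos_ring_hom_ring[OF I(1)])
  have K_img: "?K = ?\<pi> ` range (single 0)" unfolding quot_consts_def by blast
  have "1 \<notin> I" by (rule ideal_one_notin[OF I])
  then have "\<one>\<^bsub>?Q\<^esub> \<noteq> \<zero>\<^bsub>?Q\<^esub>"
    using coset_eq_zero_iff[OF I(1), of 1] by (simp add: FactRing_def mpoly_ring_simps)
  then have K: "subfield ?K ?Q" unfolding K_img by (rule h.img_is_subfield(2)[OF consts_subfield])
  define A where "A = I \<inter> U"
  have A: "sp.subspace A" "sp.fin_dim A" "A \<subseteq> U"
    unfolding A_def using sp.subspace_inter[OF ideal_subspace[OF I(1)] U(1)] sp.fin_dim_subset[OF _ U(2)]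
    by auto
  \<comment> \<open>The second conjunct keeps the truncated subtraction exact when a dimension grows
    by one.\<close>
  have main: "Q.dimension (sp.dim (sp.span (A \<union> B)) - sp.dim A) ?K (?\<pi> ` sp.span (A \<union> B))
      \<and> sp.dim A \<le> sp.dim (sp.span (A \<union> B))" if "finite B" "B \<subseteq> U" for B
    using that
  proof (induction B)
    case empty
    have sA: "sp.span A = A" using A(1) by simp
    have "?\<pi> a = I" if "a \<in> A" for a
      using that coset_eq_zero_iff[OF I(1), of a] unfolding A_def by simp
    then have "?\<pi> ` A = {\<zero>\<^bsub>?Q\<^esub>}"
      using sp.subspace_0[OF A(1)] unfolding quot_zero[OF I(1)] by auto
    then show ?case unfolding Un_empty_right sA by simp
  next
    case (insert v B)
    let ?V = "sp.span (A \<union> B)"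
    have V': "sp.span (A \<union> insert v B) = sp.span (insert v ?V)"
      by (simp add: sp.span_insert_span)
    have VU: "?V \<subseteq> U" using A(3) insert.prems U(1) by (intro sp.span_minimal) auto
    have IH: "Q.dimension (sp.dim ?V - sp.dim A) ?K (?\<pi> ` ?V)" "sp.dim A \<le> sp.dim ?V"
      using insert by auto
    show ?case
    proof (cases "v \<in> ?V")
      case True
      then have "sp.span (insert v ?V) = ?V" by (simp add: sp.span_redundant sp.span_span)
      then show ?thesis unfolding V' using IH by simp
    next
      case False
      have fV: "sp.fin_dim ?V" by (rule sp.fin_dim_subset[OF VU U(2)])
      have d: "sp.dim (sp.span (insert v ?V)) = Suc (sp.dim ?V)"
        by (rule sp.dim_insert_fin_dim[OF sp.subspace_span fV False])
      have vU: "v \<in> U" using insert.prems by simp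
      have "?\<pi> v \<notin> ?\<pi> ` ?V"
      proof
        assume "?\<pi> v \<in> ?\<pi> ` ?V"
        then obtain w where w: "w \<in> ?V" "v - w \<in> I" by (auto simp: coset_eq_iff[OF I(1)])
        then have "v - w \<in> U" using sp.subspace_diff[OF U(1) vU] VU by blast
        then have "v - w \<in> A" unfolding A_def using w(2) by blast
        then have "(v - w) + w \<in> ?V" using w(1) by (intro sp.span_add) (auto intro: sp.span_base)
        then show False using False by simp
      qed
      moreover have "?\<pi> v \<in> carrier ?Q" using quot_hom(3)[OF I(1)] vU U(3) by blast
      ultimately have "Q.dimension (Suc (sp.dim ?V - sp.dim A)) ?K (Q.line_extension ?K (?\<pi> v) (?\<pi> ` ?V))"
        using IH(1) by (intro Q.Suc_dim)
      moreover have "Q.line_extension ?K (?\<pi> v) (?\<pi> ` ?V) = ?\<pi> ` sp.span (insert v ?V)"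
      proof -
        have hom: "?\<pi> (single 0 c) \<otimes>\<^bsub>?Q\<^esub> ?\<pi> v \<oplus>\<^bsub>?Q\<^esub> ?\<pi> w = ?\<pi> (scl c v + w)"
          if "w \<in> ?V" for c w
        proof -
          have vC: "v \<in> C" and wC: "w \<in> C" using vU U(3) VU that by auto
          show ?thesis
            using quot_hom(1)[OF I(1) scl_in_C[OF vC] wC] quot_hom(2)[OF I(1) const_in_C vC]
            by (simp add: scl_def)
        qed
        have e1: "a \<in> Q.line_extension ?K (?\<pi> v) (?\<pi> ` ?V) \<longleftrightarrow> (\<exists>c. \<exists>w\<in>?V. a = ?\<pi> (scl c v + w))" for a
          unfolding Q.line_extension_mem_iff K_img using hom by auto
        have e2: "(\<exists>c. \<exists>w\<in>?V. a = ?\<pi> (scl c v + w)) \<longleftrightarrow> a \<in> ?\<pi> ` sp.span (insert v ?V)" for a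
        proof
          assume "\<exists>c. \<exists>w\<in>?V. a = ?\<pi> (scl c v + w)"
          then obtain c w where w: "w \<in> ?V" "a = ?\<pi> (scl c v + w)" by blast
          have "scl c v + w \<in> sp.span (insert v ?V)"
            using w(1) by (intro sp.span_add sp.span_scale) (auto intro: sp.span_base)
          then show "a \<in> ?\<pi> ` sp.span (insert v ?V)" using w(2) by blast
        next
          assume "a \<in> ?\<pi> ` sp.span (insert v ?V)"
          then obtain z where z: "z \<in> sp.span (insert v ?V)" "a = ?\<pi> z" by blast
          then obtain c where "z - scl c v \<in> ?V"
            using sp.span_breakdown_eq[of z v ?V] by (auto simp: sp.span_span)
          moreover have "z = scl c v + (z - scl c v)" by simp
          ultimately show "\<exists>c. \<exists>w\<in>?V. a = ?\<pi> (scl c v + w)" using z(2) by metis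
        qed
        show ?thesis by (rule Set.set_eqI) (simp only: e1 e2)
      qed
      ultimately show ?thesis unfolding V' using d IH(2) by (simp add: Suc_diff_le)
    qed
  qed
  obtain B where B: "finite B" "B \<subseteq> U" "sp.span B = U"
    using sp.fin_dim_basis[OF U(1,2)] by metis
  have AB: "sp.span (A \<union> B) = U"
  proof
    show "sp.span (A \<union> B) \<subseteq> U" using A(3) B(2) U(1) by (intro sp.span_minimal) auto
    show "U \<subseteq> sp.span (A \<union> B)" using B(3) sp.span_mono[of B "A \<union> B"] by blast
  qed
  have "Q.dimension (sp.dim U - sp.dim A) ?K (?\<pi> ` U)"
    using main[OF B(1,2)] unfolding AB by blast
  then show ?thesis
    using Q.dimI[OF K] unfolding codim_def A_def over_def by blast
qed

section \<open>The degree bound\<close>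

lemma hilbert_function_eq:
  assumes "ideal I (mpoly_ring n)" "I \<noteq> C"
  shows "hilbert_function n I = HF (hpart I)"
  unfolding hilbert_function_def HF_hpart
  by (rule ext) (rule ring_dim_coset_image[OF assms subspace_P fin_dim_P P_subset_C])

lemma coset_image_C:
  fixes I :: "'k::field mpoly set"
  assumes I: "ideal I (mpoly_ring n)" and T: "\<And>d. d > T \<Longrightarrow> hpart I d = P d"
  shows "carrier (mpoly_ring n Quot I) = coset I ` P_le T"
proof
  show "coset I ` P_le T \<subseteq> carrier (mpoly_ring n Quot I)"
    using quot_hom(3)[OF I] P_le_subset_C by blast
  show "carrier (mpoly_ring n Quot I) \<subseteq> coset I ` P_le T"
  proof
    fix a assume "a \<in> carrier (mpoly_ring n Quot I)"
    then obtain p where p: "p \<in> C" "a = coset I p" by (rule quot_carrier[OF I])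
    obtain D where D: "p \<in> P_le D" using C_P_le[OF p(1)] by blast
    define q where "q = (\<Sum>d\<le>T. hcomp d p)"
    have "q \<in> P_le T"
      unfolding q_def
    proof (rule sp.subspace_sum[OF subspace_P_le])
      fix d assume "d \<in> {..T}"
      then show "hcomp d p \<in> P_le T" by (intro subsetD[OF P_subset_P_le hcomp_in_P[OF p(1)]]) simp
    qed
    moreover have "p - q \<in> I"
    proof -
      have "{..max D T} = {..T} \<union> {T<..max D T}" by auto
      then have "(\<Sum>d\<le>max D T. hcomp d p) = q + (\<Sum>d\<in>{T<..max D T}. hcomp d p)"
        unfolding q_def by (simp only:) (rule sum.union_disjoint, auto)
      moreover have "p = (\<Sum>d\<le>max D T. hcomp d p)" by (rule P_le_sum_hcomp[OF D]) simp
      ultimately have "p = q + (\<Sum>d\<in>{T<..max D T}. hcomp d p)" by (rule trans[rotated])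
      then have "p - q = (\<Sum>d\<in>{T<..max D T}. hcomp d p)" by (metis add_diff_cancel_left')
      also have "\<dots> \<in> I"
      proof (rule sp.subspace_sum[OF ideal_subspace[OF I]])
        fix d assume "d \<in> {T<..max D T}"
        then have "hcomp d p \<in> hpart I d" using T hcomp_in_P[OF p(1)] by simp
        then show "hcomp d p \<in> I" unfolding hpart_def by blast
      qed
      finally show ?thesis .
    qed
    then have "a = coset I q" using p(2) coset_eq_iff[OF I] by simp
    ultimately show "a \<in> coset I ` P_le T" by blast
  qed
qed

text \<open>In positive dimension both sides are the same expression in the Hilbert polynomial. In
  dimension 0 the quotient is the image of some \<open>P_le N\<close>, and the filtration estimate
  bounds its dimension by the sum of the Hilbert function.\<close>

lemma ideal_degree_le_gmult:
  fixes F :: "'k::field mpoly set"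
  assumes F: "F \<subseteq> C" "\<And>f. f \<in> F \<Longrightarrow> homogeneous f" and I: "I = Idl\<^bsub>mpoly_ring n\<^esub> F" "I \<noteq> C"
  shows "ideal_degree n I \<le> gmult (hpart I)"
proof -
  have ideal: "ideal I (mpoly_ring n)"
    unfolding I(1) by (rule ring.genideal_ideal[OF mpoly_ring_ring F(1)])
  note g = gideal_hpart[OF ideal]
  have D: "the_enat (krull_dim (mpoly_ring n Quot I)) = gdim (hpart I)"
    using krull_dim_quot[OF F I] by simp
  show ?thesis
  proof (cases "gdim (hpart I) = 0")
    case False
    have "hilbert_polynomial n I = hp (hpart I)"
      unfolding hilbert_polynomial_def hp_def is_hilb_def hilbert_function_eq[OF ideal I(2)] ..
    then show ?thesis using False by (simp add: ideal_degree_def D gmult_def Let_def)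
  next
    case True
    obtain N where N: "\<And>d. d \<ge> N \<Longrightarrow> HF (hpart I) d = 0" using gdim_0_HF[OF g True] by blast
    have top: "hpart I d = P d" if "d > N" for d
    proof (rule HF_le_eq[OF g gideal_P])
      show "hpart I \<le> P" unfolding le_fun_def hpart_def by blast
      show "HF (hpart I) d \<le> HF P d" using N[of d] that by simp
    qed
    have "ring.dim (mpoly_ring n Quot I) (quot_consts n I) (carrier (mpoly_ring n Quot I))
        = codim (P_le N) I"
      using ring_dim_coset_image[OF ideal I(2) subspace_P_le fin_dim_P_le P_le_subset_C, of N]
        coset_image_C[OF ideal, of N, OF top] by metis
    then have "ideal_degree n I = of_nat (codim (P_le N) I)"
      unfolding ideal_degree_def D using True by (simp add: Let_def)
    also have "\<dots> \<le> of_nat (\<Sum>d\<le>N. HF (hpart I) d)"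
      using codim_P_le_sum[OF ideal] by (simp only: of_nat_le_iff)
    also have "\<dots> = gmult (hpart I)"
      using gmult_gdim_0[OF True, of "Suc N"] N unfolding lessThan_Suc_atMost by simp
    finally show ?thesis .
  qed
qed

text \<open>A power of a linear form outside \<open>Q\<close> lifts \<open>f\<close> to degree
  \<open>a\<close> and can be cancelled modulo \<open>Q\<close>. This allows a generator of lower
  degree to be tested through its multiples in degree \<open>a\<close>.\<close>

lemma gprime_cancel_forms:
  assumes Q: "gprime Q" "gdim Q \<noteq> 0" and f: "f \<in> P b" and "b \<le> a"
    and mult: "\<And>w. w \<in> P (a - b) \<Longrightarrow> w * f \<in> Q a"
  shows "f \<in> Q b"
proof -
  obtain l where l: "l \<in> P 1" "l \<notin> Q 1"
    using ex_linear_form_notin[OF gprime_gideal[OF Q(1)] Q(2)] by blast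
  have "l ^ (a - b) \<in> P (a - b)" using P_power[OF l(1), of "a - b"] by simp
  then have "l ^ (a - b) * f \<in> Q ((a - b) * 1 + b)" using mult \<open>b \<le> a\<close> by simp
  then show ?thesis by (rule regular_power[OF l(1) gprime_colon[OF Q(1) l] f])
qed

text \<open>The \<open>j\<close>-th parameter is \<open>f j\<close> plus a generic combination of the later generators, so that the
  parameters chosen so far together with the remaining generators still generate the ideal.\<close>

lemma ex_parameters:
  fixes f :: "nat \<Rightarrow> 'k::field mpoly"
  assumes inf: "infinite (UNIV :: 'k set)"
    and f: "\<forall>i\<in>{1..k}. f i \<in> P (d i) \<and> d i \<noteq> 0"
    and dec: "\<forall>i j. 1 \<le> i \<longrightarrow> i \<le> j \<longrightarrow> j \<le> k \<longrightarrow> d j \<le> d i"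
    and J: "gideal J" "\<forall>i\<in>{1..k}. f i \<in> J (d i)"
    and least: "\<forall>K. gideal K \<longrightarrow> (\<forall>i\<in>{1..k}. f i \<in> K (d i)) \<longrightarrow> J \<le> K"
    and "j \<le> n - gdim J"
  shows "\<exists>H. fml H \<and> (\<forall>i\<in>{1..j}. fst (H i) = d i \<and> snd (H i) \<in> J (d i)) \<and>
    j \<le> k \<and> gdim (Gen (H ` {1..j})) = n - j \<and>
    (\<forall>K. gideal K \<longrightarrow> (\<forall>i\<in>{1..j}. snd (H i) \<in> K (d i)) \<longrightarrow> (\<forall>i\<in>{Suc j..k}. f i \<in> K (d i)) \<longrightarrow> J \<le> K)"
  using assms(7)
proof (induction j)
  case 0
  show ?case
    using fml_var Gen_empty_gdim[where 'k = 'k] least by (intro exI[of _ var_fml]) auto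
next
  case (Suc j)
  then obtain H where H: "fml H" "\<forall>i\<in>{1..j}. fst (H i) = d i \<and> snd (H i) \<in> J (d i)" "j \<le> k"
      "gdim (Gen (H ` {1..j})) = n - j"
    and gen: "\<And>K. gideal K \<Longrightarrow> (\<forall>i\<in>{1..j}. snd (H i) \<in> K (d i)) \<Longrightarrow>
      (\<forall>i\<in>{Suc j..k}. f i \<in> K (d i)) \<Longrightarrow> J \<le> K"
    by auto
  have jn: "j < n" "gdim J < n - j" using Suc.prems by auto
  have sub: "{1..j} \<subseteq> {1..n}" "insert (Suc j) {1..j} \<subseteq> {1..n}" "insert (Suc j) {1..j} = {1..Suc j}"
    using jn(1) by auto
  define L where "L = Gen (H ` {1..j})"
  have L: "gideal L" unfolding L_def by (rule gideal_Gen_fml[OF H(1) sub(1)])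
  have HL: "snd (H i) \<in> L (d i)" if "i \<in> {1..j}" for i
    unfolding L_def
    by (rule mem_Gen) (use H(2) that in \<open>metis imageI prod.collapse\<close>)
  \<comment> \<open>With no generator left, the parameters so far would generate an ideal containing
    \<open>J\<close>, yet its dimension \<open>n - j\<close> still exceeds
    \<open>gdim J\<close>.\<close>
  have Suc_k: "Suc j \<le> k"
  proof (rule ccontr)
    assume "\<not> ?thesis"
    then have "J \<le> L" using HL by (intro gen[OF L]) auto
    then have "gdim L \<le> gdim J" by (rule gdim_antimono[OF J(1) L])
    then show False using H(4) jn unfolding L_def by simp
  qed
  define a where "a = d (Suc j)"
  \<comment> \<open>The ideal of the generators still to come; its forms of degree \<open>a\<close>
    are the admissible corrections of \<open>f (Suc j)\<close>.\<close>
  define G where "G = Gen ((\<lambda>i. (d i, f i)) ` {Suc (Suc j)..k})"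
  have G: "gideal G"
    unfolding G_def by (rule gideal_Gen) (use f in \<open>auto simp: forms_def\<close>)
  have fG: "f i \<in> G (d i)" if "i \<in> {Suc (Suc j)..k}" for i
    unfolding G_def by (rule mem_Gen) (use that in auto)
  have G_least: "G \<le> K" if "gideal K" "\<forall>i\<in>{Suc (Suc j)..k}. f i \<in> K (d i)" for K
    unfolding G_def by (rule Gen_least[OF that(1)]) (use that(2) in auto)
  have fa: "f (Suc j) \<in> P a" "f (Suc j) \<in> J a" "a \<noteq> 0"
    using f J(2) Suc_k unfolding a_def by auto
  have "\<exists>w\<in>G a. \<forall>K\<in>{L}. gdim (adj K a (f (Suc j) + w)) < gdim K"
  proof (rule generic_element[OF inf _ _ gideal_subspace[OF G] gideal_subset[OF G] fa(1)])
    show "gideal K \<and> gdim K \<noteq> 0" if "K \<in> {L}" for K using that L H(4) jn unfolding L_def by simp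
    fix K Q :: "'k family"
    assume "K \<in> {L}" and Q: "gprime Q" and KQ: "K \<le> Q" "gdim Q = gdim K"
    then have LQ: "L \<le> Q" "gdim Q = n - j" using H(4) unfolding L_def by auto
    show "\<exists>w\<in>G a. f (Suc j) + w \<notin> Q a"
    proof (rule ccontr)
      assume "\<not> ?thesis"
      \<comment> \<open>If the whole coset lay in \<open>Q\<close>, then so would
        \<open>f (Suc j)\<close> and all of \<open>G a\<close>, hence all remaining generators.
        \<open>Q\<close> would contain \<open>J\<close>, although its dimension \<open>n - j\<close>
        is too large for that.\<close>
      then have all: "f (Suc j) + w \<in> Q a" if "w \<in> G a" for w using that by blast
      note g = gprime_gideal[OF Q]
      have f0: "f (Suc j) \<in> Q a" using all[OF gideal_zero[OF G]] by simp
      have GQ: "w \<in> Q a" if "w \<in> G a" for w using gideal_add_left[OF g f0 all[OF that]] .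
      have "f i \<in> Q (d i)" if i: "i \<in> {Suc j..k}" for i
      proof (cases "i = Suc j")
        case True
        then show ?thesis using f0 unfolding a_def by simp
      next
        case False
        then have i': "i \<in> {Suc (Suc j)..k}" "i \<in> {1..k}" using i by auto
        \<comment> \<open>The descending order of the degrees is what gives later generators
          multiples in degree \<open>a\<close>.\<close>
        have le: "d i \<le> a" unfolding a_def using dec i by simp
        show ?thesis
        proof (rule gprime_cancel_forms[OF Q _ conjunct1[OF bspec[OF f i'(2)]] le])
          show "gdim Q \<noteq> 0" using LQ(2) jn by simp
          show "w * f i \<in> Q a" if "w \<in> P (a - d i)" for w
            using gideal_mult[OF G that fG[OF i'(1)]] le by (intro GQ) simp
        qed
      qed
      moreover have "snd (H i) \<in> Q (d i)" if "i \<in> {1..j}" for i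
        using HL[OF that] LQ(1) by (auto simp: le_fun_def)
      ultimately have "J \<le> Q" using gen[OF g] by blast
      then have "gdim Q \<le> gdim J" by (rule gdim_antimono[OF J(1) g])
      then show False using LQ(2) jn by simp
    qed
  qed simp
  then obtain w where w: "w \<in> G a" "gdim (adj L a (f (Suc j) + w)) < gdim L" by blast
  define x where "x = f (Suc j) + w"
  have x: "x \<in> P a" unfolding x_def using P_add[OF fa(1)] gideal_in_P[OF G w(1)] by blast
  have dim: "gdim (adj L a x) = n - Suc j"
    using w(2) gdim_adj_ge[OF L x fa(3)] H(4) unfolding x_def[symmetric] L_def by simp
  have "G \<le> J" using J(2) by (intro G_least[OF J(1)]) auto
  then have xJ: "x \<in> J a" unfolding x_def using gideal_add[OF J(1) fa(2)] w(1) by (auto simp: le_fun_def)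
  define H' where "H' = H(Suc j := (a, x))"
  have H': "fml H'" unfolding H'_def by (rule fml_upd[OF H(1) fa(3) x])
  have im: "H' ` {1..j} = H ` {1..j}" unfolding H'_def by auto
  have H'j: "H' (Suc j) = (a, x)" unfolding H'_def by simp
  show ?case
  proof (intro exI[of _ H'] conjI allI impI)
    show "fml H'" by (rule H')
    show "\<forall>i\<in>{1..Suc j}. fst (H' i) = d i \<and> snd (H' i) \<in> J (d i)"
      using H(2) xJ unfolding H'_def a_def by (auto simp: le_Suc_eq)
    show "Suc j \<le> k" by (rule Suc_k)
    show "gdim (Gen (H' ` {1..Suc j})) = n - Suc j"
      using Gen_fml_insert[OF H' sub(2)] dim unfolding im H'j sub(3) L_def by simp
    fix K :: "'k family"
    assume K: "gideal K" and 1: "\<forall>i\<in>{1..Suc j}. snd (H' i) \<in> K (d i)"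
      and 2: "\<forall>i\<in>{Suc (Suc j)..k}. f i \<in> K (d i)"
    have "x \<in> K a" using 1 H'j unfolding a_def by force
    moreover have "w \<in> K a" using G_least[OF K 2] w(1) by (auto simp: le_fun_def)
    \<comment> \<open>The correction lies in the ideal of the later generators, so the replaced
      generator is recovered from the new parameter.\<close>
    ultimately have "x - w \<in> K a" by (rule gideal_diff[OF K])
    then have fK: "f (Suc j) \<in> K a" unfolding x_def by simp
    show "J \<le> K"
    proof (rule gen[OF K])
      show "\<forall>i\<in>{1..j}. snd (H i) \<in> K (d i)"
      proof
        fix i assume "i \<in> {1..j}"
        then show "snd (H i) \<in> K (d i)" using bspec[OF 1, of i] unfolding H'_def by simp
      qed
      show "\<forall>i\<in>{Suc j..k}. f i \<in> K (d i)"
      proof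
        fix i assume "i \<in> {Suc j..k}"
        then show "f i \<in> K (d i)" using 2 fK unfolding a_def by (cases "i = Suc j") auto
      qed
    qed
  qed
qed

end

theorem theorem4p5:
  fixes f :: "nat \<Rightarrow> ('k::field) mpoly"
    and d :: "nat \<Rightarrow> nat"
    and n k D :: nat
    and I :: "'k mpoly set"
  assumes "infinite (UNIV :: 'k set)"
    and "\<And>i. i \<in> {1..k} \<Longrightarrow> f i \<in> carrier (mpoly_ring n)"
    and "\<And>i. i \<in> {1..k} \<Longrightarrow> f i \<noteq> 0"
    and "\<And>i. i \<in> {1..k} \<Longrightarrow> homogeneous (f i)"
    and "\<And>i. i \<in> {1..k} \<Longrightarrow> d i = total_degree (f i)"
    and "\<And>i j. 1 \<le> i \<Longrightarrow> i \<le> j \<Longrightarrow> j \<le> k \<Longrightarrow> d j \<le> d i"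
    and "I = Idl\<^bsub>mpoly_ring n\<^esub> (f ` {1..k})"
    and "I \<noteq> carrier (mpoly_ring n)"
    and "krull_dim (mpoly_ring n Quot I) = enat D"
  shows "ideal_degree n I \<le> of_nat (\<Prod>i = 1..n - D. d i)"
proof -
  interpret poly_vars n .
  have F: "f ` {1..k} \<subseteq> C" "\<And>g. g \<in> f ` {1..k} \<Longrightarrow> homogeneous g" using assms(2,4) by auto
  define J where "J = hpart I"
  have ideal: "ideal I (mpoly_ring n)" unfolding assms(7) by (rule ring.genideal_ideal[OF mpoly_ring_ring F(1)])
  have J: "gideal J" unfolding J_def by (rule gideal_hpart[OF ideal])
  have D: "gdim J = D" using krull_dim_quot[OF F assms(7,8)] assms(9) unfolding J_def by simp
  have fP: "f i \<in> P (d i)" if "i \<in> {1..k}" for i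
    using homogeneous_in_P[OF assms(2)[OF that] assms(4)[OF that]] assms(5)[OF that] by simp
  have fJ: "f i \<in> J (d i)" if "i \<in> {1..k}" for i
    using fP[OF that] ring.genideal_self[OF mpoly_ring_ring F(1)] that unfolding J_def hpart_def assms(7) by blast
  have "J \<noteq> P" unfolding J_def by (rule hpart_neq_P[OF ideal assms(8)])
  then have J0: "J 0 = {0}" by (rule gideal_degree_0[OF J])
  \<comment> \<open>A nonzero form of degree 0 is a unit, which a proper ideal does not
    contain.\<close>
  have d0: "d i \<noteq> 0" if "i \<in> {1..k}" for i
    using fJ[OF that] assms(3)[OF that] J0 by (metis singletonD)
  have least: "J \<le> K" if K: "gideal K" "\<And>i. i \<in> {1..k} \<Longrightarrow> f i \<in> K (d i)" for K
    unfolding J_def assms(7)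
    by (rule gideal_hpart_least[OF F K(1)]) (use K(2) assms(5) in auto)
  \<comment> \<open>The exponent stays in the form \<open>n - (n - D)\<close> until
    \<open>D \<le> n\<close> is available.\<close>
  have "\<exists>H. fml H \<and> (\<forall>i\<in>{1..n - D}. fst (H i) = d i \<and> snd (H i) \<in> J (d i)) \<and>
      gdim (Gen (H ` {1..n - D})) = n - (n - D)"
    using ex_parameters[of k f d J "n - D", OF assms(1) _ _ J] fP d0 assms(6) fJ least
    unfolding D by fast
  then obtain H where H: "fml H" "\<forall>i\<in>{1..n - D}. fst (H i) = d i \<and> snd (H i) \<in> J (d i)"
      "gdim (Gen (H ` {1..n - D})) = n - (n - D)" by blast
  \<comment> \<open>\<open>J\<close> contains the zero ideal, whose dimension is \<open>n\<close>;
    this bounds \<open>D\<close>.\<close>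
  have "gdim J \<le> gdim (Gen {} :: 'k family)"
    using gideal_zero[OF J] by (intro gdim_antimono J gideal_Gen) (auto simp: Gen_empty forms_def le_fun_def)
  then have Dn: "D \<le> n" unfolding Gen_empty_gdim D .
  have "ideal_degree n I \<le> gmult J"
    unfolding J_def by (rule ideal_degree_le_gmult[OF F assms(7,8)])
  also have "\<dots> \<le> of_nat (\<Prod>i = 1..n - D. fst (H i))"
  proof (rule gmult_le_prod[OF assms(1) H(1) _ H(3) J])
    show "n - D \<le> n" by simp
    show "Gen (H ` {1..n - D}) \<le> J"
    proof (rule Gen_least[OF J])
      fix a x assume "(a, x) \<in> H ` {1..n - D}"
      then obtain i where "i \<in> {1..n - D}" "(a, x) = H i" by blast
      then show "x \<in> J a" using bspec[OF H(2), of i] by (metis fst_conv snd_conv)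
    qed
    show "gdim J = n - (n - D)" using D Dn by simp
  qed
  also have "(\<Prod>i = 1..n - D. fst (H i)) = (\<Prod>i = 1..n - D. d i)"
    using H(2) by (intro prod.cong) auto
  finally show ?thesis .
qed

end
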